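(* Let $\Sigma$ be a Riemann surface (not necessarily compact) and $\Sigma_0\subset\Sigma$ an open subset. For any holomorphic cubic form $\Xi$ on $\Sigma_0$ and any smooth hyperbolic metric $\tilde g$ on $\Sigma_0$ there is a unique special Kähler structure $(g,\nabla)$ on $\Sigma_0\setminus\Xi^{-1}(0)$ whose associated hyperbolic metric and associated cubic form are $\tilde g$ and $\Xi$ respectively. If $\Xi\not\equiv0$ is meromorphic on $\Sigma$ with divisor $(\Xi)=\sum_{p\in\Sigma}\operatorname{ord}_p\Xi\cdot p$ and $\tilde g$ is a hyperbolic metric on $\Sigma$ representing a divisor $D$, then for the special Kähler structure $(g,\nabla)$ determined by $(\tilde g,\Xi)$ on $\Sigma_0:=\Sigma\setminus(\operatorname{supp}(\Xi)\cup\operatorname{supp}D)$ the following holds: (i) a cusp singularity $p$ of $\tilde g$ is a logarithmic singularity of $(g,\nabla)$ of order $\tfrac12(\operatorname{ord}_p\Xi+1)$; (ii) a conical singularity $p$ of $\tilde g$ of order $\alpha$ is a conical singularity of $(g,\nabla)$ of order $\tfrac12(\operatorname{ord}_p\Xi-\alpha)$; (iii) $(g,\nabla)$ has a conical singularity of order $\tfrac12\operatorname{ord}_p\Xi$ at each point $p\in\operatorname{supp}(\Xi)\setminus\operatorname{supp}D$.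
   Context: Special Kähler structures. A special Kähler structure on a Riemann surface with complex structure $I$ is a pair $(g,\nabla)$, where $g$ is a Kähler metric with symplectic form $\omega(\cdot,\cdot)=g(I\cdot,\cdot)$ and $\nabla$ is a flat, torsion-free connection on the tangent bundle with $\nabla\omega=0$ and $(\nabla_XI)Y=(\nabla_YI)X$ for all vector fields $X,Y$. Locally there is a pair $(Z,W)$ of conjugate special holomorphic coordinates, i.e. holomorphic functions with $\nabla(\mathrm{Re}\,dZ)=0=\nabla(\mathrm{Re}\,dW)$ and $\omega=-\mathrm{Re}\,dZ\wedge\mathrm{Re}\,dW$. The period map $\tau=dW/dZ$ takes values in the upper half-plane $\mathcal H$ and is locally defined up to the action of $SL(2,\mathbb R)$. The associated hyperbolic metric is $\tilde g:=\tau^*g_{\mathcal H}$, where $g_{\mathcal H}=(\mathrm{Im}\,z)^{-2}|dz|^2$. The associated cubic form is the holomorphic cubic differential $\Xi=\frac14\frac{d\tau}{dZ}\,dZ^3$; it does not depend on the choice of $(Z,W)$. Hyperbolic metrics. A metric is hyperbolic if its Gaussian curvature is $-1$. A hyperbolic metric $\tilde g$ on $\Sigma$ represents a divisor $D=\sum_{j=1}^n(\alpha_j-1)p_j$, $0\le\alpha_j\ne1$, if it is smooth on $\Sigma\setminus\{p_1,\dots,p_n\}$ and at each $p_j$ it has a cusp if $\alpha_j=0$, and a conical singularity of order $\alpha_j-1$ (cone angle $2\pi\alpha_j$) if $\alpha_j>0$. In a local holomorphic coordinate $z$ centered at the point, $r=|z|$: a conical singularity of order $\alpha>-1$ means $\tilde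 g=r^{2\alpha}(C+o(1))|dz|^2$, and a cusp means $\tilde g=\frac{C+o(1)}{(r\log r)^2}|dz|^2$, with a constant $C>0$. Singularities of special Kähler structures. Let $z=x+iy=re^{i\theta}$, $\rho=\log r$, $\mathbf 1_2=\begin{pmatrix}1&0\\ 0&1\end{pmatrix}$, $\mathrm I_2=\begin{pmatrix}0&-1\\ 1&0\end{pmatrix}$; $\omega_\nabla$ is the connection 1-form with respect to $(\partial_x,\partial_y)$. At a point $p$, in a local holomorphic coordinate $z$ centered at $p$: $(g,\nabla)$ has a conical singularity of order $\frac12\beta$, $\beta\in\mathbb R$, if it is asymptotic to $g^c_\beta=r^\beta|dz|^2$, $\omega^c_{\beta,\nabla}=\frac\beta2(\mathbf 1_2d\rho+\mathrm I_2d\theta)$, i.e. $g=r^\beta(C+o(1))|dz|^2$ with $C>0$ and $\omega_\nabla=\omega^c_{\beta,\nabla}+o(r^{-1})$. It has a logarithmic singularity of order $\frac12k$, $k\in\mathbb Z$, if for some $b\in\mathbb C\setminus\{0\}$, with $R=\mathrm{Re}(\frac b{|b|}e^{ik\theta})$, $J=\mathrm{Im}(\frac b{|b|}e^{ik\theta})$, it is asymptotic to $g_k=-|b|r^k\log r|dz|^2$ and $$\omega_{k,\nabla}=\tfrac12\Big(k\mathrm I_2+\begin{pmatrix}J&-1+R\\ 1+R&-J\end{pmatrix}\rho^{-1}\Big)d\theta+\tfrac12\Big(k\mathbf 1_2+\begin{pmatrix}1-R&J\\ J&1+R\end{pmatrix}\rho^{-1}\Big)d\rho,$$ i.e. $g=-r^k\log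 r\,(C+o(1))|dz|^2$ with $C>0$ and $\omega_\nabla=\omega_{k,\nabla}+o((r|\log r|)^{-1})$. *)

theory Defs
  imports "HOL-Complex_Analysis.Complex_Analysis" "HOL-Library.Landau_Symbols"
begin

section \<open>Smooth functions\<close>

primrec Ck_on :: "nat \<Rightarrow> 'a::real_normed_vector set \<Rightarrow> ('a \<Rightarrow> 'b::real_normed_vector) \<Rightarrow> bool" where
  "Ck_on 0 U f \<longleftrightarrow> continuous_on U f"
| "Ck_on (Suc k) U f \<longleftrightarrow> (\<forall>x\<in>U. f differentiable (at x)) \<and>
     (\<forall>v. Ck_on k U (\<lambda>x. frechet_derivative f (at x) v))"

text \<open>Only used on open subsets of finite-dimensional spaces.\<close>

definition smooth_on :: "'a::real_normed_vector set \<Rightarrow> ('a \<Rightarrow> 'b::real_normed_vector) \<Rightarrow> bool" where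
  "smooth_on U f \<longleftrightarrow> (\<forall>k. Ck_on k U f)"


section \<open>Local differential geometry on open subsets of the plane\<close>

text \<open>
  The plane is identified with \<open>complex\<close>; the frame \<open>(\<partial>\<^sub>x, \<partial>\<^sub>y)\<close> is \<open>(1, \<i>)\<close> and the complex
  structure is multiplication by \<open>\<i>\<close>. Vector fields are functions \<open>complex \<Rightarrow> complex\<close>.
  A metric \<open>G\<close> is given by \<open>G z u v\<close>, where \<open>u\<close> and \<open>v\<close> are tangent vectors at \<open>z\<close>.
  A connection is given by its connection 1-form \<open>\<Gamma>\<close> in the frame \<open>(\<partial>\<^sub>x, \<partial>\<^sub>y)\<close>:
  \<open>\<Gamma> z \<xi>\<close> is the endomorphism of the tangent space obtained by
  evaluating the connection 1-form at \<open>z\<close> on \<open>\<xi>\<close>.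
\<close>

type_synonym local_metric = "complex \<Rightarrow> complex \<Rightarrow> complex \<Rightarrow> real"
type_synonym local_connection = "complex \<Rightarrow> complex \<Rightarrow> complex \<Rightarrow> complex"
type_synonym vfield = "complex \<Rightarrow> complex"

definition is_hermitian_metric :: "complex set \<Rightarrow> local_metric \<Rightarrow> bool" where
  "is_hermitian_metric U G \<longleftrightarrow>
     (\<forall>u v. smooth_on U (\<lambda>z. G z u v)) \<and>
     (\<forall>z\<in>U. bilinear (G z) \<and>
        (\<forall>u v. G z u v = G z v u) \<and>
        (\<forall>u. u \<noteq> 0 \<longrightarrow> G z u u > 0) \<and>
        (\<forall>u v. G z (\<i> * u) (\<i> * v) = G z u v))"

definition symplectic_form :: "local_metric \<Rightarrow> local_metric" where
  "symplectic_form G z u v = G z (\<i> * u) v"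

definition is_connection :: "complex set \<Rightarrow> local_connection \<Rightarrow> bool" where
  "is_connection U \<Gamma> \<longleftrightarrow>
     (\<forall>u v. smooth_on U (\<lambda>z. \<Gamma> z u v)) \<and> (\<forall>z\<in>U. bilinear (\<Gamma> z))"

definition dir_deriv :: "(complex \<Rightarrow> 'b::real_normed_vector) \<Rightarrow> vfield \<Rightarrow> complex \<Rightarrow> 'b" where
  "dir_deriv f X z = frechet_derivative f (at z) (X z)"

definition cov :: "local_connection \<Rightarrow> vfield \<Rightarrow> vfield \<Rightarrow> vfield" where
  "cov \<Gamma> X Y z = dir_deriv Y X z + \<Gamma> z (X z) (Y z)"

definition lie_bracket :: "vfield \<Rightarrow> vfield \<Rightarrow> vfield" where
  "lie_bracket X Y z = dir_deriv Y X z - dir_deriv X Y z"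

definition curvature :: "local_connection \<Rightarrow> vfield \<Rightarrow> vfield \<Rightarrow> vfield \<Rightarrow> vfield" where
  "curvature \<Gamma> X Y V z =
     cov \<Gamma> X (cov \<Gamma> Y V) z - cov \<Gamma> Y (cov \<Gamma> X V) z - cov \<Gamma> (lie_bracket X Y) V z"

definition flat_on :: "complex set \<Rightarrow> local_connection \<Rightarrow> bool" where
  "flat_on U \<Gamma> \<longleftrightarrow> (\<forall>X Y V. smooth_on U X \<and> smooth_on U Y \<and> smooth_on U V \<longrightarrow>
     (\<forall>z\<in>U. curvature \<Gamma> X Y V z = 0))"

definition torsion_free_on :: "complex set \<Rightarrow> local_connection \<Rightarrow> bool" where
  "torsion_free_on U \<Gamma> \<longleftrightarrow> (\<forall>X Y. smooth_on U X \<and> smooth_on U Y \<longrightarrow>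
     (\<forall>z\<in>U. cov \<Gamma> X Y z - cov \<Gamma> Y X z = lie_bracket X Y z))"

text \<open>\<open>\<nabla>b = 0\<close> for a field \<open>b\<close> of bilinear forms (a metric or a 2-form):\<close>

definition parallel_bilinear_on ::
  "complex set \<Rightarrow> local_connection \<Rightarrow> (complex \<Rightarrow> complex \<Rightarrow> complex \<Rightarrow> real) \<Rightarrow> bool" where
  "parallel_bilinear_on U \<Gamma> b \<longleftrightarrow>
     (\<forall>X Y V. smooth_on U X \<and> smooth_on U Y \<and> smooth_on U V \<longrightarrow>
       (\<forall>z\<in>U. dir_deriv (\<lambda>w. b w (Y w) (V w)) X z =
                b z (cov \<Gamma> X Y z) (V z) + b z (Y z) (cov \<Gamma> X V z)))"

text \<open>\<open>\<nabla>\<alpha> = 0\<close> for a real 1-form \<open>\<alpha>\<close>:\<close>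

definition parallel_form_on ::
  "complex set \<Rightarrow> local_connection \<Rightarrow> (complex \<Rightarrow> complex \<Rightarrow> real) \<Rightarrow> bool" where
  "parallel_form_on U \<Gamma> \<alpha> \<longleftrightarrow>
     (\<forall>X Y. smooth_on U X \<and> smooth_on U Y \<longrightarrow>
       (\<forall>z\<in>U. dir_deriv (\<lambda>w. \<alpha> w (Y w)) X z - \<alpha> z (cov \<Gamma> X Y z) = 0))"

text \<open>\<open>(\<nabla>\<^sub>X I) Y = \<nabla>\<^sub>X (I Y) - I (\<nabla>\<^sub>X Y)\<close>\<close>

definition cov_I :: "local_connection \<Rightarrow> vfield \<Rightarrow> vfield \<Rightarrow> vfield" where
  "cov_I \<Gamma> X Y z = cov \<Gamma> X (\<lambda>w. \<i> * Y w) z - \<i> * cov \<Gamma> X Y z"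

definition is_levi_civita :: "complex set \<Rightarrow> local_metric \<Rightarrow> local_connection \<Rightarrow> bool" where
  "is_levi_civita U G \<Gamma> \<longleftrightarrow>
     is_connection U \<Gamma> \<and> torsion_free_on U \<Gamma> \<and> parallel_bilinear_on U \<Gamma> G"

text \<open>Sectional curvature \<open>G(R(u,v)v,u) = K (|u|\<^sup>2 |v|\<^sup>2 - G(u,v)\<^sup>2)\<close> of the Levi-Civita connection,
  tested on constant vector fields.\<close>

definition has_gaussian_curvature :: "complex set \<Rightarrow> local_metric \<Rightarrow> (complex \<Rightarrow> real) \<Rightarrow> bool" where
  "has_gaussian_curvature U G K \<longleftrightarrow>
     (\<exists>\<Gamma>. is_levi_civita U G \<Gamma> \<and>
       (\<forall>z\<in>U. \<forall>u v. G z (curvature \<Gamma> (\<lambda>_. u) (\<lambda>_. v) (\<lambda>_. v) z) u =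
          K z * (G z u u * G z v v - (G z u v)\<^sup>2)))"

text \<open>A Hermitian metric in real dimension 2 is Kaehler: its symplectic form is closed
  because there are no nonzero 3-forms.\<close>

definition is_special_kaehler :: "complex set \<Rightarrow> local_metric \<Rightarrow> local_connection \<Rightarrow> bool" where
  "is_special_kaehler U G \<Gamma> \<longleftrightarrow>
     is_hermitian_metric U G \<and> is_connection U \<Gamma> \<and>
     flat_on U \<Gamma> \<and> torsion_free_on U \<Gamma> \<and>
     parallel_bilinear_on U \<Gamma> (symplectic_form G) \<and>
     (\<forall>X Y. smooth_on U X \<and> smooth_on U Y \<longrightarrow> (\<forall>z\<in>U. cov_I \<Gamma> X Y z = cov_I \<Gamma> Y X z))"

definition re_d :: "(complex \<Rightarrow> complex) \<Rightarrow> complex \<Rightarrow> complex \<Rightarrow> real" where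
  "re_d Z z v = Re (deriv Z z * v)"

definition conjugate_coordinates ::
  "complex set \<Rightarrow> local_metric \<Rightarrow> local_connection \<Rightarrow>
   (complex \<Rightarrow> complex) \<Rightarrow> (complex \<Rightarrow> complex) \<Rightarrow> bool" where
  "conjugate_coordinates V G \<Gamma> Z W \<longleftrightarrow>
     Z holomorphic_on V \<and> W holomorphic_on V \<and>
     parallel_form_on V \<Gamma> (re_d Z) \<and> parallel_form_on V \<Gamma> (re_d W) \<and>
     (\<forall>z\<in>V. \<forall>u v. symplectic_form G z u v =
        - (re_d Z z u * re_d W z v - re_d Z z v * re_d W z u))"

definition period_map :: "(complex \<Rightarrow> complex) \<Rightarrow> (complex \<Rightarrow> complex) \<Rightarrow> complex \<Rightarrow> complex" where
  "period_map Z W z = deriv W z / deriv Z z"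

definition upper_half_plane_metric :: local_metric where
  "upper_half_plane_metric w u v = (u \<bullet> v) / (Im w)\<^sup>2"

definition pullback_metric :: "(complex \<Rightarrow> complex) \<Rightarrow> local_metric \<Rightarrow> local_metric" where
  "pullback_metric f G z u v = G (f z) (deriv f z * u) (deriv f z * v)"

text \<open>Coefficient of \<open>dz\<^sup>3\<close> in \<open>(1/4) (d\<tau>/dZ) dZ\<^sup>3\<close>:\<close>

definition period_cubic ::
  "(complex \<Rightarrow> complex) \<Rightarrow> (complex \<Rightarrow> complex) \<Rightarrow> complex \<Rightarrow> complex" where
  "period_cubic Z W z = 1/4 * (deriv (period_map Z W) z / deriv Z z) * (deriv Z z) ^ 3"


section \<open>Riemann surfaces\<close>

text \<open>A chart is a pair of its domain and a coordinate function (irrelevant off the domain).\<close>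

type_synonym 'a chart = "'a set \<times> ('a \<Rightarrow> complex)"

definition is_chart :: "'a::topological_space chart \<Rightarrow> bool" where
  "is_chart c \<longleftrightarrow> open (fst c) \<and> open (snd c ` fst c) \<and>
     (\<exists>\<psi>. homeomorphism (fst c) (snd c ` fst c) (snd c) \<psi>)"

definition img :: "'a chart \<Rightarrow> 'a set \<Rightarrow> complex set" where
  "img c S = snd c ` (fst c \<inter> S)"

definition transition :: "'a chart \<Rightarrow> 'a chart \<Rightarrow> complex \<Rightarrow> complex" where
  "transition c d z = snd d (the_inv_into (fst c) (snd c) z)"

definition compatible :: "'a chart \<Rightarrow> 'a chart \<Rightarrow> bool" where
  "compatible c d \<longleftrightarrow>
     transition c d holomorphic_on img c (fst d) \<and> transition d c holomorphic_on img d (fst c)"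

definition riemann_surface :: "'a::t2_space chart set \<Rightarrow> bool" where
  "riemann_surface A \<longleftrightarrow>
     connected (UNIV :: 'a set) \<and> (\<Union>c\<in>A. fst c) = UNIV \<and>
     (\<forall>c\<in>A. is_chart c) \<and> (\<forall>c\<in>A. \<forall>d\<in>A. compatible c d)"

text \<open>All local holomorphic coordinates, i.e. the maximal atlas:\<close>

definition charts :: "'a::topological_space chart set \<Rightarrow> 'a chart set" where
  "charts A = {c. is_chart c \<and> (\<forall>d\<in>A. compatible c d)}"

definition centered_at :: "'a::topological_space chart set \<Rightarrow> 'a \<Rightarrow> 'a chart \<Rightarrow> bool" where
  "centered_at A p c \<longleftrightarrow> c \<in> charts A \<and> p \<in> fst c \<and> snd c p = 0"


section \<open>Metrics, connections and cubic forms on a Riemann surface\<close>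

text \<open>
  A tensor field or a connection on an open set \<open>S\<close> is the family of its local expressions in all
  charts \<open>c\<close>, each relevant only on \<open>img c S\<close>, subject to the transformation law under
  change of coordinates.
\<close>

type_synonym 'a metric = "'a chart \<Rightarrow> local_metric"
type_synonym 'a connection = "'a chart \<Rightarrow> local_connection"
type_synonym 'a cubic = "'a chart \<Rightarrow> complex \<Rightarrow> complex"

definition metric_law :: "'a::topological_space chart set \<Rightarrow> 'a set \<Rightarrow> 'a metric \<Rightarrow> bool" where
  "metric_law A S g \<longleftrightarrow>
     (\<forall>c\<in>charts A. \<forall>d\<in>charts A. \<forall>z\<in>img c (fst d \<inter> S). \<forall>u v.
        g c z u v = pullback_metric (transition c d) (g d) z u v)"

text \<open>With \<open>t = transition c d\<close>, a vector field \<open>Y\<close> in the chart \<open>c\<close> reads \<open>t' Y\<close> in the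
  chart \<open>d\<close>; differentiating \<open>t' Y\<close> gives the inhomogeneous term \<open>t'' u v\<close>.\<close>

definition connection_law :: "'a::topological_space chart set \<Rightarrow> 'a set \<Rightarrow> 'a connection \<Rightarrow> bool" where
  "connection_law A S \<Gamma> \<longleftrightarrow>
     (\<forall>c\<in>charts A. \<forall>d\<in>charts A. \<forall>z\<in>img c (fst d \<inter> S). \<forall>u v.
        let t = transition c d in
        deriv t z * \<Gamma> c z u v =
          deriv (deriv t) z * u * v + \<Gamma> d (t z) (deriv t z * u) (deriv t z * v))"

text \<open>\<open>\<Xi> c\<close> is the coefficient of \<open>dz\<^sup>3\<close> in the chart \<open>c\<close>.\<close>

definition cubic_law :: "'a::topological_space chart set \<Rightarrow> 'a set \<Rightarrow> 'a cubic \<Rightarrow> bool" where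
  "cubic_law A S \<Xi> \<longleftrightarrow>
     (\<forall>c\<in>charts A. \<forall>d\<in>charts A. \<forall>z\<in>img c (fst d \<inter> S).
        \<Xi> c z = \<Xi> d (transition c d z) * (deriv (transition c d) z) ^ 3)"

definition hyperbolic_metric :: "'a::topological_space chart set \<Rightarrow> 'a set \<Rightarrow> 'a metric \<Rightarrow> bool" where
  "hyperbolic_metric A S g \<longleftrightarrow> open S \<and> metric_law A S g \<and>
     (\<forall>c\<in>charts A. is_hermitian_metric (img c S) (g c) \<and>
        has_gaussian_curvature (img c S) (g c) (\<lambda>_. - 1))"

definition special_kaehler ::
  "'a::topological_space chart set \<Rightarrow> 'a set \<Rightarrow> 'a metric \<Rightarrow> 'a connection \<Rightarrow> bool" where
  "special_kaehler A S g \<Gamma> \<longleftrightarrow> open S \<and> metric_law A S g \<and> connection_law A S \<Gamma> \<and>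
     (\<forall>c\<in>charts A. is_special_kaehler (img c S) (g c) (\<Gamma> c))"

definition holomorphic_cubic :: "'a::topological_space chart set \<Rightarrow> 'a set \<Rightarrow> 'a cubic \<Rightarrow> bool" where
  "holomorphic_cubic A S \<Xi> \<longleftrightarrow> open S \<and> cubic_law A S \<Xi> \<and>
     (\<forall>c\<in>charts A. \<Xi> c holomorphic_on img c S)"

text \<open>The nice variant of meromorphy assigns the value 0 at poles and removes removable
  singularities, so that the transformation law makes sense at every point.\<close>

definition meromorphic_cubic :: "'a::topological_space chart set \<Rightarrow> 'a cubic \<Rightarrow> bool" where
  "meromorphic_cubic A \<Xi> \<longleftrightarrow> cubic_law A UNIV \<Xi> \<and>
     (\<forall>c\<in>charts A. \<Xi> c nicely_meromorphic_on img c UNIV)"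

definition cubic_nonzero :: "'a::topological_space chart set \<Rightarrow> 'a cubic \<Rightarrow> bool" where
  "cubic_nonzero A \<Xi> \<longleftrightarrow> (\<exists>c\<in>charts A. \<exists>z\<in>img c UNIV. \<Xi> c z \<noteq> 0)"

definition cubic_zeros :: "'a::topological_space chart set \<Rightarrow> 'a set \<Rightarrow> 'a cubic \<Rightarrow> 'a set" where
  "cubic_zeros A S \<Xi> = {p \<in> S. \<exists>c\<in>charts A. p \<in> fst c \<and> \<Xi> c (snd c p) = 0}"

text \<open>The order does not depend on the choice of the chart.\<close>

definition cubic_ord :: "'a::topological_space chart set \<Rightarrow> 'a cubic \<Rightarrow> 'a \<Rightarrow> int" where
  "cubic_ord A \<Xi> p = (let c = (SOME c. c \<in> charts A \<and> p \<in> fst c) in zorder (\<Xi> c) (snd c p))"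

definition cubic_supp :: "'a::topological_space chart set \<Rightarrow> 'a cubic \<Rightarrow> 'a set" where
  "cubic_supp A \<Xi> = {p. cubic_ord A \<Xi> p \<noteq> 0}"

definition associated_hyperbolic_metric ::
  "'a::topological_space chart set \<Rightarrow> 'a set \<Rightarrow> 'a metric \<Rightarrow> 'a connection \<Rightarrow> 'a metric \<Rightarrow> bool" where
  "associated_hyperbolic_metric A S g \<Gamma> h \<longleftrightarrow>
     (\<forall>c\<in>charts A. \<forall>z\<in>img c S.
        (\<exists>V Z W. open V \<and> z \<in> V \<and> V \<subseteq> img c S \<and> conjugate_coordinates V (g c) (\<Gamma> c) Z W) \<and>
        (\<forall>V Z W. open V \<and> z \<in> V \<and> V \<subseteq> img c S \<and> conjugate_coordinates V (g c) (\<Gamma> c) Z W \<longrightarrow>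
           h c z = pullback_metric (period_map Z W) upper_half_plane_metric z))"

definition associated_cubic_form ::
  "'a::topological_space chart set \<Rightarrow> 'a set \<Rightarrow> 'a metric \<Rightarrow> 'a connection \<Rightarrow> 'a cubic \<Rightarrow> bool" where
  "associated_cubic_form A S g \<Gamma> \<Xi> \<longleftrightarrow>
     (\<forall>c\<in>charts A. \<forall>z\<in>img c S.
        (\<exists>V Z W. open V \<and> z \<in> V \<and> V \<subseteq> img c S \<and> conjugate_coordinates V (g c) (\<Gamma> c) Z W) \<and>
        (\<forall>V Z W. open V \<and> z \<in> V \<and> V \<subseteq> img c S \<and> conjugate_coordinates V (g c) (\<Gamma> c) Z W \<longrightarrow>
           \<Xi> c z = period_cubic Z W z))"

definition special_kaehler_with ::
  "'a::topological_space chart set \<Rightarrow> 'a set \<Rightarrow> 'a metric \<Rightarrow> 'a cubic \<Rightarrow>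
   'a metric \<Rightarrow> 'a connection \<Rightarrow> bool" where
  "special_kaehler_with A S h \<Xi> g \<Gamma> \<longleftrightarrow> special_kaehler A S g \<Gamma> \<and>
     associated_hyperbolic_metric A S g \<Gamma> h \<and> associated_cubic_form A S g \<Gamma> \<Xi>"

definition same_structure ::
  "'a::topological_space chart set \<Rightarrow> 'a set \<Rightarrow> 'a metric \<Rightarrow> 'a connection \<Rightarrow>
   'a metric \<Rightarrow> 'a connection \<Rightarrow> bool" where
  "same_structure A S g \<Gamma> g' \<Gamma>' \<longleftrightarrow>
     (\<forall>c\<in>charts A. \<forall>z\<in>img c S. g c z = g' c z \<and> \<Gamma> c z = \<Gamma>' c z)"


section \<open>Singularities\<close>

text \<open>\<open>G = w (C + o(1)) |dz|\<^sup>2\<close> at the origin with a constant \<open>C > 0\<close>; the inner product of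
  \<open>complex\<close> is \<open>|dz|\<^sup>2\<close>.\<close>

definition asymptotic_metric :: "local_metric \<Rightarrow> (complex \<Rightarrow> real) \<Rightarrow> bool" where
  "asymptotic_metric G w \<longleftrightarrow>
     (\<exists>C>0. \<forall>u v. ((\<lambda>z. G z u v / w z) \<longlongrightarrow> C * (u \<bullet> v)) (at 0))"

text \<open>\<open>\<Gamma> = \<Gamma>\<^sub>0 + o(w)\<close> at the origin, for all coefficients of the connection 1-forms:\<close>

definition asymptotic_connection ::
  "local_connection \<Rightarrow> local_connection \<Rightarrow> (complex \<Rightarrow> real) \<Rightarrow> bool" where
  "asymptotic_connection \<Gamma> \<Gamma>\<^sub>0 w \<longleftrightarrow>
     (\<forall>\<xi> v. (\<lambda>z. norm (\<Gamma> z \<xi> v - \<Gamma>\<^sub>0 z \<xi> v)) \<in> o[at 0](w))"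

definition punctured_nbhd_in :: "'a chart \<Rightarrow> 'a set \<Rightarrow> bool" where
  "punctured_nbhd_in c S \<longleftrightarrow> (\<forall>\<^sub>F z in at 0. z \<in> img c S)"

text \<open>Singularities of hyperbolic metrics. These do not depend on the centered coordinate.\<close>

definition metric_conical ::
  "'a::topological_space chart set \<Rightarrow> 'a set \<Rightarrow> 'a metric \<Rightarrow> 'a \<Rightarrow> real \<Rightarrow> bool" where
  "metric_conical A S g p \<alpha> \<longleftrightarrow> \<alpha> > - 1 \<and>
     (\<exists>c. centered_at A p c \<and> punctured_nbhd_in c S \<and>
        asymptotic_metric (g c) (\<lambda>z. norm z powr (2 * \<alpha>)))"

definition metric_cusp ::
  "'a::topological_space chart set \<Rightarrow> 'a set \<Rightarrow> 'a metric \<Rightarrow> 'a \<Rightarrow> bool" where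
  "metric_cusp A S g p \<longleftrightarrow>
     (\<exists>c. centered_at A p c \<and> punctured_nbhd_in c S \<and>
        asymptotic_metric (g c) (\<lambda>z. 1 / (norm z * ln (norm z))\<^sup>2))"

text \<open>A divisor \<open>\<Sum> (\<alpha>\<^sub>j - 1) p\<^sub>j\<close> is the function with value \<open>\<alpha>\<^sub>j - 1\<close> at \<open>p\<^sub>j\<close> and 0 elsewhere;
  \<open>\<alpha>\<^sub>j \<noteq> 1\<close> says that the support is exactly the set of the points \<open>p\<^sub>j\<close>.\<close>

definition div_supp :: "('a \<Rightarrow> real) \<Rightarrow> 'a set" where
  "div_supp D = {p. D p \<noteq> 0}"

definition represents_divisor ::
  "'a::topological_space chart set \<Rightarrow> 'a metric \<Rightarrow> ('a \<Rightarrow> real) \<Rightarrow> bool" where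
  "represents_divisor A g D \<longleftrightarrow>
     finite (div_supp D) \<and> (\<forall>p. D p \<ge> - 1) \<and>
     hyperbolic_metric A (- div_supp D) g \<and>
     (\<forall>p\<in>div_supp D. if D p = - 1 then metric_cusp A (- div_supp D) g p
                     else metric_conical A (- div_supp D) g p (D p))"

text \<open>The 1-forms \<open>d\<rho>\<close> and \<open>d\<theta>\<close> of \<open>z = exp (\<rho> + \<i> \<theta>)\<close>, so that \<open>dz/z = d\<rho> + \<i> d\<theta>\<close>:\<close>

definition drho :: "complex \<Rightarrow> complex \<Rightarrow> real" where "drho z \<xi> = Re (\<xi> / z)"
definition dtheta :: "complex \<Rightarrow> complex \<Rightarrow> real" where "dtheta z \<xi> = Im (\<xi> / z)"

text \<open>The real matrix with rows \<open>(a, b)\<close> and \<open>(c, d)\<close> acting on column vectors:\<close>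

definition mat2 :: "real \<Rightarrow> real \<Rightarrow> real \<Rightarrow> real \<Rightarrow> complex \<Rightarrow> complex" where
  "mat2 a b c d v = Complex (a * Re v + b * Im v) (c * Re v + d * Im v)"

definition conical_connection :: "real \<Rightarrow> local_connection" where
  "conical_connection \<beta> z \<xi> v =
     (\<beta>/2) *\<^sub>R (drho z \<xi> *\<^sub>R mat2 1 0 0 1 v + dtheta z \<xi> *\<^sub>R mat2 0 (-1) 1 0 v)"

definition log_connection :: "int \<Rightarrow> complex \<Rightarrow> local_connection" where
  "log_connection k b z \<xi> v =
     (let \<rho> = ln (norm z);
          e = b / of_real (norm b) * cis (of_int k * Arg z);
          R = Re e; J = Im e
      in (dtheta z \<xi> / 2) *\<^sub>R
           (of_int k *\<^sub>R mat2 0 (-1) 1 0 v + (1/\<rho>) *\<^sub>R mat2 J (-1 + R) (1 + R) (- J) v) +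
         (drho z \<xi> / 2) *\<^sub>R
           (of_int k *\<^sub>R mat2 1 0 0 1 v + (1/\<rho>) *\<^sub>R mat2 (1 - R) J J (1 + R) v))"

text \<open>Singularities of special Kaehler structures of order \<open>m\<close>, i.e. \<open>\<beta> = 2 m\<close> in the conical
  case and \<open>k = 2 m\<close>, an integer, in the logarithmic case. The asymptotics are required in
  every centered coordinate.\<close>

definition sk_conical ::
  "'a::topological_space chart set \<Rightarrow> 'a set \<Rightarrow> 'a metric \<Rightarrow> 'a connection \<Rightarrow> 'a \<Rightarrow> real \<Rightarrow> bool" where
  "sk_conical A S g \<Gamma> p m \<longleftrightarrow>
     (\<exists>\<beta>. m = 1/2 * \<beta> \<and>
       (\<forall>c. centered_at A p c \<longrightarrow> punctured_nbhd_in c S \<and>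
          asymptotic_metric (g c) (\<lambda>z. norm z powr \<beta>) \<and>
          asymptotic_connection (\<Gamma> c) (conical_connection \<beta>) (\<lambda>z. 1 / norm z)))"

definition sk_logarithmic ::
  "'a::topological_space chart set \<Rightarrow> 'a set \<Rightarrow> 'a metric \<Rightarrow> 'a connection \<Rightarrow> 'a \<Rightarrow> real \<Rightarrow> bool" where
  "sk_logarithmic A S g \<Gamma> p m \<longleftrightarrow>
     (\<exists>k::int. m = 1/2 * of_int k \<and>
       (\<forall>c. centered_at A p c \<longrightarrow> punctured_nbhd_in c S \<and>
          asymptotic_metric (g c) (\<lambda>z. - (norm z powi k) * ln (norm z)) \<and>
          (\<exists>b. b \<noteq> 0 \<and> asymptotic_connection (\<Gamma> c) (log_connection k b)
                 (\<lambda>z. 1 / (norm z * \<bar>ln (norm z)\<bar>)))))"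

end

theory Submission
  imports Defs
begin

text \<open>
  In a coordinate \<open>z\<close> write the hyperbolic metric as \<open>H |dz|\<^sup>2\<close> and the cubic form as \<open>\<Xi> dz\<^sup>3\<close>. For
  conjugate coordinates \<open>(Z, W)\<close> one computes \<open>16 |\<Xi>|\<^sup>2 = H g\<^sup>2\<close>, so the metric must be
  \<open>g = 4 |\<Xi>| / sqrt H\<close>, and the connection must be \<open>\<Gamma>(u, v) = P u v + Q cnj (u v)\<close> with \<open>P\<close> the
  \<open>z\<close>-derivative of \<open>ln g\<close> and \<open>Q = - 2 \<i> cnj \<Xi> / g\<close>; this is uniqueness. Conversely, curvature \<open>- 1\<close>
  is the Liouville equation for \<open>ln H\<close>, which makes this connection flat. The form \<open>Re (f dz)\<close> is
  parallel iff \<open>f\<close> is holomorphic with \<open>f' = P f + cnj (Q f)\<close>; local solutions come from a linear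
  holomorphic differential equation of second order, and two of them are \<open>dZ/dz\<close> and \<open>dW/dz\<close>.

  Near a puncture, pass to \<open>\<zeta> = ln z\<close>, where \<open>ln H\<close> minus its model is \<open>o(1)\<close> and solves a Poisson
  equation with small right-hand side. An interior gradient estimate, on discs of fixed radius in the
  conical case and of radius comparable to \<open>|Re \<zeta>|\<close> at a cusp, gives the asymptotics of the derivative
  of \<open>ln H\<close> and hence of \<open>P\<close>. At a cusp the maximum principle forces the leading constant of \<open>H\<close> to be 1,
  which is what the normalization of the logarithmic model connection requires.
\<close>

section \<open>Smooth functions of one complex variable\<close>

text \<open>Two obstacles shape the proof. For existence, parallel 1-forms solve an overdetermined
  real system. Flatness makes it integrable, but instead of a Frobenius argument the conjugate of f
  is eliminated: the resulting holomorphic equation has a solution space of complex dimension two,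
  and the parallel forms are the real plane in it where the first-order defect vanishes at the base
  point, hence nearby. At a puncture the hypotheses control only the size of the metric, while the
  connection contains a derivative of ln H. In \<zeta> = ln z one has z d/dz = d/d\<zeta>, so an
  error o(1/r) becomes o(1), and discs of fixed radius suffice at a cone; at a cusp the error must
  be o(1/|Re \<zeta>|), which needs discs whose radius grows like |Re \<zeta>|. The antilinear part
  has |Q| = sqrt H / 2. At a cone it is o(1/r), because \<alpha> > - 1, and drops out. At a cusp it
  is sqrt C / (2 r |ln r|) to leading order, as large as the corresponding term of the model, whose
  modulus contains no free parameter; hence the need for C = 1.\<close>

lemma frechet_derivative_cong_open:
  assumes "open U" "z \<in> U" "\<And>x. x \<in> U \<Longrightarrow> f x = g x"
  shows "frechet_derivative f (at z) = frechet_derivative g (at z)"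
proof -
  have "(f has_derivative D) (at z) \<longleftrightarrow> (g has_derivative D) (at z)" for D
    using assms has_derivative_transform_within_open[of f D z UNIV U g]
      has_derivative_transform_within_open[of g D z UNIV U f] by auto
  then show ?thesis unfolding frechet_derivative_def by simp
qed

lemma differentiable_cong_open:
  assumes "open U" "z \<in> U" "\<And>x. x \<in> U \<Longrightarrow> f x = g x"
  shows "f differentiable (at z) \<longleftrightarrow> g differentiable (at z)"
  unfolding differentiable_def
  using assms has_derivative_transform_within_open[of f _ z UNIV U g]
      has_derivative_transform_within_open[of g _ z UNIV U f] by auto

lemma Ck_on_cong:
  assumes "open U" "\<And>x. x \<in> U \<Longrightarrow> f x = g x"
  shows "Ck_on k U f \<longleftrightarrow> Ck_on k U g"
  using assms(2)
proof (induction k arbitrary: f g)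
  case 0
  then show ?case by (auto cong: continuous_on_cong)
next
  case (Suc k)
  have "Ck_on k U (\<lambda>x. frechet_derivative f (at x) v) = Ck_on k U (\<lambda>x. frechet_derivative g (at x) v)" for v
    by (rule Suc.IH) (use Suc.prems frechet_derivative_cong_open[OF assms(1), of _ f g] in auto)
  moreover have "(\<forall>x\<in>U. f differentiable (at x)) = (\<forall>x\<in>U. g differentiable (at x))"
    using differentiable_cong_open[OF assms(1), of _ f g] Suc.prems by auto
  ultimately show ?case by simp
qed

text \<open>The induction step behind all closure rules below: an explicit derivative formula
  reduces order \<open>Suc k\<close> of the function to order \<open>k\<close> of the coefficients
  of its derivative.\<close>

lemma Ck_on_SucI:
  assumes "open U" "\<And>x. x \<in> U \<Longrightarrow> (f has_derivative D x) (at x)" "\<And>v. Ck_on k U (\<lambda>x. D x v)"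
  shows "Ck_on (Suc k) U f"
proof -
  have "Ck_on k U (\<lambda>x. frechet_derivative f (at x) v)" for v
    using assms(3)[of v] Ck_on_cong[OF assms(1), of "\<lambda>x. frechet_derivative f (at x) v" "\<lambda>x. D x v" k]
      frechet_derivative_at[OF assms(2)] by (metis (mono_tags, lifting))
  then show ?thesis using assms(2) by (auto simp: differentiable_def)
qed

lemma Ck_on_Suc_imp:
  assumes "Ck_on (Suc k) U f" shows "Ck_on k U f"
  using assms
proof (induction k arbitrary: f)
  case 0
  then show ?case
    by (auto intro!: continuous_at_imp_continuous_on differentiable_imp_continuous_within)
next
  case (Suc k)
  then show ?case by (metis Ck_on.simps(2))
qed

lemma Ck_on_subset: "Ck_on k U f \<Longrightarrow> V \<subseteq> U \<Longrightarrow> Ck_on k V f"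
  by (induction k arbitrary: f) (auto intro: continuous_on_subset)

lemma smooth_on_subset: "smooth_on U f \<Longrightarrow> V \<subseteq> U \<Longrightarrow> smooth_on V f"
  unfolding smooth_on_def using Ck_on_subset by blast

lemma smooth_on_differentiable: "smooth_on U f \<Longrightarrow> z \<in> U \<Longrightarrow> f differentiable (at z)"
  unfolding smooth_on_def by (metis Ck_on.simps(2))

lemma smooth_on_frechet: "smooth_on U f \<Longrightarrow> smooth_on U (\<lambda>x. frechet_derivative f (at x) v)"
  unfolding smooth_on_def by (metis Ck_on.simps(2))

lemma smooth_on_continuous: "smooth_on U f \<Longrightarrow> continuous_on U f"
  unfolding smooth_on_def by (metis Ck_on.simps(1))

lemma Ck_on_const: "Ck_on k U (\<lambda>_. c)"
  by (induction k arbitrary: c) auto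

lemma Ck_on_bounded_linear:
  assumes "bounded_linear L" "open U" shows "Ck_on k U f \<Longrightarrow> Ck_on k U (\<lambda>x. L (f x))"
proof (induction k arbitrary: f)
  case 0
  then show ?case
    using assms bounded_linear.continuous_on by auto
next
  case (Suc k)
  have d: "((\<lambda>x. L (f x)) has_derivative (\<lambda>v. L (frechet_derivative f (at x) v))) (at x)" if "x \<in> U" for x
    by (rule bounded_linear.has_derivative[OF assms(1)])
       (use Suc.prems that in \<open>auto simp: frechet_derivative_works[symmetric]\<close>)
  show ?case by (rule Ck_on_SucI[OF assms(2) d]) (use Suc in auto)
qed

lemma Ck_on_add:
  assumes "open U" shows "Ck_on k U f \<Longrightarrow> Ck_on k U g \<Longrightarrow> Ck_on k U (\<lambda>x. f x + g x)"
proof (induction k arbitrary: f g)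
  case 0
  then show ?case by (auto intro: continuous_intros)
next
  case (Suc k)
  have d: "((\<lambda>x. f x + g x) has_derivative (\<lambda>v. frechet_derivative f (at x) v + frechet_derivative g (at x) v)) (at x)" if "x \<in> U" for x
    by (rule has_derivative_add)
       (use Suc.prems that in \<open>auto simp: frechet_derivative_works[symmetric]\<close>)
  show ?case by (rule Ck_on_SucI[OF assms d]) (use Suc in auto)
qed

lemma Ck_on_bilinear:
  assumes "bounded_bilinear B" "open U"
  shows "Ck_on k U f \<Longrightarrow> Ck_on k U g \<Longrightarrow> Ck_on k U (\<lambda>x. B (f x) (g x))"
proof (induction k arbitrary: f g)
  case 0
  then show ?case
    using bounded_bilinear.continuous_on[OF assms(1)] by auto
next
  case (Suc k)
  have d: "((\<lambda>x. B (f x) (g x)) has_derivative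
      (\<lambda>v. B (f x) (frechet_derivative g (at x) v) + B (frechet_derivative f (at x) v) (g x))) (at x)" if "x \<in> U" for x
    by (rule bounded_bilinear.FDERIV[OF assms(1)])
       (use Suc.prems that in \<open>auto simp: frechet_derivative_works[symmetric]\<close>)
  show ?case
    by (rule Ck_on_SucI[OF assms(2) d], assumption, intro Ck_on_add assms Suc.IH)
       (use Suc.prems Ck_on_Suc_imp in auto)
qed

lemma Ck_on_inverse:
  fixes f :: "'a::real_normed_vector \<Rightarrow> 'b::real_normed_field"
  assumes "open U" "\<And>x. x \<in> U \<Longrightarrow> f x \<noteq> 0"
  shows "Ck_on k U f \<Longrightarrow> Ck_on k U (\<lambda>x. inverse (f x))"
proof (induction k)
  case 0
  then show ?case using assms by (auto intro!: continuous_intros)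
next
  case (Suc k)
  have d: "((\<lambda>x. inverse (f x)) has_derivative
      (\<lambda>v. - (inverse (f x) * frechet_derivative f (at x) v * inverse (f x)))) (at x)" if "x \<in> U" for x
    by (rule Deriv.has_derivative_inverse)
       (use Suc.prems that assms in \<open>auto simp: frechet_derivative_works[symmetric]\<close>)
  show ?case
    by (rule Ck_on_SucI[OF assms(1) d], assumption,
        intro Ck_on_bounded_linear[OF bounded_linear_minus[OF bounded_linear_ident]]
          Ck_on_bilinear[OF bounded_bilinear_mult] assms Suc.IH)
       (use Suc.prems Ck_on_Suc_imp in auto)
qed

lemma Ck_on_sqrt:
  fixes f :: "'a::real_normed_vector \<Rightarrow> real"
  assumes "open U" "\<And>x. x \<in> U \<Longrightarrow> f x > 0"
  shows "Ck_on k U f \<Longrightarrow> Ck_on k U (\<lambda>x. sqrt (f x))"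
proof (induction k)
  case 0
  then show ?case using assms by (auto intro!: continuous_intros)
next
  case (Suc k)
  have d: "((\<lambda>x. sqrt (f x)) has_derivative
      (\<lambda>v. frechet_derivative f (at x) v * inverse (2 * sqrt (f x)))) (at x)" if "x \<in> U" for x
  proof -
    have "(f has_derivative frechet_derivative f (at x)) (at x)"
      using Suc.prems that by (auto simp: frechet_derivative_works[symmetric])
    from has_derivative_real_sqrt[OF assms(2)[OF that] this] show ?thesis
      by (simp add: field_simps)
  qed
  have k: "Ck_on k U f" using Suc.prems Ck_on_Suc_imp by blast
  show ?case
    by (rule Ck_on_SucI[OF assms(1) d], assumption,
        intro Ck_on_bilinear[OF bounded_bilinear_mult] assms Suc.IH Ck_on_inverse Ck_on_const)
       (use Suc.prems k assms(2) in \<open>force+\<close>)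
qed

lemma Ck_on_holomorphic:
  assumes "open U" shows "f holomorphic_on U \<Longrightarrow> Ck_on k U f"
proof (induction k arbitrary: f)
  case 0
  then show ?case by (simp add: holomorphic_on_imp_continuous_on)
next
  case (Suc k)
  have d: "(f has_derivative (\<lambda>v. deriv f x * v)) (at x)" if "x \<in> U" for x
    using holomorphic_derivI[OF Suc.prems assms that] by (simp add: has_field_derivative_def)
  show ?case
    by (rule Ck_on_SucI[OF assms d], assumption,
        intro Ck_on_bilinear[OF bounded_bilinear_mult] assms Suc.IH Ck_on_const)
       (use Suc.prems assms in \<open>auto intro: holomorphic_deriv\<close>)
qed

lemma smooth_on_const [simp]: "smooth_on U (\<lambda>_. c)"
  by (simp add: smooth_on_def Ck_on_const)

lemma smooth_on_add: "open U \<Longrightarrow> smooth_on U f \<Longrightarrow> smooth_on U g \<Longrightarrow> smooth_on U (\<lambda>x. f x + g x)"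
  by (simp add: smooth_on_def Ck_on_add)

lemma smooth_on_bounded_linear:
  "bounded_linear L \<Longrightarrow> open U \<Longrightarrow> smooth_on U f \<Longrightarrow> smooth_on U (\<lambda>x. L (f x))"
  by (simp add: smooth_on_def Ck_on_bounded_linear)

lemma smooth_on_mult:
  fixes f g :: "'a::real_normed_vector \<Rightarrow> 'b::real_normed_algebra"
  shows "open U \<Longrightarrow> smooth_on U f \<Longrightarrow> smooth_on U g \<Longrightarrow> smooth_on U (\<lambda>x. f x * g x)"
  by (simp add: smooth_on_def Ck_on_bilinear[OF bounded_bilinear_mult])

lemma smooth_on_diff: "open U \<Longrightarrow> smooth_on U f \<Longrightarrow> smooth_on U g \<Longrightarrow> smooth_on U (\<lambda>x. f x - g x)"
  using smooth_on_add[of U f "\<lambda>x. - g x"]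
    smooth_on_bounded_linear[OF bounded_linear_minus[OF bounded_linear_ident], of U g] by simp

lemma smooth_on_inverse:
  fixes f :: "'a::real_normed_vector \<Rightarrow> 'b::real_normed_field"
  shows "open U \<Longrightarrow> smooth_on U f \<Longrightarrow> (\<And>x. x \<in> U \<Longrightarrow> f x \<noteq> 0) \<Longrightarrow> smooth_on U (\<lambda>x. inverse (f x))"
  by (simp add: smooth_on_def Ck_on_inverse)

lemma smooth_on_sqrt:
  fixes f :: "'a::real_normed_vector \<Rightarrow> real"
  shows "open U \<Longrightarrow> smooth_on U f \<Longrightarrow> (\<And>x. x \<in> U \<Longrightarrow> f x > 0) \<Longrightarrow> smooth_on U (\<lambda>x. sqrt (f x))"
  by (simp add: smooth_on_def Ck_on_sqrt)

lemma smooth_on_holomorphic: "open U \<Longrightarrow> f holomorphic_on U \<Longrightarrow> smooth_on U f"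
  by (simp add: smooth_on_def Ck_on_holomorphic)

section \<open>Symmetry of second derivatives\<close>

text \<open>The mean value theorem twice: along \<open>u\<close> for the increment of
  \<open>f\<close> over \<open>h v\<close>, then along \<open>v\<close> for the derivative. The left
  side is symmetric in \<open>u\<close> and \<open>v\<close>, so exchanging them compares the two
  mixed derivatives at nearby points.\<close>

lemma second_difference_mean_value:
  fixes f :: "'a::real_normed_vector \<Rightarrow> real"
  assumes "h > 0"
    and seg: "\<And>s t. 0 \<le> s \<Longrightarrow> s \<le> h \<Longrightarrow> 0 \<le> t \<Longrightarrow> t \<le> h \<Longrightarrow> z + s *\<^sub>R u + t *\<^sub>R v \<in> U"
    and f: "\<And>x. x \<in> U \<Longrightarrow> f differentiable (at x)"
    and fu: "\<And>x. x \<in> U \<Longrightarrow> (\<lambda>x. frechet_derivative f (at x) u) differentiable (at x)"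
  shows "\<exists>s t. 0 \<le> s \<and> s \<le> h \<and> 0 \<le> t \<and> t \<le> h \<and>
    f (z + h *\<^sub>R u + h *\<^sub>R v) - f (z + h *\<^sub>R u) - f (z + h *\<^sub>R v) + f z =
    h * h * frechet_derivative (\<lambda>x. frechet_derivative f (at x) u) (at (z + s *\<^sub>R u + t *\<^sub>R v)) v"
proof -
  let ?fu = "\<lambda>x. frechet_derivative f (at x) u"
  let ?fuv = "\<lambda>x. frechet_derivative ?fu (at x) v"
  have lin: "frechet_derivative F (at x) (c *\<^sub>R w) = c * frechet_derivative F (at x) w"
    if "F differentiable (at x)" for F :: "'a \<Rightarrow> real" and x c w
    using linear_scale[OF linear_frechet_derivative[OF that], of c w] by simp
  have d1: "((\<lambda>s. f (z + s *\<^sub>R u + t *\<^sub>R v)) has_real_derivative ?fu (z + s *\<^sub>R u + t *\<^sub>R v)) (at s)"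
    if "0 \<le> s" "s \<le> h" "0 \<le> t" "t \<le> h" for s t
  proof -
    have D: "(f has_derivative frechet_derivative f (at (z + s *\<^sub>R u + t *\<^sub>R v))) (at (z + s *\<^sub>R u + t *\<^sub>R v))"
      using f[OF seg[OF that]] by (simp add: frechet_derivative_works)
    have "((\<lambda>s. f (z + s *\<^sub>R u + t *\<^sub>R v)) has_derivative
      (\<lambda>h. frechet_derivative f (at (z + s *\<^sub>R u + t *\<^sub>R v)) (h *\<^sub>R u))) (at s)"
      by (rule has_derivative_compose[where f="\<lambda>s. z + s *\<^sub>R u + t *\<^sub>R v" and g=f, OF _ D])
         (auto intro!: derivative_eq_intros)
    then show ?thesis unfolding has_field_derivative_def
      by (rule has_derivative_eq_rhs) (simp add: fun_eq_iff lin[OF f[OF seg[OF that]]])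
  qed
  have d2: "((\<lambda>t. ?fu (z + s *\<^sub>R u + t *\<^sub>R v)) has_real_derivative ?fuv (z + s *\<^sub>R u + t *\<^sub>R v)) (at t)"
    if "0 \<le> s" "s \<le> h" "0 \<le> t" "t \<le> h" for s t
  proof -
    have D: "(?fu has_derivative frechet_derivative ?fu (at (z + s *\<^sub>R u + t *\<^sub>R v))) (at (z + s *\<^sub>R u + t *\<^sub>R v))"
      using fu[OF seg[OF that]] by (simp add: frechet_derivative_works)
    have "((\<lambda>t. ?fu (z + s *\<^sub>R u + t *\<^sub>R v)) has_derivative
      (\<lambda>h. frechet_derivative ?fu (at (z + s *\<^sub>R u + t *\<^sub>R v)) (h *\<^sub>R v))) (at t)"
      by (rule has_derivative_compose[where f="\<lambda>t. z + s *\<^sub>R u + t *\<^sub>R v" and g="?fu", OF _ D])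
         (auto intro!: derivative_eq_intros)
    then show ?thesis unfolding has_field_derivative_def
      by (rule has_derivative_eq_rhs) (simp add: fun_eq_iff lin[OF fu[OF seg[OF that]]])
  qed
  have "\<exists>s>0. s < h \<and> (f (z + h *\<^sub>R u + h *\<^sub>R v) - f (z + h *\<^sub>R u + 0 *\<^sub>R v)) -
        (f (z + 0 *\<^sub>R u + h *\<^sub>R v) - f (z + 0 *\<^sub>R u + 0 *\<^sub>R v)) =
      (h - 0) * (?fu (z + s *\<^sub>R u + h *\<^sub>R v) - ?fu (z + s *\<^sub>R u + 0 *\<^sub>R v))"
    by (rule MVT2[OF \<open>h > 0\<close>, where f="\<lambda>s. f (z + s *\<^sub>R u + h *\<^sub>R v) - f (z + s *\<^sub>R u + 0 *\<^sub>R v)"])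
       (use \<open>h > 0\<close> in \<open>intro DERIV_diff d1; simp\<close>)
  then obtain s where s: "s > 0" "s < h" and es: "f (z + h *\<^sub>R u + h *\<^sub>R v) - f (z + h *\<^sub>R u) - f (z + h *\<^sub>R v) + f z =
      h * (?fu (z + s *\<^sub>R u + h *\<^sub>R v) - ?fu (z + s *\<^sub>R u + 0 *\<^sub>R v))"
    by auto
  have "\<exists>t>0. t < h \<and> ?fu (z + s *\<^sub>R u + h *\<^sub>R v) - ?fu (z + s *\<^sub>R u + 0 *\<^sub>R v) =
     (h - 0) * ?fuv (z + s *\<^sub>R u + t *\<^sub>R v)"
    by (rule MVT2[OF \<open>h > 0\<close>, where f="\<lambda>t. ?fu (z + s *\<^sub>R u + t *\<^sub>R v)"])
       (use s in \<open>intro d2; simp\<close>)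
  then obtain t where "t > 0" "t < h" "?fu (z + s *\<^sub>R u + h *\<^sub>R v) - ?fu (z + s *\<^sub>R u + 0 *\<^sub>R v) =
     h * ?fuv (z + s *\<^sub>R u + t *\<^sub>R v)"
    by auto
  with s es show ?thesis
    by (intro exI[of _ s] exI[of _ t]) auto
qed

lemma frechet_derivative_commute_real:
  fixes f :: "'a::real_normed_vector \<Rightarrow> real"
  assumes "open U" "z \<in> U" "Ck_on 2 U f"
  shows "frechet_derivative (\<lambda>x. frechet_derivative f (at x) u) (at z) v =
         frechet_derivative (\<lambda>x. frechet_derivative f (at x) v) (at z) u"
proof (rule ccontr)
  let ?D = "\<lambda>u v x. frechet_derivative (\<lambda>x. frechet_derivative f (at x) u) (at x) v"
  assume neq: "?D u v z \<noteq> ?D v u z"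
  \<comment> \<open>Half of the supposed gap: near \<open>z\<close> each mixed derivative stays
    within \<open>e\<close> of its own value at \<open>z\<close>, so a value of one can never equal
    a value of the other, but the second difference produces such a coincidence.\<close>
  define e where "e = \<bar>?D u v z - ?D v u z\<bar> / 2"
  have "e > 0" using neq by (simp add: e_def)
  have ck: "\<forall>x\<in>U. f differentiable (at x)"
      "\<forall>x\<in>U. (\<lambda>x. frechet_derivative f (at x) w) differentiable (at x)"
      "continuous_on U (?D w w')" for w w'
    using assms(3) by (auto simp: numeral_2_eq_2)
  have "\<forall>\<^sub>F x in at z. \<bar>?D w w' x - ?D w w' z\<bar> < e" for w w'
    using ck(3)[of w w'] assms(1,2) \<open>e > 0\<close>
    by (auto simp: continuous_on_eq_continuous_at isCont_def tendsto_iff dist_real_def)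
  then have "\<forall>\<^sub>F x in at z. x \<in> U \<and> \<bar>?D u v x - ?D u v z\<bar> < e \<and> \<bar>?D v u x - ?D v u z\<bar> < e"
    using eventually_at_in_open'[OF assms(1,2)] by (intro eventually_conj) auto
  then obtain d where d: "d > 0" "\<And>x. x \<noteq> z \<Longrightarrow> dist x z < d \<Longrightarrow> x \<in> U \<and> \<bar>?D u v x - ?D u v z\<bar> < e \<and> \<bar>?D v u x - ?D v u z\<bar> < e"
    unfolding eventually_at by auto
  have d': "dist x z < d \<Longrightarrow> x \<in> U \<and> \<bar>?D u v x - ?D u v z\<bar> < e \<and> \<bar>?D v u x - ?D v u z\<bar> < e" for x
    using d(2)[of x] assms(2) \<open>e > 0\<close> by (cases "x = z") auto
  \<comment> \<open>Keeps the parallelogram spanned by \<open>h u\<close> and \<open>h v\<close> in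
    the ball of radius \<open>d\<close>; the summand 1 covers the case
    \<open>u = v = 0\<close>.\<close>
  define h where "h = d / (2 * (norm u + norm v + 1))"
  have np: "norm u + norm v + 1 > 0" by (smt (verit) norm_ge_zero)
  have h: "h > 0" using d(1) np by (simp add: h_def)
  have near: "dist (z + s *\<^sub>R u + t *\<^sub>R v) z < d" if "0 \<le> s" "s \<le> h" "0 \<le> t" "t \<le> h" for s t
  proof -
    have "dist (z + s *\<^sub>R u + t *\<^sub>R v) z = norm (s *\<^sub>R u + t *\<^sub>R v)" by (simp add: dist_norm)
    also have "\<dots> \<le> s * norm u + t * norm v"
      using norm_triangle_ineq[of "s *\<^sub>R u" "t *\<^sub>R v"] that by simp
    also have "\<dots> \<le> h * norm u + h * norm v"
      using that by (intro add_mono mult_right_mono) auto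
    also have "\<dots> \<le> h * (norm u + norm v + 1)" using h by (simp add: algebra_simps)
    also have "\<dots> = d / 2"
      unfolding h_def using np by (simp only: times_divide_eq_left) (simp add: divide_simps)
    finally show ?thesis using d(1) by simp
  qed
  have near': "dist (z + s *\<^sub>R v + t *\<^sub>R u) z < d" if "0 \<le> s" "s \<le> h" "0 \<le> t" "t \<le> h" for s t
    using near[of t s] that by (simp add: ac_simps)
  obtain s t where st: "0 \<le> s" "s \<le> h" "0 \<le> t" "t \<le> h"
    "f (z + h *\<^sub>R u + h *\<^sub>R v) - f (z + h *\<^sub>R u) - f (z + h *\<^sub>R v) + f z = h * h * ?D u v (z + s *\<^sub>R u + t *\<^sub>R v)"
    using second_difference_mean_value[OF h, of z u v U f] near d' ck by blast
  obtain s' t' where st': "0 \<le> s'" "s' \<le> h" "0 \<le> t'" "t' \<le> h"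
    "f (z + h *\<^sub>R v + h *\<^sub>R u) - f (z + h *\<^sub>R v) - f (z + h *\<^sub>R u) + f z = h * h * ?D v u (z + s' *\<^sub>R v + t' *\<^sub>R u)"
    using second_difference_mean_value[OF h, of z v u U f] near' d' ck by blast
  have "h * h * ?D u v (z + s *\<^sub>R u + t *\<^sub>R v) = h * h * ?D v u (z + s' *\<^sub>R v + t' *\<^sub>R u)"
    using st(5) st'(5) add.commute[of "h *\<^sub>R v" "h *\<^sub>R u"] by (simp only: add.assoc)
  then have "?D u v (z + s *\<^sub>R u + t *\<^sub>R v) = ?D v u (z + s' *\<^sub>R v + t' *\<^sub>R u)"
    using h by simp
  moreover have "\<bar>?D u v (z + s *\<^sub>R u + t *\<^sub>R v) - ?D u v z\<bar> < e" using d'[OF near[OF st(1-4)]] by simp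
  moreover have "\<bar>?D v u (z + s' *\<^sub>R v + t' *\<^sub>R u) - ?D v u z\<bar> < e" using d'[OF near'[OF st'(1-4)]] by simp
  ultimately show False unfolding e_def by (smt (verit) field_sum_of_halves)
qed

lemma frechet_derivative_bounded_linear:
  assumes "bounded_linear L" "f differentiable (at x)"
  shows "frechet_derivative (\<lambda>x. L (f x)) (at x) v = L (frechet_derivative f (at x) v)"
  using frechet_derivative_at[OF bounded_linear.has_derivative[OF assms(1),
        OF assms(2)[unfolded frechet_derivative_works]]] by metis

text \<open>The mean value theorem is a statement about real functions, hence the passage to the
  components \<open>f x \<bullet> b\<close>.\<close>

lemma frechet_derivative_commute:
  fixes f :: "'a::real_normed_vector \<Rightarrow> 'b::euclidean_space"
  assumes "open U" "z \<in> U" "smooth_on U f"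
  shows "frechet_derivative (\<lambda>x. frechet_derivative f (at x) u) (at z) v =
         frechet_derivative (\<lambda>x. frechet_derivative f (at x) v) (at z) u"
proof (rule euclidean_eqI)
  fix b :: 'b
  let ?L = "\<lambda>y. y \<bullet> b"
  have bl: "bounded_linear ?L" by (rule bounded_linear_inner_left)
  have *: "frechet_derivative (\<lambda>x. frechet_derivative (\<lambda>x. ?L (f x)) (at x) u) (at z) v =
     ?L (frechet_derivative (\<lambda>x. frechet_derivative f (at x) u) (at z) v)" for u v
  proof -
    have "frechet_derivative (\<lambda>x. frechet_derivative (\<lambda>x. ?L (f x)) (at x) u) (at z) v =
      frechet_derivative (\<lambda>x. ?L (frechet_derivative f (at x) u)) (at z) v"
      by (subst frechet_derivative_cong_open[OF assms(1,2)])
         (use assms(3) in \<open>auto simp: frechet_derivative_bounded_linear[OF bl] smooth_on_differentiable\<close>)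
    also have "\<dots> = ?L (frechet_derivative (\<lambda>x. frechet_derivative f (at x) u) (at z) v)"
      by (rule frechet_derivative_bounded_linear[OF bl smooth_on_differentiable[OF smooth_on_frechet[OF assms(3)] assms(2)]])
    finally show ?thesis .
  qed
  have "Ck_on 2 U (\<lambda>x. ?L (f x))"
    using smooth_on_bounded_linear[OF bl assms(1,3)] by (auto simp: smooth_on_def)
  from frechet_derivative_commute_real[OF assms(1,2) this, of u v]
  show "frechet_derivative (\<lambda>x. frechet_derivative f (at x) u) (at z) v \<bullet> b =
         frechet_derivative (\<lambda>x. frechet_derivative f (at x) v) (at z) u \<bullet> b"
    by (simp add: *)
qed

section \<open>Wirtinger derivatives\<close>

text \<open>\<open>a\<close> and \<open>b\<close> are the derivatives of \<open>f\<close> with respect to \<open>z\<close> and to its conjugate.\<close>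

definition wirt :: "(complex \<Rightarrow> complex) \<Rightarrow> complex \<Rightarrow> complex \<Rightarrow> complex \<Rightarrow> bool" where
  "wirt f z a b \<longleftrightarrow> (f has_derivative (\<lambda>\<xi>. a * \<xi> + b * cnj \<xi>)) (at z)"

definition dz :: "(complex \<Rightarrow> complex) \<Rightarrow> complex \<Rightarrow> complex" where
  "dz f z = (frechet_derivative f (at z) 1 - \<i> * frechet_derivative f (at z) \<i>) / 2"

definition dzb :: "(complex \<Rightarrow> complex) \<Rightarrow> complex \<Rightarrow> complex" where
  "dzb f z = (frechet_derivative f (at z) 1 + \<i> * frechet_derivative f (at z) \<i>) / 2"

lemma linear_complex_eq:
  assumes "linear (D :: complex \<Rightarrow> 'b::real_normed_vector)"
  shows "D \<xi> = Re \<xi> *\<^sub>R D 1 + Im \<xi> *\<^sub>R D \<i>"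
proof -
  have "\<xi> = Re \<xi> *\<^sub>R 1 + Im \<xi> *\<^sub>R \<i>" by (simp add: complex_eq_iff)
  then have "D \<xi> = D (Re \<xi> *\<^sub>R 1 + Im \<xi> *\<^sub>R \<i>)" by simp
  also have "\<dots> = Re \<xi> *\<^sub>R D 1 + Im \<xi> *\<^sub>R D \<i>"
    by (simp only: linear_add[OF assms] linear_scale[OF assms])
  finally show ?thesis .
qed

lemma wirt_frechet: "wirt f z a b \<Longrightarrow> frechet_derivative f (at z) = (\<lambda>\<xi>. a * \<xi> + b * cnj \<xi>)"
  unfolding wirt_def by (metis frechet_derivative_at)

lemma wirt_dz: "wirt f z a b \<Longrightarrow> dz f z = a" and wirt_dzb: "wirt f z a b \<Longrightarrow> dzb f z = b"
  by (simp_all add: dz_def dzb_def wirt_frechet complex_eq_iff)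

lemma wirt_unique: "wirt f z a b \<Longrightarrow> wirt f z a' b' \<Longrightarrow> a = a' \<and> b = b'"
  using wirt_dz wirt_dzb by metis

lemma differentiable_wirt:
  assumes "f differentiable (at z)" shows "wirt f z (dz f z) (dzb f z)"
proof -
  have eq: "frechet_derivative f (at z) \<xi> = dz f z * \<xi> + dzb f z * cnj \<xi>" for \<xi>
    using linear_complex_eq[OF linear_frechet_derivative[OF assms], of \<xi>]
    by (simp add: dz_def dzb_def complex_eq_iff field_simps)
  show ?thesis
    using assms unfolding wirt_def frechet_derivative_works eq[abs_def, symmetric] by simp
qed

lemma wirt_differentiable: "wirt f z a b \<Longrightarrow> f differentiable (at z)"
  unfolding wirt_def differentiable_def by blast

lemma wirt_cong_open:
  assumes "wirt f z a b" "open U" "z \<in> U" "\<And>x. x \<in> U \<Longrightarrow> f x = g x" shows "wirt g z a b"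
  using assms has_derivative_transform_within_open unfolding wirt_def by blast

lemma wirt_const: "wirt (\<lambda>_. c) z 0 0" by (simp add: wirt_def)

lemma wirt_field: "(f has_field_derivative d) (at z) \<Longrightarrow> wirt f z d 0"
  by (simp add: wirt_def has_field_derivative_def)

lemma wirt_field_iff: "wirt f z d 0 \<longleftrightarrow> (f has_field_derivative d) (at z)"
  by (simp add: wirt_def has_field_derivative_def)

lemma wirt_add: "wirt f z a b \<Longrightarrow> wirt g z c d \<Longrightarrow> wirt (\<lambda>x. f x + g x) z (a + c) (b + d)"
  unfolding wirt_def by (drule (1) has_derivative_add) (simp add: algebra_simps)

lemma wirt_diff: "wirt f z a b \<Longrightarrow> wirt g z c d \<Longrightarrow> wirt (\<lambda>x. f x - g x) z (a - c) (b - d)"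
  unfolding wirt_def by (drule (1) has_derivative_diff) (simp add: algebra_simps)

lemma wirt_minus: "wirt f z a b \<Longrightarrow> wirt (\<lambda>x. - f x) z (- a) (- b)"
  unfolding wirt_def by (drule has_derivative_minus) (simp add: algebra_simps)

lemma wirt_mult:
  "wirt f z a b \<Longrightarrow> wirt g z c d \<Longrightarrow> wirt (\<lambda>x. f x * g x) z (a * g z + f z * c) (b * g z + f z * d)"
  unfolding wirt_def by (drule (1) has_derivative_mult) (simp add: algebra_simps)

lemma wirt_cmult: "wirt f z a b \<Longrightarrow> wirt (\<lambda>x. c * f x) z (c * a) (c * b)"
  using wirt_mult[OF wirt_const, of f z a b c] by simp

lemma wirt_cnj: "wirt f z a b \<Longrightarrow> wirt (\<lambda>x. cnj (f x)) z (cnj b) (cnj a)"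
  unfolding wirt_def by (drule has_derivative_cnj) (simp add: algebra_simps)

lemma wirt_inverse:
  "wirt f z a b \<Longrightarrow> f z \<noteq> 0 \<Longrightarrow> wirt (\<lambda>x. inverse (f x)) z (- a / (f z)\<^sup>2) (- b / (f z)\<^sup>2)"
  unfolding wirt_def
  by (drule (1) Deriv.has_derivative_inverse[rotated], erule has_derivative_eq_rhs)
     (simp add: fun_eq_iff field_simps power2_eq_square)

lemma wirt_compose_field:
  assumes "wirt f (t z) a b" "(t has_field_derivative t') (at z)"
  shows "wirt (\<lambda>x. f (t x)) z (a * t') (b * cnj t')"
  using has_derivative_compose[OF assms(2)[unfolded has_field_derivative_def] assms(1)[unfolded wirt_def]]
  unfolding wirt_def by (simp add: algebra_simps)

lemma smooth_dz: "open U \<Longrightarrow> smooth_on U f \<Longrightarrow> smooth_on U (dz f)"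
  unfolding dz_def[abs_def] divide_inverse
  by (intro smooth_on_mult smooth_on_diff smooth_on_frechet smooth_on_const)

lemma smooth_dzb: "open U \<Longrightarrow> smooth_on U f \<Longrightarrow> smooth_on U (dzb f)"
  unfolding dzb_def[abs_def] divide_inverse
  by (intro smooth_on_mult smooth_on_add smooth_on_frechet smooth_on_const)

lemma smooth_on_wirt: "smooth_on U f \<Longrightarrow> z \<in> U \<Longrightarrow> wirt f z (dz f z) (dzb f z)"
  by (simp add: differentiable_wirt smooth_on_differentiable)

text \<open>Both sides are a quarter of the Laplacian of \<open>f\<close>; symmetry of second
  derivatives cancels the mixed terms.\<close>

lemma dzb_dz_commute:
  assumes "open U" "z \<in> U" "smooth_on U f"
  shows "dzb (dz f) z = dz (dzb f) z"
proof -
  let ?F = "\<lambda>u x. frechet_derivative f (at x) u"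
  have w: "wirt (?F u) z (dz (?F u) z) (dzb (?F u) z)" for u
    by (rule smooth_on_wirt[OF smooth_on_frechet]) (use assms in auto)
  have 1: "wirt (dz f) z (1/2 * (dz (?F 1) z - \<i> * dz (?F \<i>) z)) (1/2 * (dzb (?F 1) z - \<i> * dzb (?F \<i>) z))"
    using wirt_cmult[OF wirt_diff[OF w[of 1] wirt_cmult[OF w[of \<i>], of \<i>]], of "1/2"]
    by (simp add: dz_def[abs_def])
  have 2: "wirt (dzb f) z (1/2 * (dz (?F 1) z + \<i> * dz (?F \<i>) z)) (1/2 * (dzb (?F 1) z + \<i> * dzb (?F \<i>) z))"
    using wirt_cmult[OF wirt_add[OF w[of 1] wirt_cmult[OF w[of \<i>], of \<i>]], of "1/2"]
    by (simp add: dzb_def[abs_def])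
  show ?thesis unfolding wirt_dzb[OF 1] wirt_dz[OF 2]
    using frechet_derivative_commute[OF assms, of 1 \<i>]
    by (simp add: dz_def[of "?F _"] dzb_def[of "?F _"] field_simps)
qed

section \<open>Local conjugate coordinates\<close>

text \<open>Picard iteration for the system f' = F, F' = a F + T f, with integration replaced by
  taking holomorphic primitives on a disc. The terms of the iteration decay like 2^(-n), and the sum
  is differentiated term by term.\<close>

lemma holomorphic_linear_ode:
  fixes a T :: "complex \<Rightarrow> complex"
  assumes "open U" "z0 \<in> U" "a holomorphic_on U" "T holomorphic_on U"
  obtains r f F where "r > 0" "ball z0 r \<subseteq> U" "f z0 = c0" "F z0 = c1"
    "\<And>z. z \<in> ball z0 r \<Longrightarrow> (f has_field_derivative F z) (at z)"
    "\<And>z. z \<in> ball z0 r \<Longrightarrow> (F has_field_derivative a z * F z + T z * f z) (at z)"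
proof -
  obtain r0 where r0: "r0 > 0" "cball z0 r0 \<subseteq> U"
    using assms(1,2) open_contains_cball by blast
  have "continuous_on (cball z0 r0) a" "continuous_on (cball z0 r0) T"
    using assms(3,4) r0(2) holomorphic_on_imp_continuous_on continuous_on_subset by blast+
  then have "bounded (a ` cball z0 r0)" "bounded (T ` cball z0 r0)"
    by (auto intro!: compact_imp_bounded compact_continuous_image)
  then obtain M1 M2 where M: "\<And>z. z \<in> cball z0 r0 \<Longrightarrow> norm (a z) \<le> M1" "\<And>z. z \<in> cball z0 r0 \<Longrightarrow> norm (T z) \<le> M2"
    unfolding bounded_iff by blast
  define M where "M = max 1 (max M1 M2)"
  \<comment> \<open>With both coefficients bounded by \<open>M\<close>, the right-hand side a F + T
    f enlarges a bound by at most 2 M and a primitive multiplies it by \<open>r\<close>, so 2 M r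
    \<le> 1/2 halves the bound at every step. \<open>M \<ge> 1\<close> also gives r \<le> 1/2, which
    the equation f' = F needs.\<close>
  define r where "r = min r0 (1 / (4 * M))"
  define B where "B = ball z0 r"
  have M1: "M \<ge> 1" by (simp add: M_def)
  have r: "r > 0" "r \<le> r0" "r * (2 * M) \<le> 1/2" "r \<le> 1/2"
  proof -
    show "r > 0" "r \<le> r0" using r0 M1 by (auto simp: r_def)
    have "r \<le> 1 / (4 * M)" by (simp add: r_def)
    then show "r * (2 * M) \<le> 1/2" using M1 by (simp add: field_simps)
    have "1 / (4 * M) \<le> 1/2" using M1 by (simp add: field_simps)
    then show "r \<le> 1/2" unfolding r_def by linarith
  qed
  have BU: "B \<subseteq> U" "B \<subseteq> cball z0 r0" using r0 r by (auto simp: B_def subset_eq)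
  have zB: "z0 \<in> B" "open B" "convex B" using r by (auto simp: B_def)
  have Mb: "norm (a z) \<le> M" "norm (T z) \<le> M" if "z \<in> B" for z
    using M(1)[of z] M(2)[of z] that BU by (auto simp: M_def)
  define I where "I \<phi> = (SOME g. (\<forall>z\<in>B. (g has_field_derivative \<phi> z) (at z)) \<and> g z0 = 0)" for \<phi> :: "complex \<Rightarrow> complex"
  have I: "\<And>z. z \<in> B \<Longrightarrow> (I \<phi> has_field_derivative \<phi> z) (at z)" "I \<phi> z0 = 0" if hp: "\<phi> holomorphic_on B" for \<phi>
  proof -
    obtain g where g: "\<And>z. z \<in> B \<Longrightarrow> (g has_field_derivative \<phi> z) (at z within B)"
      using holomorphic_convex_primitive'[OF zB(3,2) hp] by blast
    have "(\<forall>z\<in>B. ((\<lambda>z. g z - g z0) has_field_derivative \<phi> z) (at z)) \<and> g z0 - g z0 = 0"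
      using g at_within_open[OF _ zB(2)] by (auto intro!: derivative_eq_intros)
    then have "(\<forall>z\<in>B. (I \<phi> has_field_derivative \<phi> z) (at z)) \<and> I \<phi> z0 = 0"
      unfolding I_def by (rule someI[where P="\<lambda>g. (\<forall>z\<in>B. (g has_field_derivative \<phi> z) (at z)) \<and> g z0 = 0"])
    then show "\<And>z. z \<in> B \<Longrightarrow> (I \<phi> has_field_derivative \<phi> z) (at z)" "I \<phi> z0 = 0" by auto
  qed
  have Ib: "norm (I \<phi> z) \<le> K * r" if "\<phi> holomorphic_on B" "\<And>z. z \<in> B \<Longrightarrow> norm (\<phi> z) \<le> K" "z \<in> B" for \<phi> K z
  proof -
    have "norm (I \<phi> z - I \<phi> z0) \<le> K * norm (z - z0)"
      by (rule field_differentiable_bound[OF zB(3), where f'=\<phi>])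
         (use I[OF that(1)] that zB in \<open>auto intro: has_field_derivative_at_within\<close>)
    also have "\<dots> \<le> K * r"
      using that r order_trans[OF norm_ge_zero that(2)[OF that(3)]]
      by (intro mult_left_mono) (auto simp: B_def dist_norm norm_minus_commute)
    finally show ?thesis using I(2)[OF that(1)] by simp
  qed
  \<comment> \<open>The terms of the series, not its partial sums: term 0 is the constant initial
    data, and each later term is the primitive of the right-hand side evaluated at the preceding
    term.\<close>
  define st where "st = rec_nat (\<lambda>_::complex. c0, \<lambda>_::complex. c1) (\<lambda>_ p. (I (snd p), I (\<lambda>z. a z * snd p z + T z * fst p z)))"
  define \<phi> \<Phi> where "\<phi> n = fst (st n)" and "\<Phi> n = snd (st n)" for n
  have st0: "\<phi> 0 = (\<lambda>_. c0)" "\<Phi> 0 = (\<lambda>_. c1)"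
    and stS: "\<phi> (Suc n) = I (\<Phi> n)" "\<Phi> (Suc n) = I (\<lambda>z. a z * \<Phi> n z + T z * \<phi> n z)" for n
    by (simp_all add: \<phi>_def \<Phi>_def st_def)
  have aT: "a holomorphic_on B" "T holomorphic_on B" using assms BU holomorphic_on_subset by blast+
  have hol: "\<phi> n holomorphic_on B \<and> \<Phi> n holomorphic_on B" for n
  proof (induction n)
    case 0 then show ?case by (simp add: st0)
  next
    case (Suc n)
    then have "(\<lambda>z. a z * \<Phi> n z + T z * \<phi> n z) holomorphic_on B" by (intro holomorphic_intros aT) auto
    then show ?case unfolding stS using I(1) Suc zB(2) by (meson holomorphic_on_open)
  qed
  have hol': "(\<lambda>z. a z * \<Phi> n z + T z * \<phi> n z) holomorphic_on B" for n
    using hol[of n] by (intro holomorphic_intros aT) auto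
  define K where "K = max (norm c0) (norm c1)"
  have K: "K \<ge> 0" by (simp add: K_def le_max_iff_disj)
  have bnd: "\<forall>z\<in>B. norm (\<phi> n z) \<le> K * (1/2)^n \<and> norm (\<Phi> n z) \<le> K * (1/2)^n" for n
  proof (induction n)
    case 0 then show ?case by (simp add: st0 K_def)
  next
    case (Suc n)
    show ?case
    proof (intro ballI conjI)
      fix z assume z: "z \<in> B"
      have "norm (\<phi> (Suc n) z) \<le> (K * (1/2)^n) * r"
        unfolding stS using Suc z hol by (intro Ib) auto
      also have "\<dots> \<le> (K * (1/2)^n) * (1/2)" using r K by (intro mult_left_mono) auto
      finally show "norm (\<phi> (Suc n) z) \<le> K * (1/2)^Suc n" by simp
      have "norm (a x * \<Phi> n x + T x * \<phi> n x) \<le> 2 * M * (K * (1/2)^n)" if "x \<in> B" for x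
      proof -
        have "norm (a x * \<Phi> n x + T x * \<phi> n x) \<le> norm (a x) * norm (\<Phi> n x) + norm (T x) * norm (\<phi> n x)"
          by (metis norm_mult norm_triangle_ineq)
        also have "\<dots> \<le> M * (K * (1/2)^n) + M * (K * (1/2)^n)"
          using Suc that Mb[OF that] M1 by (intro add_mono mult_mono) auto
        finally show ?thesis by (simp add: mult_ac)
      qed
      then have "norm (\<Phi> (Suc n) z) \<le> (2 * M * (K * (1/2)^n)) * r"
        unfolding stS by (intro Ib hol' z) auto
      also have "\<dots> = (K * (1/2)^n) * (r * (2 * M))" by simp
      also have "\<dots> \<le> (K * (1/2)^n) * (1/2)" using r K by (intro mult_left_mono) auto
      finally show "norm (\<Phi> (Suc n) z) \<le> K * (1/2)^Suc n" by simp
    qed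
  qed
  have sm: "summable (\<lambda>n. K * (1/2)^n)" by (intro summable_mult summable_geometric) auto
  have smz: "summable (\<lambda>n. \<phi> n z)" "summable (\<lambda>n. \<Phi> n z)" if "z \<in> B" for z
    by (rule summable_comparison_test'[OF sm, of 0], use bnd that in blast)+
  define f F where "f z = (\<Sum>n. \<phi> n z)" and "F z = (\<Sum>n. \<Phi> n z)" for z
  have series: "((\<lambda>z. \<Sum>n. \<psi> n z) has_field_derivative (\<Sum>n. \<eta> n z)) (at z)"
    if \<psi>0: "\<And>z. (\<psi> 0 has_field_derivative 0) (at z)"
      and \<psi>: "\<And>n z. z \<in> B \<Longrightarrow> (\<psi> (Suc n) has_field_derivative \<eta> n z) (at z)"
      and \<eta>: "\<And>n z. z \<in> B \<Longrightarrow> norm (\<eta> n z) \<le> N * (1/2)^n"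
      and sm0: "summable (\<lambda>n. \<psi> n z0)" and z: "z \<in> B" for \<psi> \<eta> :: "nat \<Rightarrow> complex \<Rightarrow> complex" and N z
  proof -
    \<comment> \<open>Term 0 is constant and term n + 1 has derivative \<open>\<eta> n\<close>; the
      inserted zero aligns the indices.\<close>
    define \<eta>' where "\<eta>' n = (case n of 0 \<Rightarrow> (\<lambda>_. 0) | Suc m \<Rightarrow> \<eta> m)" for n
    have N: "N \<ge> 0" using order_trans[OF norm_ge_zero \<eta>[OF zB(1), of 0]] by simp
    have b: "norm (\<eta>' n x) \<le> (2 * N) * (1/2)^n" if "x \<in> B" for n x
      using \<eta>[OF that] N by (cases n) (auto simp: \<eta>'_def)
    have smN: "summable (\<lambda>n. (2 * N) * (1/2)^n)" by (intro summable_mult summable_geometric) auto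
    have "((\<lambda>z. \<Sum>n. \<psi> n z) has_field_derivative (\<Sum>n. \<eta>' n z)) (at z)"
    proof (rule has_field_derivative_series'(2)[OF zB(3)])
      show "(\<psi> n has_field_derivative \<eta>' n x) (at x within B)" if "x \<in> B" for n x
        using \<psi>0 \<psi>[OF that] by (cases n) (auto simp: \<eta>'_def intro: has_field_derivative_at_within)
      show "uniformly_convergent_on B (\<lambda>n x. \<Sum>i<n. \<eta>' i x)"
        by (rule Weierstrass_m_test'[OF b smN])
    qed (use zB sm0 z in \<open>auto simp: interior_open\<close>)
    moreover have "(\<Sum>n. \<eta>' n z) = (\<Sum>n. \<eta> n z)"
      using suminf_split_head[OF summable_comparison_test'[OF smN, of 0 "\<lambda>n. \<eta>' n z"]] b[OF z]
      by (simp add: \<eta>'_def)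
    ultimately show ?thesis by simp
  qed
  show ?thesis
  proof (rule that[of r f F])
    show "ball z0 r \<subseteq> U" using BU by (simp add: B_def)
    \<comment> \<open>All later terms are primitives normalized to vanish at \<open>z0\<close>, so
      term 0 alone carries the initial values.\<close>
    have 0: "\<phi> n z0 = (if n = 0 then c0 else 0)" "\<Phi> n z0 = (if n = 0 then c1 else 0)" for n
      using I(2) hol hol' by (cases n; simp add: st0 stS)+
    show "f z0 = c0" "F z0 = c1"
      using suminf_finite[of "{0::nat}" "\<lambda>n. \<phi> n z0"] suminf_finite[of "{0::nat}" "\<lambda>n. \<Phi> n z0"]
      by (auto simp: f_def F_def 0)
    fix z assume z: "z \<in> ball z0 r"
    have zb: "z \<in> B" using z by (simp add: B_def)
    show "(f has_field_derivative F z) (at z)"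
      unfolding f_def[abs_def] F_def
      by (rule series[where N=K])
         (use zb zB smz bnd hol in \<open>auto simp: st0 stS intro: I\<close>)
    have "(F has_field_derivative (\<Sum>n. a z * \<Phi> n z + T z * \<phi> n z)) (at z)"
      unfolding F_def[abs_def]
    proof (rule series[where N="2 * M * K"])
      show "norm (a x * \<Phi> n x + T x * \<phi> n x) \<le> 2 * M * K * (1/2)^n" if "x \<in> B" for n x
      proof -
        have "norm (a x * \<Phi> n x + T x * \<phi> n x) \<le> norm (a x) * norm (\<Phi> n x) + norm (T x) * norm (\<phi> n x)"
          by (metis norm_mult norm_triangle_ineq)
        also have "\<dots> \<le> M * (K * (1/2)^n) + M * (K * (1/2)^n)"
          using bnd that Mb[OF that] M1 by (intro add_mono mult_mono) auto
        finally show ?thesis by (simp add: mult_ac)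
      qed
    qed (use zb zB smz bnd hol' in \<open>auto simp: st0 stS intro: I\<close>)
    also have "(\<Sum>n. a z * \<Phi> n z + T z * \<phi> n z) = a z * F z + T z * f z"
      using smz[OF zb] by (simp add: suminf_add[symmetric] suminf_mult summable_mult f_def F_def)
    finally show "(F has_field_derivative a z * F z + T z * f z) (at z)" .
  qed (use r in auto)
qed

text \<open>Let |E| be maximal at \<open>z1\<close> on a closed disc of radius \<open>r\<close>
  about the zero \<open>z0\<close>. The derivative is bounded by M |E(z1)|, so the mean value
  inequality with M r \<le> 1/2 gives |E(z1)| \<le> |E(z1)| / 2.\<close>

lemma wirt_zero_unique:
  assumes "open U" "z0 \<in> U" "E z0 = 0" "continuous_on U \<alpha>" "continuous_on U \<beta>"
    and w: "\<And>z. z \<in> U \<Longrightarrow> wirt E z (\<alpha> z * E z) (\<beta> z * cnj (E z))"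
  obtains r where "r > 0" "ball z0 r \<subseteq> U" "\<And>z. z \<in> ball z0 r \<Longrightarrow> E z = 0"
proof -
  obtain r0 where r0: "r0 > 0" "cball z0 r0 \<subseteq> U"
    using assms(1,2) open_contains_cball by blast
  have "bounded (\<alpha> ` cball z0 r0)" "bounded (\<beta> ` cball z0 r0)"
    using assms(4,5) r0(2) continuous_on_subset
    by (auto intro!: compact_imp_bounded compact_continuous_image; blast)+
  then obtain M1 M2 where M: "\<And>z. z \<in> cball z0 r0 \<Longrightarrow> norm (\<alpha> z) \<le> M1" "\<And>z. z \<in> cball z0 r0 \<Longrightarrow> norm (\<beta> z) \<le> M2"
    unfolding bounded_iff by blast
  define M where "M = max 1 (M1 + M2)"
  define r where "r = min r0 (1 / (2 * M))"
  have M1: "M \<ge> 1" by (simp add: M_def)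
  have r: "r > 0" "r \<le> r0" "M * r \<le> 1/2"
    using r0 M1 by (auto simp: r_def min_def field_simps)
  let ?K = "cball z0 r"
  have KU: "?K \<subseteq> U" "?K \<subseteq> cball z0 r0" using r0 r by auto
  have "continuous_on ?K E"
    using w KU wirt_differentiable differentiable_imp_continuous_within
    by (intro continuous_at_imp_continuous_on) blast
  then have "continuous_on ?K (\<lambda>z. norm (E z))" by (rule continuous_on_norm)
  then obtain z1 where z1: "z1 \<in> ?K" "\<And>z. z \<in> ?K \<Longrightarrow> norm (E z) \<le> norm (E z1)"
    using continuous_attains_sup[of ?K "\<lambda>z. norm (E z)"] r by auto
  have "norm (E z1 - E z0) \<le> (M * norm (E z1)) * norm (z1 - z0)"
  proof (rule differentiable_bound[where S="?K"])
    fix x assume x: "x \<in> ?K"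
    show "(E has_derivative (\<lambda>\<xi>. \<alpha> x * E x * \<xi> + \<beta> x * cnj (E x) * cnj \<xi>)) (at x within ?K)"
      using w[of x] x KU unfolding wirt_def by (blast intro: has_derivative_at_withinI)
    show "onorm (\<lambda>\<xi>. \<alpha> x * E x * \<xi> + \<beta> x * cnj (E x) * cnj \<xi>) \<le> M * norm (E z1)"
    proof (rule onorm_le)
      fix \<xi>
      have "norm (\<alpha> x * E x * \<xi> + \<beta> x * cnj (E x) * cnj \<xi>) \<le> norm (\<alpha> x * E x * \<xi>) + norm (\<beta> x * cnj (E x) * cnj \<xi>)"
        by (rule norm_triangle_ineq)
      also have "\<dots> = (norm (\<alpha> x) + norm (\<beta> x)) * norm (E x) * norm \<xi>"
        by (simp add: norm_mult algebra_simps)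
      also have "\<dots> \<le> M * norm (E z1) * norm \<xi>"
        using M(1)[of x] M(2)[of x] x KU z1(2)[OF x] M1 unfolding M_def
        by (intro mult_right_mono mult_mono) auto
      finally show "norm (\<alpha> x * E x * \<xi> + \<beta> x * cnj (E x) * cnj \<xi>) \<le> M * norm (E z1) * norm \<xi>" .
    qed
  qed (use z1 r in auto)
  also have "\<dots> \<le> (M * norm (E z1)) * r"
    using z1 M1 by (intro mult_left_mono) (auto simp: dist_norm norm_minus_commute)
  also have "\<dots> = norm (E z1) * (M * r)" by simp
  also have "\<dots> \<le> norm (E z1) * (1/2)" using r by (intro mult_left_mono) auto
  finally have "E z1 = 0" using assms(3) by simp
  then show ?thesis
    using that[of r] r KU z1(2) by force
qed

section \<open>Special Kaehler structures in a coordinate domain\<close>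

text \<open>The metric w |dz|^2. Every Hermitian metric on a plane domain has this form by
  \<open>hermitian_metric_conf\<close>, so a metric is handled through one positive
  function.\<close>

definition conf :: "(complex \<Rightarrow> real) \<Rightarrow> local_metric" where
  "conf w z u v = w z * (u \<bullet> v)"

text \<open>The z-derivative of ln w, written as a quotient so that the product rule applies to it
  without differentiating a logarithm. For w |dz|^2 it is the coefficient of the Levi-Civita
  connection.\<close>

definition log_dz :: "(complex \<Rightarrow> real) \<Rightarrow> complex \<Rightarrow> complex" where
  "log_dz w z = dz (\<lambda>x. of_real (w x)) z / of_real (w z)"

definition sk_factor :: "(complex \<Rightarrow> real) \<Rightarrow> (complex \<Rightarrow> complex) \<Rightarrow> complex \<Rightarrow> real" where
  "sk_factor H \<Xi> z = 4 * norm (\<Xi> z) / sqrt (H z)"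

definition sk_lin :: "(complex \<Rightarrow> real) \<Rightarrow> (complex \<Rightarrow> complex) \<Rightarrow> complex \<Rightarrow> complex" where
  "sk_lin H \<Xi> = log_dz (sk_factor H \<Xi>)"

definition sk_anti :: "(complex \<Rightarrow> real) \<Rightarrow> (complex \<Rightarrow> complex) \<Rightarrow> complex \<Rightarrow> complex" where
  "sk_anti H \<Xi> z = - 2 * \<i> * cnj (\<Xi> z) / of_real (sk_factor H \<Xi> z)"

definition sk_connection :: "(complex \<Rightarrow> real) \<Rightarrow> (complex \<Rightarrow> complex) \<Rightarrow> local_connection" where
  "sk_connection H \<Xi> z u v = sk_lin H \<Xi> z * (u * v) + sk_anti H \<Xi> z * cnj (u * v)"

text \<open>A real function equals its conjugate, and conjugation exchanges and conjugates the two
  Wirtinger derivatives.\<close>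

lemma wirt_of_real:
  assumes "w differentiable (at z)"
  shows "wirt (\<lambda>x. of_real (w x)) z (dz (\<lambda>x. of_real (w x)) z) (cnj (dz (\<lambda>x. of_real (w x)) z))"
proof -
  have "(\<lambda>x. complex_of_real (w x)) differentiable (at z)"
    using assms bounded_linear.has_derivative[OF bounded_linear_of_real]
    unfolding differentiable_def by blast
  from differentiable_wirt[OF this]
  have 1: "wirt (\<lambda>x. of_real (w x)) z (dz (\<lambda>x. of_real (w x)) z) (dzb (\<lambda>x. of_real (w x)) z)" .
  from wirt_unique[OF wirt_cnj[OF 1, simplified] 1] 1 show ?thesis by simp
qed

lemma wirt_log_dz:
  assumes "w differentiable (at z)" "w z \<noteq> 0"
  shows "wirt (\<lambda>x. of_real (w x)) z (log_dz w z * w z) (cnj (log_dz w z) * w z)"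
  using wirt_of_real[OF assms(1)] assms(2) by (simp add: log_dz_def)

lemma log_dzI:
  fixes p :: complex
  shows "wirt (\<lambda>x. of_real (w x)) z (p * w z) b \<Longrightarrow> w z \<noteq> 0 \<Longrightarrow> log_dz w z = p"
  by (simp add: log_dz_def wirt_dz)

lemma smooth_of_real: "open U \<Longrightarrow> smooth_on U w \<Longrightarrow> smooth_on U (\<lambda>x. complex_of_real (w x))"
  by (rule smooth_on_bounded_linear[OF bounded_linear_of_real])

lemma smooth_cnj: "open U \<Longrightarrow> smooth_on U f \<Longrightarrow> smooth_on U (\<lambda>x. cnj (f x))"
  by (rule smooth_on_bounded_linear[OF bounded_linear_cnj])

lemma smooth_log_dz:
  assumes "open U" "smooth_on U w" "\<And>z. z \<in> U \<Longrightarrow> w z \<noteq> 0" shows "smooth_on U (log_dz w)"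
  unfolding log_dz_def[abs_def] divide_inverse
  by (intro smooth_on_mult smooth_on_inverse smooth_dz smooth_of_real assms) (use assms in auto)

lemma smooth_sk_factor:
  assumes "open U" "smooth_on U H" "\<And>z. z \<in> U \<Longrightarrow> H z > 0" "\<Xi> holomorphic_on U" "\<And>z. z \<in> U \<Longrightarrow> \<Xi> z \<noteq> 0"
  shows "smooth_on U (sk_factor H \<Xi>)"
proof -
  have s: "smooth_on U \<Xi>" using assms smooth_on_holomorphic by blast
  have "smooth_on U (\<lambda>z. norm (\<Xi> z))"
    unfolding cmod_def power2_eq_square
    by (intro smooth_on_sqrt smooth_on_add smooth_on_mult smooth_on_bounded_linear[OF bounded_linear_Re]
        smooth_on_bounded_linear[OF bounded_linear_Im] s assms)
       (use assms(5) in \<open>auto simp: complex_eq_iff sum_squares_gt_zero_iff\<close>)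
  then show ?thesis unfolding sk_factor_def[abs_def] divide_inverse
    by (intro smooth_on_mult smooth_on_inverse smooth_on_sqrt smooth_on_const assms) (use assms(3) in force)+
qed

lemma complex_mult_inner: "(c * u) \<bullet> (c * v) = (norm c)\<^sup>2 * (u \<bullet> (v::complex))"
  by (simp add: inner_complex_def cmod_power2) (simp add: algebra_simps power2_eq_square)

section \<open>Consequences of conjugate coordinates for the metric and the connection\<close>

text \<open>The part of \<open>conjugate_coordinates\<close> that does not involve the connection:
  for g |dz|^2 the condition on the symplectic form is g = Im (cnj Z' W'), which is |Z'|^2 Im
  \<tau>. Positivity of \<open>g\<close> thus places the period map in the upper half-plane.\<close>

locale conjugate_pair =
  fixes V :: "complex set" and Z W :: "complex \<Rightarrow> complex" and g :: "complex \<Rightarrow> real"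
  assumes V: "open V" and Z: "Z holomorphic_on V" and W: "W holomorphic_on V"
    and g: "\<And>x. x \<in> V \<Longrightarrow> g x = Im (cnj (deriv Z x) * deriv W x)"
    and pos: "\<And>x. x \<in> V \<Longrightarrow> g x > 0"
begin

text \<open>A quarter of the Wronskian of Z' and W'. Since \<tau>' = 4 X / Z'^2, it is the
  coefficient of the associated cubic form.\<close>

definition X :: "complex \<Rightarrow> complex" where
  "X z = (deriv (deriv W) z * deriv Z z - deriv W z * deriv (deriv Z) z) / 4"

lemma Z1_nonzero: "z \<in> V \<Longrightarrow> deriv Z z \<noteq> 0"
  using g[of z] pos[of z] by auto

lemma derivs:
  assumes "z \<in> V"
  shows "(deriv Z has_field_derivative deriv (deriv Z) z) (at z)"
    "(deriv W has_field_derivative deriv (deriv W) z) (at z)"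
  using assms V Z W by (meson holomorphic_deriv holomorphic_derivI)+

lemma X4: "4 * X z = deriv (deriv W) z * deriv Z z - deriv W z * deriv (deriv Z) z"
  by (simp add: X_def)

lemma g_complex2: "x \<in> V \<Longrightarrow> 2 * \<i> * complex_of_real (g x) = cnj (deriv Z x) * deriv W x - deriv Z x * cnj (deriv W x)"
  by (simp add: g complex_eq_iff)

lemma g_complex: "x \<in> V \<Longrightarrow> complex_of_real (g x) = (cnj (deriv Z x) * deriv W x - deriv Z x * cnj (deriv W x)) / (2 * \<i>)"
  by (simp flip: g_complex2)

lemma log_dz_g:
  assumes z: "z \<in> V"
  shows "log_dz g z = (cnj (deriv Z z) * deriv (deriv W) z - deriv (deriv Z) z * cnj (deriv W z)) / (2 * \<i> * g z)"
proof (rule log_dzI)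
  note dZ = wirt_field[OF derivs(1)[OF z]] and dW = wirt_field[OF derivs(2)[OF z]]
  have "wirt (\<lambda>x. 1 / (2 * \<i>) * (cnj (deriv Z x) * deriv W x - deriv Z x * cnj (deriv W x))) z
     (log_dz g z * 0 + (cnj (deriv Z z) * deriv (deriv W) z - deriv (deriv Z) z * cnj (deriv W z)) / (2 * \<i>))
     (1 / (2 * \<i>) * (cnj (deriv (deriv Z) z) * deriv W z - deriv Z z * cnj (deriv (deriv W) z)))"
    using wirt_cmult[OF wirt_diff[OF wirt_mult[OF wirt_cnj[OF dZ] dW] wirt_mult[OF dZ wirt_cnj[OF dW]]], of "1 / (2 * \<i>)"]
    by simp
  from wirt_cong_open[OF this V z, of "\<lambda>x. of_real (g x)"]
  show "wirt (\<lambda>x. complex_of_real (g x)) z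
     ((cnj (deriv Z z) * deriv (deriv W) z - deriv (deriv Z) z * cnj (deriv W z)) / (2 * \<i> * g z) * g z)
     (1 / (2 * \<i>) * (cnj (deriv (deriv Z) z) * deriv W z - deriv Z z * cnj (deriv (deriv W) z)))"
    using pos[OF z] by (simp add: g_complex)
qed (use pos[OF z] in simp)

lemma deriv_period_map:
  assumes z: "z \<in> V" shows "deriv (period_map Z W) z = 4 * X z / (deriv Z z)\<^sup>2"
proof -
  have "(period_map Z W has_field_derivative 4 * X z / (deriv Z z)\<^sup>2) (at z)"
    unfolding period_map_def[abs_def]
    by (rule DERIV_cong[OF DERIV_divide[OF derivs(2)[OF z] derivs(1)[OF z] Z1_nonzero[OF z]]])
       (simp add: X4 power2_eq_square)
  then show ?thesis by (rule DERIV_imp_deriv)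
qed

lemma period_cubic_eq: "z \<in> V \<Longrightarrow> period_cubic Z W z = X z"
  using Z1_nonzero[of z] by (simp add: period_cubic_def deriv_period_map field_simps power2_eq_square power3_eq_cube)

text \<open>Im \<tau> = g / |Z'|^2 and |\<tau>'| = 4 |X| / |Z'|^2, so Z' cancels from |\<tau>'|^2 /
  (Im \<tau>)^2. This relation is what determines the metric from the data.\<close>

lemma period_metric_eq:
  assumes z: "z \<in> V"
  shows "pullback_metric (period_map Z W) upper_half_plane_metric z = conf (\<lambda>z. 16 * (norm (X z))\<^sup>2 / (g z)\<^sup>2) z"
proof -
  have n: "norm (deriv Z z) > 0" using Z1_nonzero[OF z] by simp
  have "Im (period_map Z W z) = Im (deriv W z * cnj (deriv Z z) / of_real ((norm (deriv Z z))\<^sup>2))"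
    by (simp only: period_map_def complex_div_cnj[of "deriv W z" "deriv Z z"] of_real_power)
  also have "\<dots> = g z / (norm (deriv Z z))\<^sup>2"
    unfolding Im_divide_of_real g[OF z] by (simp add: mult.commute)
  finally have I: "Im (period_map Z W z) = g z / (norm (deriv Z z))\<^sup>2" .
  show ?thesis
    unfolding pullback_metric_def upper_half_plane_metric_def conf_def fun_eq_iff complex_mult_inner
      deriv_period_map[OF z] I
    using n pos[OF z] by (simp add: norm_divide norm_mult norm_power field_simps)
qed

text \<open>Cramer's rule: \<open>X4\<close> and \<open>log_dz_g\<close> are two linear equations
  for Z'' and W'' whose determinant is 2 \<i> g up to sign. Solved, they say that Z' and W' satisfy
  the parallel equation with coefficients expressed by \<open>g\<close> and
  \<open>X\<close>.\<close>

lemma second_derivs: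
  assumes z: "z \<in> V"
  shows "deriv (deriv Z) z = log_dz g z * deriv Z z + cnj (- 2 * \<i> * cnj (X z) / g z) * cnj (deriv Z z)"
    "deriv (deriv W) z = log_dz g z * deriv W z + cnj (- 2 * \<i> * cnj (X z) / g z) * cnj (deriv W z)"
proof -
  have gz: "complex_of_real (g z) \<noteq> 0" using pos[OF z] by simp
  have G: "2 * \<i> * of_real (g z) = cnj (deriv Z z) * deriv W z - deriv Z z * cnj (deriv W z)"
    using g_complex2[OF z] .
  have "2 * \<i> * of_real (g z) * (log_dz g z * c + cnj (- 2 * \<i> * cnj (X z) / g z) * cnj c)
     = (cnj (deriv Z z) * deriv (deriv W) z - deriv (deriv Z) z * cnj (deriv W z)) * c
     - 4 * X z * cnj c" for c
    unfolding log_dz_g[OF z] using gz by (simp add: field_simps)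
  note e = this
  have "2 * \<i> * of_real (g z) * deriv (deriv Z) z = 2 * \<i> * of_real (g z) *
     (log_dz g z * deriv Z z + cnj (- 2 * \<i> * cnj (X z) / g z) * cnj (deriv Z z))"
    unfolding e X4 unfolding G by (simp add: algebra_simps)
  then show "deriv (deriv Z) z = log_dz g z * deriv Z z + cnj (- 2 * \<i> * cnj (X z) / g z) * cnj (deriv Z z)"
    using gz by simp
  have "2 * \<i> * of_real (g z) * deriv (deriv W) z = 2 * \<i> * of_real (g z) *
     (log_dz g z * deriv W z + cnj (- 2 * \<i> * cnj (X z) / g z) * cnj (deriv W z))"
    unfolding e X4 unfolding G by (simp add: algebra_simps)
  then show "deriv (deriv W) z = log_dz g z * deriv W z + cnj (- 2 * \<i> * cnj (X z) / g z) * cnj (deriv W z)"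
    using gz by simp
qed

text \<open>Re dZ and Re dW form a coframe because their wedge product is the nonvanishing
  symplectic form up to sign. A vector, and so the value of a connection form, is determined by its
  pairings with them.\<close>

lemma independent:
  assumes z: "z \<in> V" and a: "Re (deriv Z z * a) = 0" "Re (deriv W z * a) = 0" shows "a = 0"
proof -
  have "of_real (2 * g z) * a = - \<i> * (cnj (deriv Z z) * (deriv W z * a) - cnj (deriv W z) * (deriv Z z * a))"
  proof -
    have "of_real (2 * g z) * a = - \<i> * ((2 * \<i> * of_real (g z)) * a)" by simp
    then show ?thesis unfolding g_complex2[OF z] by (simp add: algebra_simps)
  qed
  also have "deriv W z * a = - cnj (deriv W z * a)" using a by (simp add: complex_eq_iff)
  also have "deriv Z z * a = - cnj (deriv Z z * a)" using a by (simp add: complex_eq_iff)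
  finally have "of_real (2 * g z) * a = 0" by (simp add: algebra_simps)
  then show ?thesis using pos[OF z] by simp
qed

end

text \<open>By the Leibniz rule the derivatives of \<open>Y\<close> cancel. What remains is
  tensorial in both fields, so constant fields test it.\<close>

lemma parallel_form_re_d_iff:
  assumes "open V" "Z holomorphic_on V"
  shows "parallel_form_on V \<Gamma> (re_d Z) \<longleftrightarrow>
    (\<forall>z\<in>V. \<forall>u v. Re (deriv (deriv Z) z * (u * v)) = Re (deriv Z z * \<Gamma> z u v))"
proof -
  have d: "frechet_derivative (\<lambda>w. Re (deriv Z w * Y w)) (at z) \<xi> =
      Re (deriv (deriv Z) z * (\<xi> * Y z)) + Re (deriv Z z * frechet_derivative Y (at z) \<xi>)"
    if "z \<in> V" "smooth_on V Y" for Y z \<xi>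
  proof -
    have "(deriv Z has_derivative (\<lambda>v. deriv (deriv Z) z * v)) (at z)"
      using assms that holomorphic_derivI[OF holomorphic_deriv[OF assms(2,1)] assms(1)]
      by (simp add: has_field_derivative_def)
    from has_derivative_mult[OF this smooth_on_differentiable[OF that(2,1), unfolded frechet_derivative_works]]
    have "((\<lambda>w. Re (deriv Z w * Y w)) has_derivative
      (\<lambda>h. Re (deriv Z z * frechet_derivative Y (at z) h + deriv (deriv Z) z * h * Y z))) (at z)"
      by (rule bounded_linear.has_derivative[OF bounded_linear_Re])
    from frechet_derivative_at[OF this, symmetric] show ?thesis by (simp add: algebra_simps)
  qed
  have *: "frechet_derivative (\<lambda>w. Re (deriv Z w * Y w)) (at z) (X z) -
      Re (deriv Z z * (frechet_derivative Y (at z) (X z) + \<Gamma> z (X z) (Y z))) = 0 \<longleftrightarrow>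
      Re (deriv (deriv Z) z * (X z * Y z)) = Re (deriv Z z * \<Gamma> z (X z) (Y z))"
    if "z \<in> V" "smooth_on V Y" for X Y z
    unfolding d[OF that] distrib_left plus_complex.simps by linarith
  have e: "parallel_form_on V \<Gamma> (re_d Z) \<longleftrightarrow>
    (\<forall>X Y. smooth_on V X \<and> smooth_on V Y \<longrightarrow>
       (\<forall>z\<in>V. Re (deriv (deriv Z) z * (X z * Y z)) = Re (deriv Z z * \<Gamma> z (X z) (Y z))))"
    unfolding parallel_form_on_def re_d_def dir_deriv_def cov_def
    using * by blast
  show ?thesis
  proof
    assume p: "parallel_form_on V \<Gamma> (re_d Z)"
    show "\<forall>z\<in>V. \<forall>u v. Re (deriv (deriv Z) z * (u * v)) = Re (deriv Z z * \<Gamma> z u v)"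
    proof (intro ballI allI)
      fix z u v assume "z \<in> V"
      then show "Re (deriv (deriv Z) z * (u * v)) = Re (deriv Z z * \<Gamma> z u v)"
        using p[unfolded e, rule_format, of "\<lambda>_. u" "\<lambda>_. v" z] by simp
    qed
  qed (auto simp: e)
qed

text \<open>Both sides are 2-forms in the plane, so the single component u = 1, v = \<i>
  decides.\<close>

lemma symplectic_conf_iff:
  "(\<forall>u v. symplectic_form (conf g) z u v = - (re_d Z z u * re_d W z v - re_d Z z v * re_d W z u))
   \<longleftrightarrow> g z = Im (cnj (deriv Z z) * deriv W z)"
proof
  assume "\<forall>u v. symplectic_form (conf g) z u v = - (re_d Z z u * re_d W z v - re_d Z z v * re_d W z u)"
  from this[rule_format, of 1 \<i>] show "g z = Im (cnj (deriv Z z) * deriv W z)"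
    by (simp add: symplectic_form_def conf_def re_d_def inner_complex_def algebra_simps)
next
  assume g: "g z = Im (cnj (deriv Z z) * deriv W z)"
  show "\<forall>u v. symplectic_form (conf g) z u v = - (re_d Z z u * re_d W z v - re_d Z z v * re_d W z u)"
    unfolding symplectic_form_def conf_def re_d_def inner_complex_def g by (simp add: algebra_simps)
qed

lemma bilinear_expand:
  assumes "bilinear (B :: complex \<Rightarrow> complex \<Rightarrow> 'b::real_normed_vector)"
  shows "B u v = (Re u * Re v) *\<^sub>R B 1 1 + (Re u * Im v) *\<^sub>R B 1 \<i> + (Im u * Re v) *\<^sub>R B \<i> 1 + (Im u * Im v) *\<^sub>R B \<i> \<i>"
proof -
  have l: "linear (\<lambda>x. B x y)" "linear (B x)" for x y using assms by (auto simp: bilinear_def)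
  show ?thesis
    unfolding linear_complex_eq[OF l(1), of u v] linear_complex_eq[OF l(2), of 1 v] linear_complex_eq[OF l(2), of \<i> v]
    by (simp add: scaleR_add_right)
qed

text \<open>Invariance under multiplication by \<i> equates the diagonal entries in the frame (1,
  \<i>) and makes the off-diagonal entry its own negative.\<close>

lemma hermitian_metric_conf:
  assumes "is_hermitian_metric U G" "z \<in> U"
  shows "G z = conf (\<lambda>z. G z 1 1) z" "G z 1 1 > 0"
proof -
  have b: "bilinear (G z)" and s: "\<And>u v. G z u v = G z v u" and p: "\<And>u. u \<noteq> 0 \<Longrightarrow> G z u u > 0"
    and J: "\<And>u v. G z (\<i> * u) (\<i> * v) = G z u v"
    using assms unfolding is_hermitian_metric_def by auto
  show "G z 1 1 > 0" using p[of 1] by simp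
  have "linear (G z \<i>)" using b by (auto simp: bilinear_def)
  from linear_neg[OF this, of 1] have "G z \<i> (-1) = - G z \<i> 1" by simp
  then have "G z 1 \<i> = 0" "G z \<i> 1 = 0" using J[of 1 \<i>] s[of 1 \<i>] by auto
  moreover have "G z \<i> \<i> = G z 1 1" using J[of 1 1] by simp
  ultimately show "G z = conf (\<lambda>z. G z 1 1) z"
    by (intro ext, subst bilinear_expand[OF b]) (simp add: conf_def inner_complex_def algebra_simps)
qed

lemma hermitian_metric_smooth: "is_hermitian_metric U G \<Longrightarrow> smooth_on U (\<lambda>z. G z 1 1)"
  by (simp add: is_hermitian_metric_def)

lemma is_hermitian_conf:
  assumes "open U" "smooth_on U w" "\<And>z. z \<in> U \<Longrightarrow> w z > 0"
  shows "is_hermitian_metric U (conf w)"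
  unfolding is_hermitian_metric_def conf_def
proof (intro conjI ballI allI impI)
  show "smooth_on U (\<lambda>z. w z * (u \<bullet> v))" for u v :: complex
    by (intro smooth_on_mult smooth_on_const assms)
  show "bilinear (\<lambda>u v. w z * (u \<bullet> v))" for z
    by (auto simp: bilinear_def linear_iff inner_add inner_scaleR algebra_simps)
qed (use assms(3) in \<open>auto simp: inner_commute inner_complex_def sum_power2_gt_zero_iff complex_eq_iff power2_eq_square[symmetric] intro: mult_pos_pos\<close>)

lemma dir_deriv_wirt: "wirt f z a b \<Longrightarrow> dir_deriv f X z = a * X z + b * cnj (X z)"
  by (simp add: dir_deriv_def wirt_frechet)

lemma dir_deriv_Re_wirt:
  assumes "wirt f z a b" shows "dir_deriv (\<lambda>w. Re (f w)) X z = Re (a * X z + b * cnj (X z))"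
  using frechet_derivative_bounded_linear[OF bounded_linear_Re wirt_differentiable[OF assms]]
  by (simp add: dir_deriv_def wirt_frechet[OF assms])

section \<open>From curvature -1 to the Liouville equation\<close>

text \<open>The Koszul formula on constant fields: metric compatibility in the three cyclic
  positions, added with signs +, +, -, isolates the connection once torsion-freeness makes it
  symmetric. For a conformal metric the answer is complex bilinear.\<close>

lemma levi_civita_conf:
  assumes U: "open U" and h: "is_hermitian_metric U h" and lc: "is_levi_civita U h \<Gamma>" and z: "z \<in> U"
  shows "\<Gamma> z x y = log_dz (\<lambda>z. h z 1 1) z * (x * y)"
proof -
  define H where "H z = h z 1 1" for z
  have hH: "h w u v = H w * (u \<bullet> v)" if "w \<in> U" for w u v
    using hermitian_metric_conf(1)[OF h that] by (metis H_def conf_def)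
  have pos: "H z > 0" using hermitian_metric_conf(2)[OF h z] by (simp add: H_def)
  have Hd: "H differentiable (at z)"
    using smooth_on_differentiable[OF hermitian_metric_smooth[OF h] z] by (simp add: H_def[abs_def])
  define p where "p = log_dz H z"
  have wH: "wirt (\<lambda>x. of_real (H x)) z (p * H z) (cnj p * H z)"
    unfolding p_def using wirt_log_dz[OF Hd] pos by simp
  have sym: "\<Gamma> z u v = \<Gamma> z v u" for u v
  proof -
    have "cov \<Gamma> (\<lambda>_. u) (\<lambda>_. v) z - cov \<Gamma> (\<lambda>_. v) (\<lambda>_. u) z = lie_bracket (\<lambda>_. u) (\<lambda>_. v) z"
      using lc z unfolding is_levi_civita_def torsion_free_on_def by simp
    then show ?thesis by (simp add: cov_def lie_bracket_def dir_deriv_def)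
  qed
  have met: "2 * Re (p * \<xi>) * (u \<bullet> v) = \<Gamma> z \<xi> u \<bullet> v + u \<bullet> \<Gamma> z \<xi> v" for \<xi> u v
  proof -
    have "dir_deriv (\<lambda>w. h w u v) (\<lambda>_. \<xi>) z = h z (cov \<Gamma> (\<lambda>_. \<xi>) (\<lambda>_. u) z) v + h z u (cov \<Gamma> (\<lambda>_. \<xi>) (\<lambda>_. v) z)"
      using lc z unfolding is_levi_civita_def parallel_bilinear_on_def by simp
    also have "\<dots> = H z * (\<Gamma> z \<xi> u \<bullet> v + u \<bullet> \<Gamma> z \<xi> v)"
      by (simp add: cov_def dir_deriv_def hH[OF z] algebra_simps)
    also have "dir_deriv (\<lambda>w. h w u v) (\<lambda>_. \<xi>) z = dir_deriv (\<lambda>w. Re (of_real (u \<bullet> v) * of_real (H w))) (\<lambda>_. \<xi>) z"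
      unfolding dir_deriv_def by (subst frechet_derivative_cong_open[OF U z]) (simp_all add: hH)
    also have "\<dots> = H z * (2 * Re (p * \<xi>) * (u \<bullet> v))"
      unfolding dir_deriv_Re_wirt[OF wirt_cmult[OF wH]] by (simp add: algebra_simps)
    finally show ?thesis using pos by simp
  qed
  have "2 * (\<Gamma> z x y \<bullet> w) = 2 * ((p * (x * y)) \<bullet> w)" for w
  proof -
    have "2 * (\<Gamma> z x y \<bullet> w) = (\<Gamma> z x y \<bullet> w + y \<bullet> \<Gamma> z x w) + (\<Gamma> z y x \<bullet> w + x \<bullet> \<Gamma> z y w) - (\<Gamma> z w x \<bullet> y + x \<bullet> \<Gamma> z w y)"
      using sym[of x y] sym[of x w] sym[of y w] by (simp add: inner_commute)
    also have "\<dots> = 2 * ((p * (x * y)) \<bullet> w)"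
      unfolding met[symmetric] by (simp add: inner_complex_def algebra_simps)
    finally show ?thesis .
  qed
  then have "(\<Gamma> z x y - p * (x * y)) \<bullet> w = 0" for w by (simp add: inner_diff_left)
  then have "\<Gamma> z x y - p * (x * y) = 0" using inner_eq_zero_iff by blast
  then show ?thesis by (simp add: p_def H_def[abs_def])
qed

text \<open>For the connection p x y the curvature endomorphism is multiplication by the conjugate
  derivative of p times cnj u v - cnj v u. Curvature -1 then reads: the Laplacian of ln H is 2
  H.\<close>

lemma hyperbolic_liouville:
  assumes U: "open U" and h: "is_hermitian_metric U h" and K: "has_gaussian_curvature U h (\<lambda>_. - 1)" and z: "z \<in> U"
  shows "dzb (log_dz (\<lambda>z. h z 1 1)) z = of_real (h z 1 1) / 2"
proof -
  obtain \<Gamma> where lc: "is_levi_civita U h \<Gamma>" and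
    curv: "\<And>u v. h z (curvature \<Gamma> (\<lambda>_. u) (\<lambda>_. v) (\<lambda>_. v) z) u = - (h z u u * h z v v - (h z u v)\<^sup>2)"
    using K z unfolding has_gaussian_curvature_def by fastforce
  define H where "H z = h z 1 1" for z
  define p where "p = log_dz H"
  have hH: "h z u v = H z * (u \<bullet> v)" for u v
    using hermitian_metric_conf(1)[OF h z] by (metis H_def conf_def)
  have pos: "H w > 0" if "w \<in> U" for w using hermitian_metric_conf(2)[OF h that] by (simp add: H_def)
  have \<Gamma>: "\<Gamma> w x y = p w * (x * y)" if "w \<in> U" for w x y
    using levi_civita_conf[OF U h lc that] by (simp add: p_def H_def[abs_def])
  have "smooth_on U H" using hermitian_metric_smooth[OF h] by (simp add: H_def[abs_def])
  then have "smooth_on U p" unfolding p_def using pos U by (intro smooth_log_dz) force+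
  then have wp: "wirt p z (dz p z) (dzb p z)" using z smooth_on_wirt by blast
  have cc: "cov \<Gamma> (\<lambda>_. u) (\<lambda>_. v) w = p w * (u * v)" if "w \<in> U" for u v w
    using \<Gamma>[OF that] by (simp add: cov_def dir_deriv_def)
  have d: "dir_deriv (cov \<Gamma> (\<lambda>_. u) (\<lambda>_. v)) (\<lambda>_. \<xi>) z = (dz p z * \<xi> + dzb p z * cnj \<xi>) * (u * v)" for u v \<xi>
  proof -
    have "wirt (cov \<Gamma> (\<lambda>_. u) (\<lambda>_. v)) z ((u * v) * dz p z) ((u * v) * dzb p z)"
      by (rule wirt_cong_open[OF wirt_cmult[OF wp, of "u * v"] U z]) (simp add: cc)
    then show ?thesis by (simp add: dir_deriv_wirt algebra_simps)
  qed
  have R: "curvature \<Gamma> (\<lambda>_. u) (\<lambda>_. v) (\<lambda>_. v) z = dzb p z * (cnj u * v - cnj v * u) * v" for u v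
    unfolding curvature_def cov_def[of \<Gamma> _ "cov \<Gamma> _ _"] cov_def[of \<Gamma> "lie_bracket _ _"] d cc[OF z] \<Gamma>[OF z]
    by (simp add: lie_bracket_def dir_deriv_def algebra_simps)
  have e: "Re (dzb p z * (v - cnj v) * v) = - (H z * (Im v)\<^sup>2)" for v
  proof -
    have "H z * Re (dzb p z * (v - cnj v) * v) = H z * (- (H z * (Im v)\<^sup>2))"
      using curv[of 1 v] unfolding R hH by (simp add: inner_complex_def power2_eq_square algebra_simps)
    moreover have "H z \<noteq> 0" using pos[OF z] by simp
    ultimately show ?thesis by (simp only: mult_cancel_left) simp
  qed
  \<comment> \<open>The vector \<open>v = \<i>\<close> isolates the real part, and
    \<open>v = 1 + \<i>\<close> then gives the imaginary part.\<close>
  have "Re (dzb p z) = H z / 2" using e[of \<i>] by simp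
  moreover have "Im (dzb p z) = 0" using e[of "1 + \<i>"] e[of \<i>] by simp
  ultimately show ?thesis by (simp add: complex_eq_iff p_def H_def[abs_def])
qed

section \<open>The special Kaehler structure built from a conformal factor and a cubic form\<close>

text \<open>Curvature enters only as the Liouville equation for \<open>H\<close>, so everything in
  this locale is calculus with the two Wirtinger derivatives.\<close>

locale sk_data =
  fixes U :: "complex set" and H :: "complex \<Rightarrow> real" and \<Xi> :: "complex \<Rightarrow> complex"
  assumes U: "open U" and smooth_H: "smooth_on U H" and H_pos: "\<And>z. z \<in> U \<Longrightarrow> H z > 0"
    and \<Xi>_hol: "\<Xi> holomorphic_on U" and \<Xi>_nz: "\<And>z. z \<in> U \<Longrightarrow> \<Xi> z \<noteq> 0"
    and liouville: "\<And>z. z \<in> U \<Longrightarrow> dzb (log_dz H) z = of_real (H z) / 2"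
begin

abbreviation "g \<equiv> sk_factor H \<Xi>"
abbreviation "P \<equiv> sk_lin H \<Xi>"
abbreviation "Q \<equiv> sk_anti H \<Xi>"
abbreviation "\<Gamma> \<equiv> sk_connection H \<Xi>"
abbreviation "a z \<equiv> deriv \<Xi> z / \<Xi> z"

lemma smooth_g: "smooth_on U g"
  by (rule smooth_sk_factor[OF U smooth_H H_pos \<Xi>_hol \<Xi>_nz])

lemma g_pos: "z \<in> U \<Longrightarrow> g z > 0"
  using H_pos \<Xi>_nz by (simp add: sk_factor_def)

text \<open>The defining relation without square root and modulus, in a form that the product rule
  can differentiate.\<close>

lemma g_sq: "z \<in> U \<Longrightarrow> of_real (g z) * of_real (g z) * complex_of_real (H z) = 16 * (\<Xi> z * cnj (\<Xi> z))"
proof -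
  assume z: "z \<in> U"
  have "g z * g z * H z = 16 * (norm (\<Xi> z))\<^sup>2"
    using H_pos[OF z] by (simp add: sk_factor_def power2_eq_square field_simps)
  then have "complex_of_real (g z * g z * H z) = complex_of_real (16 * (norm (\<Xi> z))\<^sup>2)" by simp
  then show ?thesis unfolding complex_norm_square of_real_mult by simp
qed

lemma smooth_P: "smooth_on U P"
  unfolding sk_lin_def using g_pos by (intro smooth_log_dz U smooth_g) force

lemma smooth_Q: "smooth_on U Q"
  unfolding sk_anti_def[abs_def] divide_inverse
  by (intro smooth_on_mult smooth_on_inverse smooth_on_const smooth_of_real smooth_cnj smooth_on_holomorphic U smooth_g \<Xi>_hol)
     (use g_pos in force)

lemma wirt_g: "z \<in> U \<Longrightarrow> wirt (\<lambda>x. of_real (g x)) z (P z * g z) (cnj (P z) * g z)"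
  unfolding sk_lin_def using wirt_log_dz smooth_on_differentiable[OF smooth_g] g_pos by force

lemma \<Xi>_deriv: "z \<in> U \<Longrightarrow> (\<Xi> has_field_derivative deriv \<Xi> z) (at z)"
  using \<Xi>_hol U by (rule holomorphic_derivI)

text \<open>The logarithmic z-derivative of g^2 H = 16 \<Xi> cnj \<Xi>; the antiholomorphic factor
  contributes nothing.\<close>

lemma P_eq: assumes z: "z \<in> U" shows "P z = (a z - log_dz H z) / 2"
proof -
  have wH: "wirt (\<lambda>x. of_real (H x)) z (log_dz H z * H z) (cnj (log_dz H z) * H z)"
    using wirt_log_dz smooth_on_differentiable[OF smooth_H z] H_pos[OF z] by force
  have 1: "wirt (\<lambda>x. 16 * (\<Xi> x * cnj (\<Xi> x))) z
    ((P z * g z * g z + g z * (P z * g z)) * H z + of_real (g z) * of_real (g z) * (log_dz H z * H z))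
    ((cnj (P z) * g z * g z + g z * (cnj (P z) * g z)) * H z + of_real (g z) * of_real (g z) * (cnj (log_dz H z) * H z))"
    by (rule wirt_cong_open[OF wirt_mult[OF wirt_mult[OF wirt_g[OF z] wirt_g[OF z]] wH] U z]) (simp add: g_sq)
  have 2: "wirt (\<lambda>x. 16 * (\<Xi> x * cnj (\<Xi> x))) z (16 * (deriv \<Xi> z * cnj (\<Xi> z))) (16 * (\<Xi> z * cnj (deriv \<Xi> z)))"
    using wirt_cmult[OF wirt_mult[OF wirt_field[OF \<Xi>_deriv[OF z]] wirt_cnj[OF wirt_field[OF \<Xi>_deriv[OF z]]]], of 16] by simp
  have "(2 * P z + log_dz H z) * (of_real (g z) * of_real (g z) * of_real (H z)) = 16 * (deriv \<Xi> z * cnj (\<Xi> z))"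
    using wirt_unique[OF 1 2] by (simp add: algebra_simps)
  then have "16 * cnj (\<Xi> z) * ((2 * P z + log_dz H z) * \<Xi> z) = 16 * cnj (\<Xi> z) * deriv \<Xi> z"
    unfolding g_sq[OF z] by (simp only: mult_ac)
  moreover have "16 * cnj (\<Xi> z) \<noteq> 0" using \<Xi>_nz[OF z] by simp
  ultimately have "(2 * P z + log_dz H z) * \<Xi> z = deriv \<Xi> z"
    by (simp only: mult_cancel_left) simp
  then show ?thesis using \<Xi>_nz[OF z] by (simp add: field_simps)
qed

lemma Q_norm: assumes z: "z \<in> U" shows "Q z * cnj (Q z) = of_real (H z) / 4"
proof -
  have "complex_of_real (g z) \<noteq> 0" using g_pos[OF z] by simp
  then show ?thesis using g_sq[OF z] by (simp add: sk_anti_def field_simps)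
qed

text \<open>First structure equation. In \<open>P_eq\<close> the term \<open>a\<close> is
  holomorphic, so the Liouville equation gives conjugate derivative - H / 4, which is -
  |Q|^2.\<close>

lemma wirt_P: assumes z: "z \<in> U" shows "wirt P z (dz P z) (- (Q z * cnj (Q z)))"
proof -
  have "smooth_on U (log_dz H)" using H_pos by (intro smooth_log_dz U smooth_H) force
  then have p: "wirt (log_dz H) z (dz (log_dz H) z) (of_real (H z) / 2)"
    using smooth_on_wirt[OF _ z] liouville[OF z] by metis
  have "a holomorphic_on U" using \<Xi>_hol \<Xi>_nz U by (intro holomorphic_intros) auto
  then have "wirt a z (deriv a z) 0" using wirt_field holomorphic_derivI[OF _ U z] by blast
  from wirt_cmult[OF wirt_diff[OF this p], of "1/2"]
  have "wirt (\<lambda>x. 1/2 * (a x - log_dz H x)) z (1/2 * (deriv a z - dz (log_dz H) z)) (- (Q z * cnj (Q z)))"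
    by (simp add: Q_norm[OF z])
  from wirt_cong_open[OF this U z, of P]
  have "wirt P z (1/2 * (deriv a z - dz (log_dz H) z)) (- (Q z * cnj (Q z)))"
    by (simp add: P_eq)
  then show ?thesis using wirt_dz by metis
qed

text \<open>Second structure equation: in Q = - 2 \<i> cnj \<Xi> / g the factor 1 / g contributes -
  P and - cnj P to the logarithmic derivatives, while cnj \<Xi> contributes only cnj a to the
  conjugate one.\<close>

lemma wirt_Q: assumes z: "z \<in> U" shows "wirt Q z (- (P z * Q z)) (Q z * cnj (a z - P z))"
proof -
  have gz: "complex_of_real (g z) \<noteq> 0" using g_pos[OF z] by simp
  have "wirt (\<lambda>x. (- 2 * \<i>) * (cnj (\<Xi> x) * inverse (of_real (g x)))) z
     ((- 2 * \<i>) * (cnj (\<Xi> z) * (- (P z * g z) / (of_real (g z))\<^sup>2)))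
     ((- 2 * \<i>) * (cnj (deriv \<Xi> z) * inverse (of_real (g z)) + cnj (\<Xi> z) * (- (cnj (P z) * g z) / (of_real (g z))\<^sup>2)))"
    using wirt_cmult[OF wirt_mult[OF wirt_cnj[OF wirt_field[OF \<Xi>_deriv[OF z]]] wirt_inverse[OF wirt_g[OF z] gz]], of "- 2 * \<i>"]
    by simp
  also have "(- 2 * \<i>) * (cnj (\<Xi> z) * (- (P z * g z) / (of_real (g z))\<^sup>2)) = - (P z * Q z)"
    using gz by (simp add: sk_anti_def field_simps power2_eq_square)
  also have "(- 2 * \<i>) * (cnj (deriv \<Xi> z) * inverse (of_real (g z)) + cnj (\<Xi> z) * (- (cnj (P z) * g z) / (of_real (g z))\<^sup>2))
     = Q z * cnj (a z - P z)"
    using gz \<Xi>_nz[OF z] by (simp add: sk_anti_def field_simps power2_eq_square)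
  also have "(\<lambda>x. (- 2 * \<i>) * (cnj (\<Xi> x) * inverse (of_real (g x)))) = Q"
    by (simp add: sk_anti_def fun_eq_iff divide_inverse)
  finally show ?thesis .
qed

lemma is_connection_\<Gamma>: "is_connection U \<Gamma>"
  unfolding is_connection_def
proof (intro conjI allI ballI)
  show "smooth_on U (\<lambda>z. \<Gamma> z u v)" for u v
    unfolding sk_connection_def by (intro smooth_on_add smooth_on_mult smooth_on_const smooth_P smooth_Q U)
  show "bilinear (\<Gamma> z)" for z
    by (auto simp: bilinear_def linear_iff sk_connection_def algebra_simps scaleR_conv_of_real)
qed

lemma cov_\<Gamma>:
  assumes "wirt Y w ya yb"
  shows "cov \<Gamma> X Y w = ya * X w + yb * cnj (X w) + P w * (X w * Y w) + Q w * cnj (X w * Y w)"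
  by (simp add: cov_def dir_deriv_wirt[OF assms] sk_connection_def)

lemma torsion_free: "torsion_free_on U \<Gamma>"
  unfolding torsion_free_on_def
proof (intro allI impI ballI)
  fix X Y :: vfield and z assume "smooth_on U X \<and> smooth_on U Y" "z \<in> U"
  then show "cov \<Gamma> X Y z - cov \<Gamma> Y X z = lie_bracket X Y z"
    by (simp add: cov_def sk_connection_def lie_bracket_def mult.commute)
qed

text \<open>Only the antilinear part of the connection fails to commute with \<i>, so the covariant
  derivative of the complex structure is - 2 \<i> Q cnj (X Y), symmetric in the two fields.\<close>

lemma cov_I_symmetric:
  fixes X Y :: vfield
  assumes "smooth_on U X" "smooth_on U Y" "z \<in> U"
  shows "cov_I \<Gamma> X Y z = cov_I \<Gamma> Y X z"
proof -
  have *: "cov_I \<Gamma> X Y z = - 2 * \<i> * Q z * cnj (X z * Y z)" if "smooth_on U Y" for X Y :: vfield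
    unfolding cov_I_def cov_\<Gamma>[OF smooth_on_wirt[OF that assms(3)]]
      cov_\<Gamma>[OF wirt_cmult[OF smooth_on_wirt[OF that assms(3)]]]
    by (simp add: algebra_simps)
  show ?thesis using *[OF assms(1)] *[OF assms(2)] by (simp add: mult_ac)
qed

lemma wirt_cov:
  assumes s: "smooth_on U B" "smooth_on U V" and z: "z \<in> U"
  shows "wirt (cov \<Gamma> B V) z
      (dz (dz V) z * B z + dz V z * dz B z + (dz (dzb V) z * cnj (B z) + dzb V z * cnj (dzb B z)) +
       (dz P z * (B z * V z) + P z * (dz B z * V z + B z * dz V z)) +
       (- (P z * Q z) * cnj (B z * V z) + Q z * cnj (dzb B z * V z + B z * dzb V z)))
      (dzb (dz V) z * B z + dz V z * dzb B z + (dzb (dzb V) z * cnj (B z) + dzb V z * cnj (dz B z)) +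
       (- (Q z * cnj (Q z)) * (B z * V z) + P z * (dzb B z * V z + B z * dzb V z)) +
       (Q z * cnj (a z - P z) * cnj (B z * V z) + Q z * cnj (dz B z * V z + B z * dz V z)))"
proof -
  note w = smooth_on_wirt[OF _ z]
  note wB = w[OF s(1)] and wV = w[OF s(2)] and wVz = w[OF smooth_dz[OF U s(2)]] and wVb = w[OF smooth_dzb[OF U s(2)]]
  show ?thesis
    by (rule wirt_cong_open[OF wirt_add[OF wirt_add[OF wirt_add[OF
        wirt_mult[OF wVz wB] wirt_mult[OF wVb wirt_cnj[OF wB]]] wirt_mult[OF wirt_P[OF z] wirt_mult[OF wB wV]]]
        wirt_mult[OF wirt_Q[OF z] wirt_cnj[OF wirt_mult[OF wB wV]]]] U z])
       (simp add: cov_\<Gamma>[OF smooth_on_wirt[OF s(2)]])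
qed

text \<open>The curvature part linear in \<open>V\<close> has the factor (conjugate derivative of P)
  + |Q|^2, the antilinear part has the factor (z-derivative of Q) + P Q, and both vanish by the
  structure equations. The other terms are symmetric in \<open>X\<close> and \<open>Y\<close> or
  cancel against the Lie bracket.\<close>

lemma flat: "flat_on U \<Gamma>"
  unfolding flat_on_def
proof (intro allI impI ballI, elim conjE)
  fix X Y V :: vfield and z assume s: "smooth_on U X" "smooth_on U Y" "smooth_on U V" and z: "z \<in> U"
  note w = smooth_on_wirt[OF _ z]
  have lb: "lie_bracket X Y z = (dz Y z * X z + dzb Y z * cnj (X z)) - (dz X z * Y z + dzb X z * cnj (Y z))"
    by (simp add: lie_bracket_def dir_deriv_wirt[OF w] s)
  show "curvature \<Gamma> X Y V z = 0"
    unfolding curvature_def cov_\<Gamma>[OF wirt_cov[OF s(2,3) z]] cov_\<Gamma>[OF wirt_cov[OF s(1,3) z]] cov_\<Gamma>[OF w[OF s(3)]] lb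
      dzb_dz_commute[OF U z s(3)]
    by (simp add: algebra_simps)
qed

text \<open>A connection acts on a 2-form through its real trace. The antilinear part is traceless,
  and the linear part contributes 2 Re (P X), the logarithmic derivative of \<open>g\<close> along
  \<open>X\<close>.\<close>

lemma parallel_symplectic: "parallel_bilinear_on U \<Gamma> (symplectic_form (conf g))"
  unfolding parallel_bilinear_on_def
proof (intro allI impI ballI, elim conjE)
  fix X Y V :: vfield and z assume s: "smooth_on U X" "smooth_on U Y" "smooth_on U V" and z: "z \<in> U"
  have sf: "symplectic_form (conf g) w u v = Re (of_real (g w) * (\<i> * (u * cnj v)))" for w u v
    by (simp add: symplectic_form_def conf_def inner_complex_def algebra_simps)
  note wY = smooth_on_wirt[OF s(2) z] and wV = smooth_on_wirt[OF s(3) z]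
  show "dir_deriv (\<lambda>w. symplectic_form (conf g) w (Y w) (V w)) X z =
     symplectic_form (conf g) z (cov \<Gamma> X Y z) (V z) + symplectic_form (conf g) z (Y z) (cov \<Gamma> X V z)"
    unfolding sf dir_deriv_Re_wirt[OF wirt_mult[OF wirt_g[OF z] wirt_cmult[OF wirt_mult[OF wY wirt_cnj[OF wV]]]]]
      cov_\<Gamma>[OF wY] cov_\<Gamma>[OF wV]
    by (simp add: algebra_simps)
qed

lemma is_special_kaehler_\<Gamma>: "is_special_kaehler U (conf g) \<Gamma>"
  unfolding is_special_kaehler_def
  using is_hermitian_conf[OF U smooth_g g_pos] is_connection_\<Gamma> flat torsion_free parallel_symplectic cov_I_symmetric
  by blast

end

section \<open>Parallel 1-forms and the existence of conjugate coordinates\<close>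

context sk_data begin

text \<open>The coefficient of f after elimination: cnj Q has z-derivative (a - P) cnj Q, so f'' =
  (\<open>dz P\<close>) f + P f' + (a - P) (f' - P f).\<close>

definition T :: "complex \<Rightarrow> complex" where "T z = dz P z + P z * P z - P z * a z"

lemma a_hol: "a holomorphic_on U"
  using \<Xi>_hol \<Xi>_nz U by (intro holomorphic_intros) auto

lemma wirt_a: "z \<in> U \<Longrightarrow> wirt a z (deriv a z) 0"
  using wirt_field holomorphic_derivI[OF a_hol U] by blast

lemma dzb_dz_P: assumes z: "z \<in> U" shows "dzb (dz P) z = Q z * cnj (Q z) * (2 * P z - a z)"
proof -
  have "wirt (\<lambda>x. - (Q x * cnj (Q x))) z (Q z * cnj (Q z) * (2 * P z - a z))
     (- (Q z * cnj (a z - P z) * cnj (Q z) + Q z * cnj (- (P z * Q z))))"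
    using wirt_minus[OF wirt_mult[OF wirt_Q[OF z] wirt_cnj[OF wirt_Q[OF z]]]] by (simp add: algebra_simps)
  from wirt_dz[OF wirt_cong_open[OF this U z, of "dzb P"]]
  show ?thesis unfolding dzb_dz_commute[OF U z smooth_P] using wirt_dzb[OF wirt_P] by metis
qed

text \<open>The conjugate derivative is |Q|^2 times (2 P - a) - 2 P + a, which is 0.\<close>

lemma T_hol: "T holomorphic_on U"
proof -
  have "\<exists>d. (T has_field_derivative d) (at z)" if z: "z \<in> U" for z
  proof -
    have "wirt (dz P) z (dz (dz P) z) (Q z * cnj (Q z) * (2 * P z - a z))"
      using smooth_on_wirt[OF smooth_dz[OF U smooth_P] z] dzb_dz_P[OF z] by simp
    from wirt_diff[OF wirt_add[OF this wirt_mult[OF wirt_P[OF z] wirt_P[OF z]]] wirt_mult[OF wirt_P[OF z] wirt_a[OF z]]]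
    have "wirt T z (dz (dz P) z + (dz P z * P z + P z * dz P z) - (dz P z * a z + P z * deriv a z)) 0"
      by (simp add: T_def[abs_def] algebra_simps)
    then show ?thesis unfolding wirt_field_iff by blast
  qed
  then show ?thesis using U by (simp add: holomorphic_on_open)
qed

text \<open>Differentiating \<open>f' = P f + cnj (Q f)\<close> and eliminating \<open>cnj f\<close> gives the linear equation
  \<open>f'' = a f' + T f\<close> with holomorphic coefficients. Conversely the defect
  \<open>E = f' - P f - cnj (Q f)\<close> of a solution satisfies a homogeneous linear system.\<close>

lemma exists_parallel:
  assumes z0: "z0 \<in> U"
  obtains r f where "r > 0" "ball z0 r \<subseteq> U" "f z0 = c0"
    "\<And>z. z \<in> ball z0 r \<Longrightarrow> (f has_field_derivative (P z * f z + cnj (Q z) * cnj (f z))) (at z)"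
proof -
  \<comment> \<open>The initial slope is the one for which the defect \<open>E\<close> vanishes at
    \<open>z0\<close>; only \<open>c0\<close>, two real parameters, remains free.\<close>
  obtain r f F where r: "r > 0" "ball z0 r \<subseteq> U" and f0: "f z0 = c0" "F z0 = P z0 * c0 + cnj (Q z0) * cnj c0"
    and f: "\<And>z. z \<in> ball z0 r \<Longrightarrow> (f has_field_derivative F z) (at z)"
    and F: "\<And>z. z \<in> ball z0 r \<Longrightarrow> (F has_field_derivative a z * F z + T z * f z) (at z)"
    using holomorphic_linear_ode[OF U z0 a_hol T_hol, of c0 "P z0 * c0 + cnj (Q z0) * cnj c0"] by metis
  define E where "E z = F z - P z * f z - cnj (Q z) * cnj (f z)" for z
  have "wirt E z ((a z - P z) * E z) (- cnj (Q z) * cnj (E z))" if z: "z \<in> ball z0 r" for z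
  proof -
    have zU: "z \<in> U" using z r by auto
    note wf = wirt_field[OF f[OF z]] and wF = wirt_field[OF F[OF z]]
    show ?thesis
      using wirt_diff[OF wirt_diff[OF wF wirt_mult[OF wirt_P[OF zU] wf]]
          wirt_mult[OF wirt_cnj[OF wirt_Q[OF zU]] wirt_cnj[OF wf]]]
      by (simp add: E_def[abs_def] T_def algebra_simps)
  qed
  moreover have "continuous_on (ball z0 r) (\<lambda>z. a z - P z)" "continuous_on (ball z0 r) (\<lambda>z. - cnj (Q z))"
    by (rule continuous_on_subset[OF _ r(2)],
        intro continuous_on_diff continuous_on_minus continuous_on_cnj holomorphic_on_imp_continuous_on[OF a_hol]
          smooth_on_continuous[OF smooth_P] smooth_on_continuous[OF smooth_Q])+
  ultimately obtain r' where r': "r' > 0" "ball z0 r' \<subseteq> ball z0 r" "\<And>z. z \<in> ball z0 r' \<Longrightarrow> E z = 0"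
    using wirt_zero_unique[of "ball z0 r" z0 E "\<lambda>z. a z - P z" "\<lambda>z. - cnj (Q z)"] r(1) f0
    by (auto simp: E_def)
  show ?thesis
  proof (rule that[of r' f])
    show "r' > 0" "f z0 = c0" by fact+
    show "ball z0 r' \<subseteq> U" using r' r by blast
    fix z assume z: "z \<in> ball z0 r'"
    have "F z = P z * f z + cnj (Q z) * cnj (f z)" using r'(3)[OF z] by (simp add: E_def algebra_simps)
    then show "(f has_field_derivative (P z * f z + cnj (Q z) * cnj (f z))) (at z)"
      using f[OF subsetD[OF r'(2) z]] by (simp only:)
  qed
qed

text \<open>The initial values 1 and \<i> g(z0) of dZ/dz and dW/dz give Im (cnj Z' W') = g at
  \<open>z0\<close>. Both sides have the same logarithmic derivative, so their difference solves a
  homogeneous system and the normalization persists nearby.\<close>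

lemma exists_conjugate_coordinates:
  assumes z0: "z0 \<in> U"
  obtains V Z W where "open V" "z0 \<in> V" "V \<subseteq> U" "conjugate_coordinates V (conf g) \<Gamma> Z W"
proof -
  obtain r1 f1 where r1: "r1 > 0" "ball z0 r1 \<subseteq> U" "f1 z0 = 1"
    and f1: "\<And>z. z \<in> ball z0 r1 \<Longrightarrow> (f1 has_field_derivative (P z * f1 z + cnj (Q z) * cnj (f1 z))) (at z)"
    using exists_parallel[OF z0, of 1] by metis
  obtain r2 f2 where r2: "r2 > 0" "ball z0 r2 \<subseteq> U" "f2 z0 = \<i> * g z0"
    and f2: "\<And>z. z \<in> ball z0 r2 \<Longrightarrow> (f2 has_field_derivative (P z * f2 z + cnj (Q z) * cnj (f2 z))) (at z)"
    using exists_parallel[OF z0, of "\<i> * g z0"] by metis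
  define B where "B = ball z0 (min r1 r2)"
  have B: "B \<subseteq> U" "z0 \<in> B" "open B" "B \<subseteq> ball z0 r1" "B \<subseteq> ball z0 r2" using r1 r2 by (auto simp: B_def)
  define E where "E z = cnj (f1 z) * f2 z - f1 z * cnj (f2 z) - 2 * \<i> * of_real (g z)" for z
  \<comment> \<open>\<open>E\<close> is purely imaginary, so its conjugate derivative cnj P E can be
    rewritten with cnj E, the shape that \<open>wirt_zero_unique\<close> expects.\<close>
  have cE: "cnj (E z) = - E z" for z by (simp add: E_def)
  have "wirt E z (P z * E z) (- cnj (P z) * cnj (E z))" if z: "z \<in> B" for z
  proof -
    have zU: "z \<in> U" and z1: "z \<in> ball z0 r1" and z2: "z \<in> ball z0 r2" using z B by auto
    note w1 = wirt_field[OF f1[OF z1]] and w2 = wirt_field[OF f2[OF z2]]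
    show ?thesis unfolding cE
      using wirt_diff[OF wirt_diff[OF wirt_mult[OF wirt_cnj[OF w1] w2] wirt_mult[OF w1 wirt_cnj[OF w2]]]
        wirt_cmult[OF wirt_g[OF zU], of "2 * \<i>"]]
      by (simp add: E_def[abs_def] algebra_simps)
  qed
  moreover have "continuous_on B P" "continuous_on B (\<lambda>z. - cnj (P z))"
    by (rule continuous_on_subset[OF _ B(1)],
        intro continuous_on_minus continuous_on_cnj smooth_on_continuous[OF smooth_P])+
  ultimately obtain r where r: "r > 0" "ball z0 r \<subseteq> B" "\<And>z. z \<in> ball z0 r \<Longrightarrow> E z = 0"
    using wirt_zero_unique[OF B(3,2), of E P "\<lambda>z. - cnj (P z)"] r1(3) r2(3)
    by (auto simp: E_def)
  define V where "V = ball z0 r"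
  have V: "open V" "convex V" "z0 \<in> V" "V \<subseteq> U" "V \<subseteq> ball z0 r1" "V \<subseteq> ball z0 r2" using r B by (auto simp: V_def)
  have "f1 holomorphic_on V" "f2 holomorphic_on V"
    unfolding holomorphic_on_open[OF V(1)] using f1[OF subsetD[OF V(5)]] f2[OF subsetD[OF V(6)]] by meson+
  then obtain Z W where "\<And>z. z \<in> V \<Longrightarrow> (Z has_field_derivative f1 z) (at z within V)"
     "\<And>z. z \<in> V \<Longrightarrow> (W has_field_derivative f2 z) (at z within V)"
    using holomorphic_convex_primitive'[OF V(2,1)] by metis
  then have ZW: "\<And>z. z \<in> V \<Longrightarrow> (Z has_field_derivative f1 z) (at z)"
     "\<And>z. z \<in> V \<Longrightarrow> (W has_field_derivative f2 z) (at z)"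
    using at_within_open[OF _ V(1)] by auto
  then have hol: "Z holomorphic_on V" "W holomorphic_on V"
    unfolding holomorphic_on_open[OF V(1)] by meson+
  have d: "deriv Z z = f1 z" "deriv W z = f2 z" if "z \<in> V" for z
    using ZW[OF that] by (auto intro: DERIV_imp_deriv)
  have dd: "deriv (deriv Z) z = P z * f1 z + cnj (Q z) * cnj (f1 z)"
    "deriv (deriv W) z = P z * f2 z + cnj (Q z) * cnj (f2 z)" if z: "z \<in> V" for z
  proof -
    have "eventually (\<lambda>z. z \<in> V) (nhds z)" using V(1) z by (rule eventually_nhds_in_open)
    then have "eventually (\<lambda>z. deriv Z z = f1 z) (nhds z)" "eventually (\<lambda>z. deriv W z = f2 z) (nhds z)"
      by (auto elim!: eventually_mono simp: d)
    then have "deriv (deriv Z) z = deriv f1 z" "deriv (deriv W) z = deriv f2 z"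
      by (auto intro!: deriv_cong_ev)
    then show "deriv (deriv Z) z = P z * f1 z + cnj (Q z) * cnj (f1 z)"
      "deriv (deriv W) z = P z * f2 z + cnj (Q z) * cnj (f2 z)"
      using DERIV_imp_deriv[OF f1[OF subsetD[OF V(5) z]]] DERIV_imp_deriv[OF f2[OF subsetD[OF V(6) z]]]
      by (simp_all only:)
  qed
  have R: "Re ((P z * f + cnj (Q z) * cnj f) * s) = Re (f * (P z * s + Q z * cnj s))" for f s z
    by (simp add: algebra_simps)
  have "parallel_form_on V \<Gamma> (re_d Z)"
    unfolding parallel_form_re_d_iff[OF V(1) hol(1)]
  proof (intro ballI allI)
    fix z u v assume z: "z \<in> V"
    show "Re (deriv (deriv Z) z * (u * v)) = Re (deriv Z z * \<Gamma> z u v)"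
      unfolding dd[OF z] d[OF z] sk_connection_def by (rule R)
  qed
  moreover have "parallel_form_on V \<Gamma> (re_d W)"
    unfolding parallel_form_re_d_iff[OF V(1) hol(2)]
  proof (intro ballI allI)
    fix z u v assume z: "z \<in> V"
    show "Re (deriv (deriv W) z * (u * v)) = Re (deriv W z * \<Gamma> z u v)"
      unfolding dd[OF z] d[OF z] sk_connection_def by (rule R)
  qed
  moreover have "g z = Im (cnj (deriv Z z) * deriv W z)" if z: "z \<in> V" for z
  proof -
    have "E z = 0" using r(3) z by (simp add: V_def)
    then have "complex_of_real (2 * g z) = complex_of_real (2 * Im (cnj (f1 z) * f2 z))"
      by (simp add: E_def complex_eq_iff mult_ac)
    then have "2 * g z = 2 * Im (cnj (f1 z) * f2 z)" by (simp only: of_real_eq_iff)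
    then show ?thesis by (simp add: d[OF z])
  qed
  ultimately have "conjugate_coordinates V (conf g) \<Gamma> Z W"
    unfolding conjugate_coordinates_def symplectic_conf_iff using hol by blast
  then show ?thesis using that V by blast
qed

end

section \<open>The structure is determined by its conjugate coordinates\<close>

lemma conjugate_coordinates_pair:
  assumes V: "open V" and cc: "conjugate_coordinates V G \<Gamma> Z W"
    and g: "\<And>z. z \<in> V \<Longrightarrow> G z = conf g z" "\<And>z. z \<in> V \<Longrightarrow> g z > 0"
  shows "conjugate_pair V Z W g"
proof
  show "g x = Im (cnj (deriv Z x) * deriv W x)" if "x \<in> V" for x
  proof -
    have "\<forall>u v. symplectic_form G x u v = - (re_d Z x u * re_d W x v - re_d Z x v * re_d W x u)"
      using cc that unfolding conjugate_coordinates_def by blast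
    then have "\<forall>u v. symplectic_form (conf g) x u v = - (re_d Z x u * re_d W x v - re_d Z x v * re_d W x u)"
      unfolding symplectic_form_def g(1)[OF that] .
    then show ?thesis by (rule symplectic_conf_iff[of g x Z W, THEN iffD1])
  qed
qed (use assms in \<open>auto simp: conjugate_coordinates_def\<close>)

text \<open>Parallelism of Re dZ and Re dW prescribes the pairings of the connection form with a
  coframe, and \<open>second_derivs\<close> identifies them with those of the expression on the
  right.\<close>

lemma conjugate_coordinates_connection:
  assumes V: "open V" and cc: "conjugate_coordinates V G \<Gamma> Z W"
    and pair: "conjugate_pair V Z W g" and z: "z \<in> V"
  shows "\<Gamma> z u v = log_dz g z * (u * v) + (- 2 * \<i> * cnj (conjugate_pair.X Z W z) / g z) * cnj (u * v)"
proof -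
  interpret conjugate_pair V Z W g by (rule pair)
  define q where "q = - 2 * \<i> * cnj (X z) / g z"
  define \<Gamma>' where "\<Gamma>' = log_dz g z * (u * v) + q * cnj (u * v)"
  have par: "Re (deriv (deriv Z) z * (u * v)) = Re (deriv Z z * \<Gamma> z u v)"
     "Re (deriv (deriv W) z * (u * v)) = Re (deriv W z * \<Gamma> z u v)"
    using cc z parallel_form_re_d_iff[OF V] unfolding conjugate_coordinates_def by blast+
  have R: "Re ((p * f + cnj q * cnj f) * s) = Re (f * (p * s + q * cnj s))" for p f s
    by (simp add: algebra_simps)
  have "Re (deriv Z z * (\<Gamma> z u v - \<Gamma>')) = 0" "Re (deriv W z * (\<Gamma> z u v - \<Gamma>')) = 0"
    using par unfolding second_derivs[OF z] q_def[symmetric] R \<Gamma>'_def by (simp_all only: right_diff_distrib minus_complex.simps)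
  from independent[OF z this] show ?thesis by (simp add: \<Gamma>'_def q_def)
qed

text \<open>The connection is known twice, by construction and from the coordinates, with the same
  linear part. Comparing the antilinear parts at u = v = 1 gives \<open>X = \<Xi>\<close>; the
  metric then follows from \<open>period_metric_eq\<close>.\<close>

lemma (in sk_data) associated:
  assumes VU: "open V" "V \<subseteq> U" "z \<in> V" and cc: "conjugate_coordinates V (conf g) \<Gamma> Z W"
  shows "conf H z = pullback_metric (period_map Z W) upper_half_plane_metric z" "\<Xi> z = period_cubic Z W z"
proof -
  have pair: "conjugate_pair V Z W g"
    by (rule conjugate_coordinates_pair[OF VU(1) cc]) (use VU g_pos in auto)
  interpret conjugate_pair V Z W g by (rule pair)
  have zU: "z \<in> U" using VU by auto
  have gz: "complex_of_real (g z) \<noteq> 0" using g_pos[OF zU] by simp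
  define q where "q = - 2 * \<i> * cnj (X z) / g z"
  have "P z * (u * v) + Q z * cnj (u * v) = log_dz g z * (u * v) + q * cnj (u * v)" for u v
    using conjugate_coordinates_connection[OF VU(1) cc pair VU(3), of u v] by (simp add: sk_connection_def q_def)
  from this[of 1 1] have "Q z = q" by (simp add: sk_lin_def)
  then have X: "X z = \<Xi> z" using gz by (simp add: sk_anti_def q_def complex_eq_iff)
  then show "\<Xi> z = period_cubic Z W z" using period_cubic_eq[OF VU(3)] by simp
  have "16 * (norm (\<Xi> z))\<^sup>2 / (g z)\<^sup>2 = H z"
    using \<Xi>_nz[OF zU] H_pos[OF zU] by (simp add: sk_factor_def power_divide power_mult_distrib)
  then show "conf H z = pullback_metric (period_map Z W) upper_half_plane_metric z"
    unfolding period_metric_eq[OF VU(3)] X by (simp add: conf_def X fun_eq_iff)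
qed

text \<open>The cubic form fixes \<open>X\<close>, the hyperbolic metric then fixes the conformal
  factor through H = 16 |X|^2 / g^2, and both together fix the connection.\<close>

lemma (in sk_data) determined:
  assumes sk: "is_special_kaehler U G \<Gamma>'" and z: "z \<in> U"
    and VU: "open V" "z \<in> V" "V \<subseteq> U" and cc: "conjugate_coordinates V G \<Gamma>' Z W"
    and ass: "\<And>w. w \<in> V \<Longrightarrow> conf H w = pullback_metric (period_map Z W) upper_half_plane_metric w"
      "\<And>w. w \<in> V \<Longrightarrow> \<Xi> w = period_cubic Z W w"
  shows "G z = conf g z" "\<Gamma>' z = \<Gamma> z"
proof -
  define g' where "g' z = G z 1 1" for z
  have her: "is_hermitian_metric U G" using sk by (simp add: is_special_kaehler_def)
  have G: "G w = conf g' w" "g' w > 0" if "w \<in> V" for w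
    using hermitian_metric_conf[OF her, of w] that VU by (auto simp: g'_def[abs_def])
  have pair: "conjugate_pair V Z W g'" by (rule conjugate_coordinates_pair[OF VU(1) cc G])
  interpret conjugate_pair V Z W g' by (rule pair)
  have X: "X w = \<Xi> w" if "w \<in> V" for w using ass(2)[OF that] period_cubic_eq[OF that] by simp
  have gg: "g' w = g w" if w: "w \<in> V" for w
  proof -
    have "conf H w 1 1 = conf (\<lambda>z. 16 * (norm (X z))\<^sup>2 / (g' z)\<^sup>2) w 1 1"
      using ass(1)[OF w] period_metric_eq[OF w] by simp
    then have "H w = (4 * norm (\<Xi> w) / g' w)\<^sup>2"
      by (simp add: conf_def X[OF w] power_divide power_mult_distrib)
    then have "sqrt (H w) = 4 * norm (\<Xi> w) / g' w" using G(2)[OF w] by simp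
    moreover have "norm (\<Xi> w) > 0" using \<Xi>_nz w VU by auto
    ultimately show ?thesis using G(2)[OF w] by (simp add: sk_factor_def)
  qed
  \<comment> \<open>A derivative at \<open>z\<close> is compared, so \<open>g' = g\<close> is needed
    on all of \<open>V\<close> and not only at \<open>z\<close>.\<close>
  have "log_dz g' z = P z"
    unfolding sk_lin_def log_dz_def dz_def gg[OF VU(2)]
    by (subst (1 2) frechet_derivative_cong_open[OF VU(1,2), where g="\<lambda>x. of_real (g x)"]) (simp_all add: gg)
  then have "\<Gamma>' z u v = \<Gamma> z u v" for u v
    using conjugate_coordinates_connection[OF VU(1) cc pair VU(2), of u v]
    by (simp add: sk_connection_def sk_anti_def X[OF VU(2)] gg[OF VU(2)])
  then show "\<Gamma>' z = \<Gamma> z" by blast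
  show "G z = conf g z" unfolding G(1)[OF VU(2)] by (simp add: conf_def fun_eq_iff gg[OF VU(2)])
qed

section \<open>Gradient estimates for the Poisson equation\<close>

text \<open>The function \<open>w\<close> has Wirtinger derivative \<open>p\<close> and Laplacian \<open>L\<close>.\<close>

definition lap_on :: "complex set \<Rightarrow> (complex \<Rightarrow> real) \<Rightarrow> (complex \<Rightarrow> complex) \<Rightarrow> (complex \<Rightarrow> real) \<Rightarrow> bool" where
  "lap_on U w p L \<longleftrightarrow>
     (\<forall>z\<in>U. wirt (\<lambda>x. of_real (w x)) z (p z) (cnj (p z)) \<and> (\<exists>q. wirt p z q (of_real (L z) / 4)))"

lemma lap_on_subset: "lap_on U w p L \<Longrightarrow> V \<subseteq> U \<Longrightarrow> lap_on V w p L"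
  by (auto simp: lap_on_def)

lemma lap_on_add:
  assumes "lap_on U w p L" "lap_on U w' p' L'"
  shows "lap_on U (\<lambda>z. w z + w' z) (\<lambda>z. p z + p' z) (\<lambda>z. L z + L' z)"
  unfolding lap_on_def
proof (intro ballI conjI)
  fix z assume z: "z \<in> U"
  then obtain q q' where "wirt p z q (of_real (L z) / 4)" "wirt p' z q' (of_real (L' z) / 4)"
    using assms unfolding lap_on_def by blast
  from wirt_add[OF this] show "\<exists>q. wirt (\<lambda>z. p z + p' z) z q (of_real (L z + L' z) / 4)"
    by (auto simp: add_divide_distrib)
  show "wirt (\<lambda>x. of_real (w x + w' x)) z (p z + p' z) (cnj (p z + p' z))"
    using assms z wirt_add[of "\<lambda>x. of_real (w x)" z _ _ "\<lambda>x. of_real (w' x)"] unfolding lap_on_def by simp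
qed

lemma lap_on_cmult:
  assumes "lap_on U w p L"
  shows "lap_on U (\<lambda>z. c * w z) (\<lambda>z. of_real c * p z) (\<lambda>z. c * L z)"
  unfolding lap_on_def
proof (intro ballI conjI)
  fix z assume z: "z \<in> U"
  then obtain q where "wirt p z q (of_real (L z) / 4)"
    using assms unfolding lap_on_def by blast
  from wirt_cmult[OF this, of "of_real c"] show "\<exists>q. wirt (\<lambda>z. of_real c * p z) z q (of_real (c * L z) / 4)"
    by auto
  show "wirt (\<lambda>x. of_real (c * w x)) z (of_real c * p z) (cnj (of_real c * p z))"
    using assms z wirt_cmult[of "\<lambda>x. of_real (w x)" z _ _ "of_real c"] unfolding lap_on_def by simp
qed

lemma lap_on_diff:
  assumes "lap_on U w p L" "lap_on U w' p' L'"
  shows "lap_on U (\<lambda>z. w z - w' z) (\<lambda>z. p z - p' z) (\<lambda>z. L z - L' z)"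
  using lap_on_add[OF assms(1) lap_on_cmult[OF assms(2), of "-1"]] by simp

lemma lap_on_const: "lap_on U (\<lambda>_. c) (\<lambda>_. 0) (\<lambda>_. 0)"
  using wirt_const by (auto simp: lap_on_def)

lemma lap_on_compose:
  assumes w: "lap_on U w p L" and V: "open V" "f holomorphic_on V" "f ` V \<subseteq> U"
  shows "lap_on V (\<lambda>z. w (f z)) (\<lambda>z. p (f z) * deriv f z) (\<lambda>z. L (f z) * (norm (deriv f z))\<^sup>2)"
  unfolding lap_on_def
proof (intro ballI conjI)
  fix z assume z: "z \<in> V"
  have f: "(f has_field_derivative deriv f z) (at z)" using V z by (auto intro: holomorphic_derivI)
  have f': "wirt (deriv f) z (deriv (deriv f) z) 0"
    using V z by (intro wirt_field holomorphic_derivI[OF holomorphic_deriv]) auto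
  have fz: "f z \<in> U" using V z by auto
  then obtain q where q: "wirt p (f z) q (of_real (L (f z)) / 4)" using w unfolding lap_on_def by blast
  have e: "of_real (L (f z)) / 4 * cnj (deriv f z) * deriv f z = of_real (L (f z) * (norm (deriv f z))\<^sup>2) / 4"
    by (simp add: complex_norm_square[unfolded of_real_power] mult_ac)
  show "\<exists>q. wirt (\<lambda>z. p (f z) * deriv f z) z q (of_real (L (f z) * (norm (deriv f z))\<^sup>2) / 4)"
    unfolding e[symmetric] using wirt_mult[OF wirt_compose_field[OF q f] f'] by auto
  show "wirt (\<lambda>x. of_real (w (f x))) z (p (f z) * deriv f z) (cnj (p (f z) * deriv f z))"
    using wirt_compose_field[of "\<lambda>x. of_real (w x)" f z _ _, OF _ f] w fz unfolding lap_on_def by simp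
qed

lemma wirt_compose_cnj:
  assumes "wirt f (cnj z) a b" shows "wirt (\<lambda>x. f (cnj x)) z b a"
proof -
  have "((\<lambda>x. f (cnj x)) has_derivative (\<lambda>x. a * cnj x + b * cnj (cnj x))) (at z)"
    by (rule has_derivative_compose[OF bounded_linear_imp_has_derivative[OF bounded_linear_cnj]
          assms[unfolded wirt_def]])
  then show ?thesis unfolding wirt_def by (simp add: add.commute)
qed

text \<open>Conjugation is antiholomorphic and so outside the scope of
  \<open>lap_on_compose\<close>; it provides the reflection that forms the odd part in the gradient
  estimate.\<close>

lemma lap_on_reflect:
  assumes "lap_on U w p L"
  shows "lap_on (cnj ` U) (\<lambda>z. w (cnj z)) (\<lambda>z. cnj (p (cnj z))) (\<lambda>z. L (cnj z))"
  unfolding lap_on_def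
proof (intro ballI conjI)
  fix z assume "z \<in> cnj ` U"
  then have z: "cnj z \<in> U" by auto
  then obtain q where q: "wirt p (cnj z) q (of_real (L (cnj z)) / 4)" using assms unfolding lap_on_def by blast
  show "\<exists>q. wirt (\<lambda>z. cnj (p (cnj z))) z q (of_real (L (cnj z)) / 4)"
    using wirt_cnj[OF wirt_compose_cnj[OF q]] by auto
  show "wirt (\<lambda>x. of_real (w (cnj x))) z (cnj (p (cnj z))) (cnj (cnj (p (cnj z))))"
    using wirt_compose_cnj[of "\<lambda>x. of_real (w x)" z] assms z unfolding lap_on_def by simp
qed

lemma lap_on_Re: "lap_on U Re (\<lambda>_. 1/2) (\<lambda>_. 0)"
proof -
  have "wirt (\<lambda>x. of_real (Re x)) z (1/2) (cnj (1/2))" for z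
    unfolding wirt_def
    by (rule has_derivative_eq_rhs[OF bounded_linear_imp_has_derivative[OF
          bounded_linear_compose[OF bounded_linear_of_real bounded_linear_Re]]])
       (simp add: fun_eq_iff complex_eq_iff)
  then show ?thesis unfolding lap_on_def using wirt_const by auto
qed

lemma lap_on_Im: "lap_on U Im (\<lambda>_. - \<i> / 2) (\<lambda>_. 0)"
proof -
  have "wirt (\<lambda>x. of_real (Im x)) z (- \<i> / 2) (cnj (- \<i> / 2))" for z
    unfolding wirt_def
    by (rule has_derivative_eq_rhs[OF bounded_linear_imp_has_derivative[OF
          bounded_linear_compose[OF bounded_linear_of_real bounded_linear_Im]]])
       (simp add: fun_eq_iff complex_eq_iff)
  then show ?thesis unfolding lap_on_def using wirt_const[of "- \<i> / 2"] by auto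
qed

text \<open>For affine \<open>w\<close> the Laplacian of w^2 is twice the squared gradient, and the
  gradient has length 2 |c|.\<close>

lemma lap_on_square:
  assumes "lap_on U w (\<lambda>_. c) (\<lambda>_. 0)"
  shows "lap_on U (\<lambda>z. (w z)\<^sup>2) (\<lambda>z. 2 * of_real (w z) * c) (\<lambda>_. 8 * (norm c)\<^sup>2)"
  unfolding lap_on_def
proof (intro ballI conjI)
  fix z assume z: "z \<in> U"
  then have w: "wirt (\<lambda>x. of_real (w x)) z c (cnj c)" using assms by (auto simp: lap_on_def)
  show "wirt (\<lambda>x. of_real ((w x)\<^sup>2)) z (2 * of_real (w z) * c) (cnj (2 * of_real (w z) * c))"
    using wirt_mult[OF w w] by (simp add: power2_eq_square algebra_simps)
  have "(2 * c) * cnj c = of_real (8 * (norm c)\<^sup>2) / 4"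
    by (simp add: complex_norm_square[unfolded of_real_power])
  then show "\<exists>q. wirt (\<lambda>z. 2 * of_real (w z) * c) z q (of_real (8 * (norm c)\<^sup>2) / 4)"
    using wirt_cmult[OF w, of "2 * c"] by (metis (no_types, lifting) ext mult.assoc mult.commute)
qed

lemma line_derivative:
  assumes "wirt f (z + of_real t * c) a b"
  shows "((\<lambda>t. Re (f (z + of_real t * c))) has_real_derivative Re (a * c + b * cnj c)) (at t)"
proof -
  have "((\<lambda>t. z + of_real t * c) has_derivative (\<lambda>h. of_real h * c)) (at t)"
    by (auto intro!: derivative_eq_intros)
  from has_derivative_compose[OF this assms[unfolded wirt_def]]
  have "((\<lambda>t. Re (f (z + of_real t * c))) has_derivative
     (\<lambda>h. Re (a * (of_real h * c) + b * cnj (of_real h * c)))) (at t)"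
    by (rule bounded_linear.has_derivative[OF bounded_linear_Re])
  then show ?thesis unfolding has_field_derivative_def
    by (rule has_derivative_eq_rhs) (simp add: fun_eq_iff algebra_simps)
qed

section \<open>Maximum principle and gradient estimate\<close>

text \<open>At the maximum the first derivative vanishes. If \<open>c\<close> were positive, the
  first derivative would be positive just to the right, and by the mean value theorem \<phi> would
  exceed its maximum.\<close>

lemma second_derivative_at_max:
  fixes \<phi> \<phi>' :: "real \<Rightarrow> real"
  assumes "r > 0" and d: "\<And>t. \<bar>t\<bar> < r \<Longrightarrow> (\<phi> has_real_derivative \<phi>' t) (at t)"
    and d2: "(\<phi>' has_real_derivative c) (at 0)" and max: "\<And>t. \<bar>t\<bar> < r \<Longrightarrow> \<phi> t \<le> \<phi> 0"
  shows "c \<le> 0"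
proof (rule ccontr)
  assume "\<not> c \<le> 0"
  then have "c > 0" by simp
  have z: "\<phi>' 0 = 0"
    by (rule DERIV_local_max[OF d[of 0] \<open>r > 0\<close>]) (use assms(1) max in auto)
  obtain s where s: "s > 0" "\<And>h. h > 0 \<Longrightarrow> h < s \<Longrightarrow> \<phi>' 0 < \<phi>' (0 + h)"
    using DERIV_pos_inc_right[OF d2 \<open>c > 0\<close>] by blast
  define h where "h = min r s / 2"
  have h: "h > 0" "h < r" "h < s" using \<open>r > 0\<close> s(1) by (auto simp: h_def)
  obtain x where x: "0 < x" "x < h" "\<phi> h - \<phi> 0 = (h - 0) * \<phi>' x"
    using MVT2[OF h(1), of \<phi> \<phi>'] d h by fastforce
  have "\<phi>' x > 0" using s(2)[of x] x h z by simp
  then have "\<phi> h - \<phi> 0 > 0" using x(3) h by simp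
  then show False using max[of h] h by simp
qed

lemma laplacian_at_max:
  assumes U: "open U" and w: "lap_on U w p L" and z: "z \<in> U" and max: "\<And>x. x \<in> U \<Longrightarrow> w x \<le> w z"
  shows "L z \<le> 0"
proof -
  obtain r where r: "r > 0" "ball z r \<subseteq> U" using U z open_contains_ball by blast
  obtain q where q: "wirt p z q (of_real (L z) / 4)" using w z unfolding lap_on_def by blast
  have "2 * Re ((q * c + of_real (L z) / 4 * cnj c) * c) \<le> 0" if c: "norm c = 1" for c
  proof (rule second_derivative_at_max[OF r(1)])
    have in_U: "z + of_real t * c \<in> U" if "\<bar>t\<bar> < r" for t
      using r(2) that c by (auto simp: subset_eq dist_norm norm_mult)
    show "((\<lambda>t. w (z + of_real t * c)) has_real_derivative 2 * Re (p (z + of_real t * c) * c)) (at t)" if "\<bar>t\<bar> < r" for t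
    proof -
      have "wirt (\<lambda>x. of_real (w x)) (z + of_real t * c) (p (z + of_real t * c)) (cnj (p (z + of_real t * c)))"
        using w in_U[OF that] by (simp add: lap_on_def)
      from line_derivative[OF this] show ?thesis by (simp add: algebra_simps)
    qed
    show "w (z + of_real t * c) \<le> w (z + of_real 0 * c)" if "\<bar>t\<bar> < r" for t
      using max in_U[OF that] by simp
    have "wirt (\<lambda>x. 2 * c * p x) (z + of_real 0 * c) (2 * c * q) (2 * c * (of_real (L z) / 4))"
      using wirt_cmult[OF q, of "2 * c"] by simp
    from line_derivative[OF this]
    have "((\<lambda>t. Re (2 * c * p (z + of_real t * c))) has_real_derivative
       Re (2 * c * q * c + 2 * c * (of_real (L z) / 4) * cnj c)) (at 0)" .
    also have "(\<lambda>t. Re (2 * c * p (z + of_real t * c))) = (\<lambda>t. 2 * Re (p (z + of_real t * c) * c))"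
      by (simp add: fun_eq_iff algebra_simps)
    also have "2 * c * q * c + 2 * c * (of_real (L z) / 4) * cnj c = 2 * ((q * c + of_real (L z) / 4 * cnj c) * c)"
      by (simp add: field_simps)
    also have "Re (2 * ((q * c + of_real (L z) / 4 * cnj c) * c)) = 2 * Re ((q * c + of_real (L z) / 4 * cnj c) * c)"
      by simp
    finally show "((\<lambda>t. 2 * Re (p (z + of_real t * c) * c)) has_real_derivative 2 * Re ((q * c + of_real (L z) / 4 * cnj c) * c)) (at 0)" .
  qed
  \<comment> \<open>In the two orthogonal directions the terms with \<open>q\<close> cancel, and the
    second derivatives add up to \<open>L z\<close>.\<close>
  from this[of 1] this[of \<i>] show ?thesis by simp
qed

text \<open>A strictly positive Laplacian excludes an interior maximum directly; callers obtain the
  strict sign by adding quadratic terms.\<close>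

lemma maximum_principle:
  assumes K: "compact K" "continuous_on K w" and w: "lap_on (interior K) w p L"
    and L: "\<And>z. z \<in> interior K \<Longrightarrow> L z > 0" and bd: "\<And>z. z \<in> K - interior K \<Longrightarrow> w z \<le> B" and z: "z \<in> K"
  shows "w z \<le> B"
proof -
  obtain x where x: "x \<in> K" "\<And>y. y \<in> K \<Longrightarrow> w y \<le> w x"
    using continuous_attains_sup[OF K(1) _ K(2)] z by blast
  have "x \<notin> interior K"
    using laplacian_at_max[OF open_interior w, of x] L[of x] x(2) interior_subset[of K] by force
  then show ?thesis using bd[of x] x z by force
qed

lemma lap_on_continuous:
  assumes "lap_on U w p L" "z \<in> U" shows "isCont w z"
proof -
  have "isCont (\<lambda>x. Re (of_real (w x))) z"
    using assms unfolding lap_on_def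
    by (intro continuous_Re differentiable_imp_continuous_within[of _ _ UNIV] wirt_differentiable) auto
  then show ?thesis by simp
qed

text \<open>On a half square, the odd part of \<open>w\<close> in the direction of the gradient is dominated by an
  explicit quadratic barrier (Gilbarg and Trudinger, Theorem 3.9).\<close>

lemma gradient_estimate:
  assumes U: "open U" "cball z0 (2 * d) \<subseteq> U" and d: "d > 0" and w: "lap_on U w p L"
    and M: "\<And>z. z \<in> cball z0 (2 * d) \<Longrightarrow> \<bar>w z\<bar> \<le> M" and N: "\<And>z. z \<in> cball z0 (2 * d) \<Longrightarrow> \<bar>L z\<bar> < N"
  shows "norm (p z0) \<le> M / d + N * d / 4"
proof (cases "p z0 = 0")
  case True
  have "M \<ge> 0" "N > 0" using M[of z0] N[of z0] d by auto
  with d True show ?thesis by simp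
next
  case False
  \<comment> \<open>Rotates the plane so that the gradient of \<open>w\<close> at \<open>z0\<close>
    points along the imaginary axis: \<open>p z0 * c\<close> is - \<i> |p(z0)|.\<close>
  define c where "c = - \<i> * cnj (p z0) / norm (p z0)"
  have c: "norm c = 1" using False by (simp add: c_def norm_mult norm_divide)
  define f where "f z = z0 + c * z" for z
  define B where "B = ball (0::complex) (2 * d)"
  have fB: "f z \<in> cball z0 (2 * d)" if "z \<in> B" for z
    using that c by (simp add: f_def B_def dist_norm norm_mult)
  have df: "(f has_field_derivative c) (at z)" for z
    unfolding f_def by (auto intro!: derivative_eq_intros)
  have f_hol: "f holomorphic_on B" by (simp add: f_def[abs_def] holomorphic_intros)
  have v: "lap_on B (\<lambda>z. w (f z)) (\<lambda>z. p (f z) * c) (\<lambda>z. L (f z))"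
  proof -
    have "f ` B \<subseteq> U" using fB U(2) by blast
    from lap_on_compose[OF w _ f_hol this] show ?thesis
      using c DERIV_imp_deriv[OF df] by (simp add: B_def)
  qed
  have "x \<in> cnj ` B" if "x \<in> B" for x
    using that by (intro image_eqI[of x cnj "cnj x"]) (auto simp: B_def)
  then have cB: "cnj ` B = B" by (auto simp: B_def)
  have v': "lap_on B (\<lambda>z. w (f (cnj z))) (\<lambda>z. cnj (p (f (cnj z)) * c)) (\<lambda>z. L (f (cnj z)))"
    using lap_on_reflect[OF v] by (simp add: cB)
  \<comment> \<open>The first summand is harmonic, at least \<open>M\<close> on the sides |Re z| = d
    and Im z = d, and nonnegative on the real axis, where the odd part of \<open>w\<close> vanishes.
    The second has Laplacian - N, which absorbs the right-hand side, and vanishes for Im z = 0 and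
    Im z = d.\<close>
  define \<psi> where "\<psi> z = M / d\<^sup>2 * ((Re z)\<^sup>2 + (2 * d * Im z - (Im z)\<^sup>2)) + N / 2 * (d * Im z - (Im z)\<^sup>2)" for z
  define p\<psi> where "p\<psi> z = of_real (M / d\<^sup>2) * (2 * of_real (Re z) * (1/2) + (of_real (2 * d) * (- \<i> / 2) - 2 * of_real (Im z) * (- \<i> / 2)))
     + of_real (N / 2) * (of_real d * (- \<i> / 2) - 2 * of_real (Im z) * (- \<i> / 2))" for z
  have \<psi>: "lap_on B \<psi> p\<psi> (\<lambda>_. - N)"
  proof -
    have "lap_on B \<psi> p\<psi> (\<lambda>_. M / d\<^sup>2 * (8 * (norm (1/2::complex))\<^sup>2 + (2 * d * 0 - 8 * (norm (- \<i> / 2))\<^sup>2)) + N / 2 * (d * 0 - 8 * (norm (- \<i> / 2))\<^sup>2))"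
      unfolding \<psi>_def[abs_def] p\<psi>_def[abs_def]
      by (intro lap_on_add lap_on_cmult lap_on_diff lap_on_square lap_on_Re lap_on_Im)
    then show ?thesis by (simp add: norm_divide power2_eq_square)
  qed
  define F where "F z = 1/2 * (w (f z) - w (f (cnj z))) - \<psi> z" for z
  define pF where "pF z = of_real (1/2) * (p (f z) * c - cnj (p (f (cnj z)) * c)) - p\<psi> z" for z
  have F: "lap_on B F pF (\<lambda>z. 1/2 * (L (f z) - L (f (cnj z))) - (- N))"
    unfolding F_def[abs_def] pF_def[abs_def] by (intro lap_on_diff lap_on_cmult v v' \<psi>)
  \<comment> \<open>The upper half square: its corners have modulus at most sqrt 2 d < 2 d, so it
    and its reflection lie in \<open>B\<close>.\<close>
  define K where "K = cbox (Complex (- d) 0) (Complex d d)"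
  have intK: "interior K = box (Complex (- d) 0) (Complex d d)" by (simp add: K_def interior_cbox)
  have K: "z \<in> K \<longleftrightarrow> \<bar>Re z\<bar> \<le> d \<and> 0 \<le> Im z \<and> Im z \<le> d" for z
    by (auto simp: K_def in_cbox_complex_iff)
  have iK: "z \<in> interior K \<longleftrightarrow> \<bar>Re z\<bar> < d \<and> 0 < Im z \<and> Im z < d" for z
    by (auto simp: intK in_box_complex_iff)
  have KB: "K \<subseteq> B"
  proof
    fix z assume "z \<in> K"
    then have z: "\<bar>Re z\<bar> \<le> d" "\<bar>Im z\<bar> \<le> d" by (auto simp: K)
    have "(norm z)\<^sup>2 \<le> d\<^sup>2 + d\<^sup>2"
      unfolding cmod_power2 using z d by (intro add_mono) (auto intro!: abs_le_square_iff[THEN iffD1])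
    also have "\<dots> < (2 * d)\<^sup>2" using d by (simp add: power2_eq_square)
    finally have "norm z < 2 * d" using d by (meson power_less_imp_less_base less_imp_le mult_pos_pos zero_less_numeral)
    then show "z \<in> B" by (simp add: B_def)
  qed
  have cn: "cnj z \<in> B" if "z \<in> B" for z using that by (simp add: B_def)
  have FK: "F z \<le> 0" if "z \<in> K" for z
  proof (rule maximum_principle[where K=K and w=F])
    show "compact K" by (simp add: K_def)
    show "continuous_on K F"
      using lap_on_continuous[OF F] KB by (intro continuous_at_imp_continuous_on) auto
    show "lap_on (interior K) F pF (\<lambda>z. 1/2 * (L (f z) - L (f (cnj z))) - (- N))"
      by (rule lap_on_subset[OF F]) (use KB interior_subset[of K] in blast)
    show "1/2 * (L (f z) - L (f (cnj z))) - (- N) > 0" if "z \<in> interior K" for z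
    proof -
      have "z \<in> B" using that KB interior_subset[of K] by blast
      then show ?thesis using N[OF fB[of z]] N[OF fB[OF cn[of z]]]
        by (auto simp: abs_less_iff field_simps)
    qed
    show "F z \<le> 0" if "z \<in> K - interior K" for z
    proof -
      have z: "\<bar>Re z\<bar> \<le> d" "0 \<le> Im z" "Im z \<le> d" using that by (auto simp: K)
      have "z \<in> B" using that KB by blast
      then have Mz: "\<bar>w (f z)\<bar> \<le> M" "\<bar>w (f (cnj z))\<bar> \<le> M" using M[OF fB[of z]] M[OF fB[OF cn[of z]]] by auto
      have M0: "M \<ge> 0" "N > 0" using M[of z0] N[of z0] d by auto
      have "0 \<le> Im z * (d - Im z)" "0 \<le> d * Im z" using z d by auto
      then have pos: "0 \<le> d * Im z - (Im z)\<^sup>2" "0 \<le> 2 * d * Im z - (Im z)\<^sup>2"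
        by (simp_all add: algebra_simps power2_eq_square)
      have "Im z = 0 \<or> Im z = d \<or> \<bar>Re z\<bar> = d" using that by (auto simp: K iK)
      then consider "Im z = 0" | "Im z = d" | "\<bar>Re z\<bar> = d" by blast
      then show ?thesis
      proof cases
        case 1
        then have "cnj z = z" by (simp add: complex_eq_iff)
        then show ?thesis using 1 M0 by (simp add: F_def \<psi>_def)
      next
        case 2
        have "M = M / d\<^sup>2 * d\<^sup>2" using d by simp
        also have "\<dots> \<le> M / d\<^sup>2 * ((Re z)\<^sup>2 + (2 * d * Im z - (Im z)\<^sup>2))"
          using 2 M0 by (intro mult_left_mono) (auto simp: power2_eq_square)
        also have "\<dots> \<le> \<psi> z" unfolding \<psi>_def using M0 pos by simp
        finally show ?thesis using Mz by (simp add: F_def)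
      next
        case 3
        then have "(Re z)\<^sup>2 = d\<^sup>2" by (metis power2_abs)
        have "M = M / d\<^sup>2 * d\<^sup>2" using d by simp
        also have "\<dots> \<le> M / d\<^sup>2 * ((Re z)\<^sup>2 + (2 * d * Im z - (Im z)\<^sup>2))"
          using \<open>(Re z)\<^sup>2 = d\<^sup>2\<close> M0 pos by (intro mult_left_mono) auto
        also have "\<dots> \<le> \<psi> z" unfolding \<psi>_def using M0 pos by simp
        finally show ?thesis using Mz by (simp add: F_def)
      qed
    qed
  qed fact
  have "wirt (\<lambda>x. of_real (F x)) (0 + of_real 0 * \<i>) (pF 0) (cnj (pF 0))"
    using F d by (auto simp: lap_on_def B_def)
  from line_derivative[OF this]
  have D: "((\<lambda>t. F (of_real t * \<i>)) has_real_derivative 2 * Re (pF 0 * \<i>)) (at 0)" by simp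
  \<comment> \<open>\<open>F\<close> vanishes at 0 and is at most 0 above it, so its derivative
    along the imaginary axis is nonpositive. That derivative is twice |p(z0)| minus the slope of the
    barrier, M / d + N d / 4.\<close>
  have "2 * Re (pF 0 * \<i>) \<le> 0"
  proof (rule ccontr)
    assume "\<not> 2 * Re (pF 0 * \<i>) \<le> 0"
    then obtain s where s: "s > 0" "\<And>h. h > 0 \<Longrightarrow> h < s \<Longrightarrow> F (of_real 0 * \<i>) < F (of_real (0 + h) * \<i>)"
      using DERIV_pos_inc_right[OF D] by auto
    define h where "h = min s d / 2"
    have h: "h > 0" "h < s" "h \<le> d" using s d by (auto simp: h_def)
    have "F (of_real h * \<i>) \<le> 0" by (rule FK) (use h d in \<open>auto simp: K\<close>)
    moreover have "F 0 = 0" by (simp add: F_def \<psi>_def)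
    ultimately show False using s(2)[of h] h by simp
  qed
  moreover have "Re (pF 0 * \<i>) = norm (p z0) - (M / d\<^sup>2 * d + N / 2 * d / 2)"
  proof -
    have pc: "p z0 * c = - \<i> * of_real (norm (p z0))"
      using False by (simp add: c_def field_simps complex_norm_square[unfolded of_real_power, symmetric] power2_eq_square)
    have "pF 0 = of_real (1/2) * (p z0 * c - cnj (p z0 * c)) - p\<psi> 0" by (simp add: pF_def f_def)
    also have "\<dots> = - \<i> * of_real (norm (p z0)) - p\<psi> 0" unfolding pc by simp
    finally have "Re (pF 0 * \<i>) = norm (p z0) - Re (p\<psi> 0 * \<i>)" by simp
    moreover have "Re (p\<psi> 0 * \<i>) = M / d\<^sup>2 * d + N / 2 * d / 2" by (simp add: p\<psi>_def)
    ultimately show ?thesis by simp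
  qed
  ultimately have "norm (p z0) \<le> M / d\<^sup>2 * d + N / 2 * d / 2" by linarith
  also have "\<dots> = M / d + N * d / 4" using d by (simp add: power2_eq_square)
  finally show ?thesis .
qed

section \<open>Isolated singularities of solutions of the Liouville equation\<close>

text \<open>In the coordinate \<zeta> the cusp metric is |d\<zeta>|^2 / (Re \<zeta>)^2, with
  logarithm - 2 ln (- Re \<zeta>); the formula says that it solves the Liouville equation.\<close>

lemma lap_on_ln_minus_Re:
  assumes "\<And>z. z \<in> U \<Longrightarrow> Re z < 0"
  shows "lap_on U (\<lambda>z. ln (- Re z)) (\<lambda>z. of_real (1 / (2 * Re z))) (\<lambda>z. - 1 / (Re z)\<^sup>2)"
  unfolding lap_on_def
proof (intro ballI conjI)
  fix z assume "z \<in> U"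
  then have n: "Re z < 0" by (rule assms)
  have "((\<lambda>x. ln (- Re x)) has_derivative (\<lambda>\<xi>. Re \<xi> / Re z)) (at z)"
    by (rule has_derivative_eq_rhs[OF has_derivative_ln[OF _ has_derivative_minus[OF has_derivative_Re[OF has_derivative_ident]]]])
       (use n in \<open>auto simp: fun_eq_iff field_simps\<close>)
  from bounded_linear.has_derivative[OF bounded_linear_of_real this]
  show "wirt (\<lambda>x. of_real (ln (- Re x))) z (of_real (1 / (2 * Re z))) (cnj (of_real (1 / (2 * Re z))))"
    unfolding wirt_def by (rule has_derivative_eq_rhs) (use n in \<open>simp add: fun_eq_iff complex_eq_iff field_simps\<close>)
  have "((\<lambda>x. 1 / (2 * Re x)) has_derivative (\<lambda>\<xi>. - Re \<xi> / (2 * (Re z)\<^sup>2))) (at z)"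
    using n by (auto intro!: derivative_eq_intros simp: fun_eq_iff field_simps power2_eq_square)
  from bounded_linear.has_derivative[OF bounded_linear_of_real this]
  have "wirt (\<lambda>x. of_real (1 / (2 * Re x))) z (of_real (- 1 / (4 * (Re z)\<^sup>2))) (of_real (- 1 / (Re z)\<^sup>2) / 4)"
    unfolding wirt_def by (rule has_derivative_eq_rhs) (use n in \<open>simp add: fun_eq_iff complex_eq_iff field_simps\<close>)
  then show "\<exists>q. wirt (\<lambda>x. of_real (1 / (2 * Re x))) z q (of_real (- 1 / (Re z)\<^sup>2) / 4)" by blast
qed

lemma lap_on_dist_square: "lap_on U (\<lambda>z. (norm (z - z0))\<^sup>2) (\<lambda>z. cnj (z - z0)) (\<lambda>_. 4)"
  unfolding lap_on_def
proof (intro ballI conjI)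
  fix z
  have w: "wirt (\<lambda>x. x - z0) z 1 0" by (rule wirt_field) (auto intro!: derivative_eq_intros)
  have "wirt (\<lambda>x. (x - z0) * cnj (x - z0)) z (cnj (z - z0)) (z - z0)"
    using wirt_mult[OF w wirt_cnj[OF w]] by simp
  then show "wirt (\<lambda>x. of_real ((norm (x - z0))\<^sup>2)) z (cnj (z - z0)) (cnj (cnj (z - z0)))"
    by (simp only: complex_norm_square complex_cnj_cnj)
  show "\<exists>q. wirt (\<lambda>z. cnj (z - z0)) z q (of_real 4 / 4)"
    using wirt_cnj[OF w] by auto
qed

lemma norm_exp_less:
  assumes "Re \<zeta> < ln r" "r > 0" shows "norm (exp \<zeta>) < r"
proof -
  have "exp (Re \<zeta>) < exp (ln r)" using assms(1) by (simp only: exp_less_cancel_iff)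
  then show ?thesis using assms(2) by simp
qed

locale punctured_liouville =
  fixes R :: real and H :: "complex \<Rightarrow> real" and p :: "complex \<Rightarrow> complex"
  assumes R: "R > 0"
    and lap: "lap_on (ball 0 R - {0}) (\<lambda>z. ln (H z)) p (\<lambda>z. 2 * H z)"
    and pos: "\<And>z. z \<in> ball 0 R - {0} \<Longrightarrow> H z > 0"
begin

text \<open>The logarithmic coordinate \<open>\<zeta>\<close> with \<open>z = exp \<zeta>\<close>:\<close>

definition U :: "complex set" where "U = {\<zeta>. Re \<zeta> < ln R}"

lemma open_U: "open U" unfolding U_def by (rule open_halfspace_Re_lt)

lemma exp_U: "\<zeta> \<in> U \<Longrightarrow> exp \<zeta> \<in> ball 0 R - {0}"
  using norm_exp_less[OF _ R, of \<zeta>] by (simp add: U_def)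

text \<open>The \<zeta>-derivative is z p(z), the quantity whose asymptotics are wanted, and H |z|^2
  is the conformal factor in the coordinate \<zeta>.\<close>

lemma lap_exp: "lap_on U (\<lambda>\<zeta>. ln (H (exp \<zeta>))) (\<lambda>\<zeta>. p (exp \<zeta>) * exp \<zeta>) (\<lambda>\<zeta>. 2 * H (exp \<zeta>) * (norm (exp \<zeta>))\<^sup>2)"
proof -
  have "exp ` U \<subseteq> ball 0 R - {0}" by (rule image_subsetI) (rule exp_U)
  from lap_on_compose[OF lap open_U holomorphic_on_exp this] show ?thesis
    unfolding DERIV_imp_deriv[OF DERIV_exp] .
qed

text \<open>\<open>w\<close> tends to 0, and its Laplacian 2 H |z|^2 is of order |z|^(2 \<alpha> +
  2), which tends to 0 because \<alpha> > - 1. So its gradient tends to 0, and the subtracted model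
  2 \<alpha> Re \<zeta> has derivative \<alpha>.\<close>

lemma conical_asymptotics:
  assumes \<alpha>: "\<alpha> > - 1" and C: "C > 0" and lim: "((\<lambda>z. H z / norm z powr (2 * \<alpha>)) \<longlongrightarrow> C) (at 0)"
  shows "((\<lambda>z. z * p z) \<longlongrightarrow> of_real \<alpha>) (at 0)"
proof (rule tendstoI)
  fix e :: real assume "e > 0"
  \<comment> \<open>The gradient estimate with d = 1 returns \<epsilon> + \<epsilon> / 4, below
    e.\<close>
  define \<epsilon> where "\<epsilon> = e / 2"
  have \<epsilon>: "\<epsilon> > 0" "\<epsilon> + \<epsilon> / 4 < e" using \<open>e > 0\<close> by (auto simp: \<epsilon>_def)
  have l1: "((\<lambda>z. ln (H z / norm z powr (2 * \<alpha>))) \<longlongrightarrow> ln C) (at 0)"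
    using tendsto_ln[OF lim] C by simp
  have "((\<lambda>z. 2 * (H z / norm z powr (2 * \<alpha>)) * norm z powr (2 * \<alpha> + 2)) \<longlongrightarrow> 2 * C * 0) (at (0::complex))"
  proof (intro tendsto_intros lim)
    have n: "((\<lambda>z::complex. norm z) \<longlongrightarrow> 0) (at 0)" by (rule tendsto_norm_zero[OF tendsto_ident_at])
    show "((\<lambda>z. norm z powr (2 * \<alpha> + 2)) \<longlongrightarrow> 0) (at (0::complex))"
      by (rule tendsto_zero_powrI[OF n tendsto_const]) (use \<alpha> in auto)
  qed
  then have l2: "((\<lambda>z. 2 * (H z / norm z powr (2 * \<alpha>)) * norm z powr (2 * \<alpha> + 2)) \<longlongrightarrow> 0) (at (0::complex))" by simp
  have "\<forall>\<^sub>F z in at 0. \<bar>ln (H z / norm z powr (2 * \<alpha>)) - ln C\<bar> < \<epsilon> \<and>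
      \<bar>2 * (H z / norm z powr (2 * \<alpha>)) * norm z powr (2 * \<alpha> + 2)\<bar> < \<epsilon>"
    using tendstoD[OF l1 \<epsilon>(1)] tendstoD[OF l2 \<epsilon>(1)] by (auto simp: dist_real_def intro: eventually_conj)
  then obtain d where d: "d > 0" "\<And>z. z \<noteq> 0 \<Longrightarrow> norm z < d \<Longrightarrow> \<bar>ln (H z / norm z powr (2 * \<alpha>)) - ln C\<bar> < \<epsilon> \<and>
      \<bar>2 * (H z / norm z powr (2 * \<alpha>)) * norm z powr (2 * \<alpha> + 2)\<bar> < \<epsilon>"
    unfolding eventually_at by auto
  define r where "r = min d R"
  have r: "r > 0" "r \<le> d" "r \<le> R" using d R by (auto simp: r_def)
  define w where "w \<zeta> = ln (H (exp \<zeta>)) - 2 * \<alpha> * Re \<zeta> - ln C" for \<zeta>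
  have w: "lap_on U w (\<lambda>\<zeta>. p (exp \<zeta>) * exp \<zeta> - of_real (2 * \<alpha>) * (1 / 2) - 0) (\<lambda>\<zeta>. 2 * H (exp \<zeta>) * (norm (exp \<zeta>))\<^sup>2 - 2 * \<alpha> * 0 - 0)"
    unfolding w_def[abs_def] by (intro lap_on_diff lap_exp lap_on_cmult lap_on_Re lap_on_const)
  have est: "\<bar>w \<zeta>\<bar> \<le> \<epsilon> \<and> \<bar>2 * H (exp \<zeta>) * (norm (exp \<zeta>))\<^sup>2 - 2 * \<alpha> * 0 - 0\<bar> < \<epsilon>" if "Re \<zeta> < ln r" for \<zeta>
  proof -
    have n: "norm (exp \<zeta>) < r" using norm_exp_less that r(1) by blast
    then have m: "exp \<zeta> \<in> ball 0 R - {0}" "norm (exp \<zeta>) < d" using r by auto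
    have P: "norm (exp \<zeta>) powr b = exp (b * Re \<zeta>)" for b by (simp add: powr_def)
    have "ln (H (exp \<zeta>) / norm (exp \<zeta>) powr (2 * \<alpha>)) = ln (H (exp \<zeta>)) - 2 * \<alpha> * Re \<zeta>"
      unfolding P using pos[OF m(1)] by (simp add: ln_div)
    then have 1: "\<bar>w \<zeta>\<bar> < \<epsilon>" using d(2)[of "exp \<zeta>"] m by (simp add: w_def)
    have "2 * (H (exp \<zeta>) / norm (exp \<zeta>) powr (2 * \<alpha>)) * norm (exp \<zeta>) powr (2 * \<alpha> + 2) = 2 * H (exp \<zeta>) * (norm (exp \<zeta>))\<^sup>2"
      unfolding P by (simp add: exp_add distrib_right exp_double)
    then have "\<bar>2 * H (exp \<zeta>) * (norm (exp \<zeta>))\<^sup>2\<bar> < \<epsilon>" using d(2)[of "exp \<zeta>"] m(2) by simp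
    with 1 show ?thesis by simp
  qed
  \<comment> \<open>The factor exp (- 2) moves Re \<zeta> by 2 to the left, so the disc of radius 2
    about \<zeta> stays in the half-plane where \<open>est\<close> holds.\<close>
  have "dist (z * p z) (of_real \<alpha>) < e" if z: "z \<noteq> 0" "norm z < r * exp (- 2)" for z
  proof -
    \<comment> \<open>The branch of the logarithm only picks the base point. On the disc all
      functions are composed with \<open>exp\<close>, so the branch cut does not interfere.\<close>
    define \<zeta> where "\<zeta> = Ln z"
    have ez: "exp \<zeta> = z" using z by (simp add: \<zeta>_def)
    have "Re \<zeta> = ln (norm z)" using z by (simp add: \<zeta>_def)
    also have "\<dots> < ln (r * exp (- 2))" using z r by (subst ln_less_cancel_iff) auto
    also have "\<dots> = ln r - 2" using r by (simp add: ln_mult)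
    finally have "Re \<zeta> < ln r - 2" .
    then have in': "Re x < ln r" if "x \<in> cball \<zeta> (2 * 1)" for x
      using abs_Re_le_cmod[of "\<zeta> - x"] that by (auto simp: dist_norm)
    have "ln r \<le> ln R" using r by simp
    then have "cball \<zeta> (2 * 1) \<subseteq> U" unfolding U_def using in' by fastforce
    from gradient_estimate[OF open_U this _ w, of \<epsilon> \<epsilon>]
    have "norm (p (exp \<zeta>) * exp \<zeta> - of_real (2 * \<alpha>) * (1 / 2) - 0) \<le> \<epsilon> / 1 + \<epsilon> * 1 / 4"
      using est in' by simp
    then show ?thesis using \<epsilon>(2) by (simp add: ez dist_norm mult.commute)
  qed
  moreover have "r * exp (- 2) > 0" using r by simp
  ultimately show "\<forall>\<^sub>F z in at 0. dist (z * p z) (of_real \<alpha>) < e"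
    unfolding eventually_at by (intro exI[of _ "r * exp (- 2)"]) auto
qed

section \<open>Cusps\<close>

context
  fixes C :: real
  assumes C: "C > 0" and lim: "((\<lambda>z. H z * (norm z * ln (norm z))\<^sup>2) \<longlongrightarrow> C) (at 0)"
begin

text \<open>The logarithm of the quotient of the metric by its model C |d\<zeta>|^2 / (Re
  \<zeta>)^2; \<open>pw\<close> and \<open>Lw\<close> are its derivative and its Laplacian.\<close>

definition w :: "complex \<Rightarrow> real" where
  "w \<zeta> = ln (H (exp \<zeta>)) + 2 * Re \<zeta> + 2 * ln (- Re \<zeta>) - ln C"

definition pw :: "complex \<Rightarrow> complex" where
  "pw \<zeta> = p (exp \<zeta>) * exp \<zeta> + 1 + of_real (1 / Re \<zeta>)"

definition Lw :: "complex \<Rightarrow> real" where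
  "Lw \<zeta> = 2 * H (exp \<zeta>) * (norm (exp \<zeta>))\<^sup>2 - 2 / (Re \<zeta>)\<^sup>2"

lemma lap_w:
  assumes "V \<subseteq> U" "\<And>z. z \<in> V \<Longrightarrow> Re z < 0" shows "lap_on V w pw Lw"
proof -
  have "lap_on V w (\<lambda>\<zeta>. p (exp \<zeta>) * exp \<zeta> + of_real 2 * (1 / 2) + of_real 2 * of_real (1 / (2 * Re \<zeta>)) - 0)
    (\<lambda>\<zeta>. 2 * H (exp \<zeta>) * (norm (exp \<zeta>))\<^sup>2 + 2 * 0 + 2 * (- 1 / (Re \<zeta>)\<^sup>2) - 0)"
    unfolding w_def[abs_def]
    by (intro lap_on_diff lap_on_add lap_on_cmult lap_on_Re lap_on_const lap_on_ln_minus_Re lap_on_subset[OF lap_exp] assms)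
  then show ?thesis by (simp add: pw_def[abs_def] Lw_def[abs_def])
qed

text \<open>(Re \<zeta>)^2 \<open>Lw \<zeta>\<close> is 2 (H (r ln r)^2 - 1), with limit 2 (C - 1):
  the Laplacian is small compared to 1 / (Re \<zeta>)^2 only if C = 1.\<close>

lemma cusp_bounds:
  assumes e: "e > 0"
  obtains N where "N < 0" "N \<le> ln R" "\<And>\<zeta>. Re \<zeta> < N \<Longrightarrow> \<bar>w \<zeta>\<bar> \<le> e" "\<And>\<zeta>. Re \<zeta> < N \<Longrightarrow> \<bar>Lw \<zeta> * (Re \<zeta>)\<^sup>2 - 2 * (C - 1)\<bar> < e"
proof -
  have l1: "((\<lambda>z. ln (H z * (norm z * ln (norm z))\<^sup>2)) \<longlongrightarrow> ln C) (at 0)"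
    using tendsto_ln[OF lim] C by simp
  have l2: "((\<lambda>z. 2 * (H z * (norm z * ln (norm z))\<^sup>2)) \<longlongrightarrow> 2 * C) (at 0)"
    by (intro tendsto_intros lim)
  have "\<forall>\<^sub>F z in at 0. \<bar>ln (H z * (norm z * ln (norm z))\<^sup>2) - ln C\<bar> < e \<and>
      \<bar>2 * (H z * (norm z * ln (norm z))\<^sup>2) - 2 * C\<bar> < e"
    using tendstoD[OF l1 e] tendstoD[OF l2 e] by (auto simp: dist_real_def intro: eventually_conj)
  then obtain d where d: "d > 0" "\<And>z. z \<noteq> 0 \<Longrightarrow> norm z < d \<Longrightarrow> \<bar>ln (H z * (norm z * ln (norm z))\<^sup>2) - ln C\<bar> < e \<and>
      \<bar>2 * (H z * (norm z * ln (norm z))\<^sup>2) - 2 * C\<bar> < e"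
    unfolding eventually_at by auto
  define r where "r = min (min d R) (1/2)"
  have r: "r > 0" "r \<le> d" "r \<le> R" "r < 1" using d R by (auto simp: r_def)
  show ?thesis
  proof (rule that[of "ln r"])
    show "ln r < 0" "ln r \<le> ln R" using r by auto
    fix \<zeta> :: complex assume \<zeta>: "Re \<zeta> < ln r"
    have n: "norm (exp \<zeta>) < r" using norm_exp_less \<zeta> r(1) by blast
    then have m: "exp \<zeta> \<in> ball 0 R - {0}" "norm (exp \<zeta>) < d" using r by auto
    have neg: "Re \<zeta> < 0" using \<zeta> \<open>ln r < 0\<close> by simp
    have h: "H (exp \<zeta>) > 0" using pos[OF m(1)] .
    define m where "m = - Re \<zeta>"
    have m0: "m > 0" using neg by (simp add: m_def)
    have sq: "(norm (exp \<zeta>) * ln (norm (exp \<zeta>)))\<^sup>2 = exp (2 * Re \<zeta>) * m\<^sup>2"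
      by (simp add: power_mult_distrib exp_double m_def)
    have "ln (H (exp \<zeta>) * (exp (2 * Re \<zeta>) * m\<^sup>2)) = ln (H (exp \<zeta>)) + (2 * Re \<zeta> + 2 * ln m)"
      using h m0 by (simp add: ln_mult ln_realpow)
    then have "ln (H (exp \<zeta>) * (norm (exp \<zeta>) * ln (norm (exp \<zeta>)))\<^sup>2) = ln (H (exp \<zeta>)) + 2 * Re \<zeta> + 2 * ln (- Re \<zeta>)"
      unfolding sq by (simp add: m_def)
    then show "\<bar>w \<zeta>\<bar> \<le> e" using d(2)[of "exp \<zeta>"] m(2) by (simp add: w_def)
    have eq: "Lw \<zeta> * (Re \<zeta>)\<^sup>2 - 2 * (C - 1) = 2 * (H (exp \<zeta>) * (norm (exp \<zeta>) * ln (norm (exp \<zeta>)))\<^sup>2) - 2 * C"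
      using neg by (simp add: Lw_def field_simps)
    show "\<bar>Lw \<zeta> * (Re \<zeta>)\<^sup>2 - 2 * (C - 1)\<bar> < e"
      unfolding eq using d(2)[OF exp_not_eq_zero m(2)] by blast
  qed
qed

text \<open>If \<open>C \<noteq> 1\<close>, the bounded function \<open>w\<close> has Laplacian of size at least a multiple of
  \<open>1 / (Re \<zeta>)\<^sup>2\<close> on discs of radius comparable to \<open>Re \<zeta>\<close>, so that it oscillates on them by a fixed amount.\<close>

lemma cusp_constant: "C = 1"
proof (rule ccontr)
  assume "C \<noteq> 1"
  define \<kappa> where "\<kappa> = \<bar>C - 1\<bar>"
  \<comment> \<open>The sign treats C > 1 and C < 1 together: \<open>s * w\<close> has positive
    Laplacian far to the left in both cases.\<close>
  define s where "s = sgn (C - 1)"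
  have \<kappa>: "\<kappa> > 0" "s * (C - 1) = \<kappa>" "\<bar>s\<bar> = 1" using \<open>C \<noteq> 1\<close> by (auto simp: \<kappa>_def s_def sgn_real_def)
  obtain N where N: "N < 0" "N \<le> ln R" "\<And>\<zeta>. Re \<zeta> < N \<Longrightarrow> \<bar>w \<zeta>\<bar> \<le> \<kappa> / 200"
     "\<And>\<zeta>. Re \<zeta> < N \<Longrightarrow> \<bar>Lw \<zeta> * (Re \<zeta>)\<^sup>2 - 2 * (C - 1)\<bar> < \<kappa> / 200"
    using cusp_bounds[of "\<kappa> / 200"] \<kappa> by auto
  \<comment> \<open>The disc of radius t / 2 about - t has real parts between - 3 t / 2 and - t / 2
    = N - 1, so it lies in the region of the bounds.\<close>
  define t where "t = 2 * (1 - N)"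
  have t: "t > 0" "- t / 2 < N" using N(1) by (auto simp: t_def)
  define \<zeta>0 where "\<zeta>0 = complex_of_real (- t)"
  define K where "K = cball \<zeta>0 (t / 2)"
  have K: "Re \<zeta> < N" "\<bar>Re \<zeta>\<bar> \<le> 3 * t / 2" "Re \<zeta> < 0" if "\<zeta> \<in> K" for \<zeta>
    using abs_Re_le_cmod[of "\<zeta>0 - \<zeta>"] that t N(1) by (auto simp: K_def \<zeta>0_def dist_norm abs_le_iff)
  have KU: "K \<subseteq> U" unfolding U_def using K(1) N(2) by fastforce
  have lw: "lap_on K w pw Lw" by (rule lap_w[OF KU K(3)])
  \<comment> \<open>On \<open>K\<close> the Laplacian of \<open>s * w\<close> exceeds \<kappa> / (3
    t / 2)^2, and 4 \<eta> is half of that. On the boundary the quadratic term is \<eta> t^2 / 4 =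
    \<kappa> / 72, more than the possible oscillation 2 \<kappa> / 200 of
    \<open>s * w\<close>.\<close>
  define \<eta> where "\<eta> = \<kappa> / (18 * t\<^sup>2)"
  define F where "F \<zeta> = s * w \<zeta> - \<eta> * (norm (\<zeta> - \<zeta>0))\<^sup>2" for \<zeta>
  have F: "lap_on K F (\<lambda>\<zeta>. of_real s * pw \<zeta> - of_real \<eta> * cnj (\<zeta> - \<zeta>0)) (\<lambda>\<zeta>. s * Lw \<zeta> - \<eta> * 4)"
    unfolding F_def[abs_def] by (intro lap_on_diff lap_on_cmult lw lap_on_dist_square)
  have sw: "\<bar>s * w \<zeta>\<bar> \<le> \<kappa> / 200" if "\<zeta> \<in> K" for \<zeta>
    using N(3)[OF K(1)[OF that]] \<kappa> by (simp add: abs_mult)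
  have "F \<zeta>0 \<le> \<kappa> / 200 - \<kappa> / 72"
  proof (rule maximum_principle[where K=K and w=F])
    show "continuous_on K F" using lap_on_continuous[OF F] by (intro continuous_at_imp_continuous_on) auto
    show "lap_on (interior K) F (\<lambda>\<zeta>. of_real s * pw \<zeta> - of_real \<eta> * cnj (\<zeta> - \<zeta>0)) (\<lambda>\<zeta>. s * Lw \<zeta> - \<eta> * 4)"
      by (rule lap_on_subset[OF F interior_subset])
    show "0 < s * Lw \<zeta> - \<eta> * 4" if "\<zeta> \<in> interior K" for \<zeta>
    proof -
      have \<zeta>: "\<zeta> \<in> K" using that interior_subset by blast
      have "\<bar>s * (Lw \<zeta> * (Re \<zeta>)\<^sup>2 - 2 * (C - 1))\<bar> < \<kappa> / 200"
        using N(4)[OF K(1)[OF \<zeta>]] \<kappa> by (simp add: abs_mult)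
      moreover have "s * (Lw \<zeta> * (Re \<zeta>)\<^sup>2 - 2 * (C - 1)) = s * Lw \<zeta> * (Re \<zeta>)\<^sup>2 - 2 * (s * (C - 1))"
        by (simp add: algebra_simps)
      moreover have "- (s * (Lw \<zeta> * (Re \<zeta>)\<^sup>2 - 2 * (C - 1))) \<le> \<bar>s * (Lw \<zeta> * (Re \<zeta>)\<^sup>2 - 2 * (C - 1))\<bar>"
        by (rule abs_ge_minus_self)
      ultimately have 1: "\<kappa> < s * Lw \<zeta> * (Re \<zeta>)\<^sup>2" using \<kappa>(1,2) by linarith
      have "(Re \<zeta>)\<^sup>2 \<le> (3 * t / 2)\<^sup>2" using K(2)[OF \<zeta>] t by (intro abs_le_square_iff[THEN iffD1]) auto
      then have "\<eta> * 4 * (Re \<zeta>)\<^sup>2 \<le> \<eta> * 4 * (3 * t / 2)\<^sup>2"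
        using \<kappa>(1) by (intro mult_left_mono) (auto simp: \<eta>_def)
      also have "\<dots> = \<kappa> / 2" using t by (simp add: \<eta>_def power2_eq_square)
      finally have "\<eta> * 4 * (Re \<zeta>)\<^sup>2 < s * Lw \<zeta> * (Re \<zeta>)\<^sup>2" using 1 \<kappa>(1) by linarith
      then show ?thesis using K(3)[OF \<zeta>] by simp
    qed
    show "F \<zeta> \<le> \<kappa> / 200 - \<kappa> / 72" if "\<zeta> \<in> K - interior K" for \<zeta>
    proof -
      have nt: "norm (\<zeta> - \<zeta>0) = t / 2" using that by (auto simp: K_def interior_cball dist_norm norm_minus_commute)
      have "\<eta> * (norm (\<zeta> - \<zeta>0))\<^sup>2 = \<kappa> / 72" unfolding nt using t by (simp add: \<eta>_def power2_eq_square)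
      then show ?thesis using sw[of \<zeta>] that by (simp add: F_def abs_le_iff)
    qed
  qed (use t in \<open>auto simp: K_def\<close>)
  moreover have "F \<zeta>0 \<ge> - \<kappa> / 200" using sw[of \<zeta>0] t by (auto simp: F_def K_def abs_le_iff)
  ultimately show False using \<kappa>(1) by simp
qed

text \<open>The gradient estimate with d = t / 4, t = - Re \<zeta>, gains a factor 1 / t: |w| \<le>
  \<epsilon> gives 4 \<epsilon> / t, and the Laplacian of size \<epsilon> / t^2 contributes another
  multiple of \<epsilon> / t. Here C = 1 is essential, since otherwise the second contribution is
  not o(1 / t).\<close>

lemma cusp_asymptotics: "((\<lambda>z. of_real (ln (norm z)) * (z * p z + 1)) \<longlongrightarrow> - 1) (at 0)"
proof (rule tendstoI)
  fix e :: real assume "e > 0"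
  \<comment> \<open>The estimate below produces 17/4 \<epsilon>, and 17/4 < 6.\<close>
  define \<epsilon> where "\<epsilon> = e / 6"
  have \<epsilon>: "\<epsilon> > 0" using \<open>e > 0\<close> by (auto simp: \<epsilon>_def)
  obtain N where N: "N < 0" "N \<le> ln R" "\<And>\<zeta>. Re \<zeta> < N \<Longrightarrow> \<bar>w \<zeta>\<bar> \<le> \<epsilon>"
     "\<And>\<zeta>. Re \<zeta> < N \<Longrightarrow> \<bar>Lw \<zeta> * (Re \<zeta>)\<^sup>2 - 2 * (C - 1)\<bar> < \<epsilon>"
    using cusp_bounds[OF \<epsilon>] by auto
  \<comment> \<open>The bound exp (2 N) means t > - 2 N, so the disc of radius t / 2 about \<zeta>
    lies to the left of - t / 2 < N.\<close>
  have "dist (of_real (ln (norm z)) * (z * p z + 1)) (- 1) < e" if z: "z \<noteq> 0" "norm z < exp (2 * N)" for z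
  proof -
    define \<zeta> where "\<zeta> = Ln z"
    define t where "t = - Re \<zeta>"
    have ez: "exp \<zeta> = z" using z by (simp add: \<zeta>_def)
    have R\<zeta>: "Re \<zeta> = ln (norm z)" using z by (simp add: \<zeta>_def)
    also have "\<dots> < ln (exp (2 * N))" using z by (subst ln_less_cancel_iff) auto
    finally have t: "t > - 2 * N" "t > 0" using N(1) by (auto simp: t_def)
    define K where "K = cball \<zeta> (2 * (t / 4))"
    have K: "Re x < N" "Re x \<le> - t / 2" "Re x < 0" if "x \<in> K" for x
      using abs_Re_le_cmod[of "\<zeta> - x"] that t N(1) by (auto simp: K_def t_def dist_norm abs_le_iff)
    have KU: "K \<subseteq> U" unfolding U_def using K(1) N(2) by fastforce
    define V where "V = U \<inter> {x. Re x < 0}"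
    have V: "open V" "K \<subseteq> V" using KU K(3) open_U open_halfspace_Re_lt[of 0] by (auto simp: V_def)
    have lw: "lap_on V w pw Lw" by (rule lap_w) (auto simp: V_def)
    have L: "\<bar>Lw x\<bar> < 4 * \<epsilon> / t\<^sup>2" if "x \<in> K" for x
    proof -
      have "\<bar>Lw x\<bar> * (Re x)\<^sup>2 < \<epsilon>" using N(4)[OF K(1)[OF that]] by (simp add: cusp_constant abs_mult)
      moreover have "(t / 2)\<^sup>2 \<le> (Re x)\<^sup>2" using K(2)[OF that] t by (intro abs_le_square_iff[THEN iffD1]) auto
      then have "\<bar>Lw x\<bar> * (t / 2)\<^sup>2 \<le> \<bar>Lw x\<bar> * (Re x)\<^sup>2" by (intro mult_left_mono) auto
      ultimately have "\<bar>Lw x\<bar> * (t / 2)\<^sup>2 < \<epsilon>" by linarith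
      then show ?thesis using t by (simp add: field_simps power2_eq_square)
    qed
    have "norm (pw \<zeta>) \<le> \<epsilon> / (t / 4) + 4 * \<epsilon> / t\<^sup>2 * (t / 4) / 4"
      by (rule gradient_estimate[OF V(1) V(2)[unfolded K_def] _ lw])
         (use t N(3) K(1) L in \<open>auto simp: K_def\<close>)
    also have "\<dots> = (17 / 4 * \<epsilon>) / t" using t by (simp add: field_simps power2_eq_square)
    finally have "t * norm (pw \<zeta>) \<le> 17 / 4 * \<epsilon>" using t by (simp add: field_simps)
    also have "\<dots> < e" using \<open>e > 0\<close> by (simp add: \<epsilon>_def)
    finally have "t * norm (pw \<zeta>) < e" .
    moreover have "of_real (ln (norm z)) * (z * p z + 1) - (- 1) = of_real (- t) * pw \<zeta>"
      using t unfolding pw_def ez R\<zeta>[symmetric] t_def by (simp add: field_simps)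
    ultimately show ?thesis using t by (simp add: dist_norm norm_mult del: of_real_minus minus_minus diff_minus_eq_add)
  qed
  then show "\<forall>\<^sub>F z in at 0. dist (of_real (ln (norm z)) * (z * p z + 1)) (- 1) < e"
    unfolding eventually_at by (intro exI[of _ "exp (2 * N)"]) auto
qed

end

end

section \<open>Charts\<close>

lemma is_chart_homeo:
  assumes "is_chart c"
  shows "open (fst c)" "open (snd c ` fst c)" "inj_on (snd c) (fst c)" "continuous_on (fst c) (snd c)"
    "continuous_on (snd c ` fst c) (the_inv_into (fst c) (snd c))"
proof -
  from assms show "open (fst c)" "open (snd c ` fst c)" by (auto simp: is_chart_def)
  obtain \<psi> where \<psi>: "homeomorphism (fst c) (snd c ` fst c) (snd c) \<psi>"
    using assms by (auto simp: is_chart_def)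
  show inj: "inj_on (snd c) (fst c)" by (rule inj_on_inverseI[where g=\<psi>]) (rule homeomorphism_apply1[OF \<psi>])
  show "continuous_on (fst c) (snd c)" using \<psi> homeomorphism_cont1 by blast
  have "the_inv_into (fst c) (snd c) z = \<psi> z" if "z \<in> snd c ` fst c" for z
    using that by (auto simp: the_inv_into_f_f[OF inj] homeomorphism_apply1[OF \<psi>])
  then show "continuous_on (snd c ` fst c) (the_inv_into (fst c) (snd c))"
    using homeomorphism_cont2[OF \<psi>] by (simp cong: continuous_on_cong)
qed

lemma open_img: assumes "is_chart c" "open S" shows "open (img c S)"
proof -
  note c = is_chart_homeo[OF assms(1)]
  have "img c S = snd c ` fst c \<inter> the_inv_into (fst c) (snd c) -` S"
    using c(3) by (auto simp: img_def the_inv_into_f_f)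
  moreover have "open (snd c ` fst c \<inter> the_inv_into (fst c) (snd c) -` S)"
    using continuous_on_open_vimage[OF c(2)] c(5) assms(2) by (metis Int_commute)
  ultimately show ?thesis by simp
qed

lemma img_mono: "S \<subseteq> T \<Longrightarrow> img c S \<subseteq> img c T"
  by (auto simp: img_def)

lemma imgI: "p \<in> fst c \<Longrightarrow> p \<in> S \<Longrightarrow> snd c p \<in> img c S"
  by (auto simp: img_def)

lemma imgE: assumes "z \<in> img c S" obtains p where "p \<in> fst c" "p \<in> S" "z = snd c p"
  using assms by (auto simp: img_def)

lemma transition_eq: "is_chart c \<Longrightarrow> p \<in> fst c \<Longrightarrow> transition c d (snd c p) = snd d p"
  by (simp add: transition_def the_inv_into_f_f is_chart_homeo(3))

lemma transition_img: "is_chart c \<Longrightarrow> z \<in> img c (fst d \<inter> S) \<Longrightarrow> transition c d z \<in> img d (fst c \<inter> S)"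
  by (auto elim!: imgE simp: transition_eq intro: imgI)

lemma transition_inverse:
  "is_chart c \<Longrightarrow> is_chart d \<Longrightarrow> z \<in> img c (fst d) \<Longrightarrow> transition d c (transition c d z) = z"
  by (auto elim!: imgE simp: transition_eq)

lemma charts_is_chart: "c \<in> charts A \<Longrightarrow> is_chart c"
  by (simp add: charts_def)

locale surface =
  fixes A :: "'a::t2_space chart set"
  assumes rs: "riemann_surface A"
begin

lemma atlas_chart: "c \<in> A \<Longrightarrow> c \<in> charts A"
  using rs by (auto simp: riemann_surface_def charts_def)

lemma ex_atlas_chart: obtains c where "c \<in> A" "p \<in> fst c"
proof -
  have "p \<in> (\<Union>c\<in>A. fst c)" using rs unfolding riemann_surface_def by simp
  then show ?thesis using that by blast
qed

lemma ex_chart: obtains c where "c \<in> charts A" "p \<in> fst c"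
  using ex_atlas_chart atlas_chart by metis

text \<open>Charts of the maximal atlas are compatible with \<open>A\<close> by definition, but not
  with each other; near each point the transition is factored through a chart of
  \<open>A\<close>.\<close>

lemma transition_holomorphic:
  assumes c: "c \<in> charts A" and d: "d \<in> charts A"
  shows "transition c d holomorphic_on img c (fst d)"
  unfolding holomorphic_on_open[OF open_img[OF charts_is_chart[OF c] is_chart_homeo(1)[OF charts_is_chart[OF d]]]]
proof
  fix z assume "z \<in> img c (fst d)"
  then obtain p where p: "p \<in> fst c" "p \<in> fst d" "z = snd c p" by (rule imgE)
  obtain e where e: "e \<in> A" "p \<in> fst e" by (rule ex_atlas_chart)
  have ic: "is_chart c" "is_chart d" "is_chart e" using c d e atlas_chart charts_is_chart by blast+
  have ce: "transition c e holomorphic_on img c (fst e)" and ed: "transition e d holomorphic_on img e (fst d)"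
    using c d e by (auto simp: charts_def compatible_def)
  have o: "open (img c (fst e))" "open (img e (fst d))" "open (img c (fst d \<inter> fst e))"
    using ic by (auto intro!: open_img is_chart_homeo(1) open_Int)
  have z: "z \<in> img c (fst e)" "z \<in> img c (fst d \<inter> fst e)" "transition c e z \<in> img e (fst d)"
    using p e ic by (auto simp: transition_eq intro: imgI)
  have "((\<lambda>x. transition e d (transition c e x)) has_field_derivative
      deriv (transition e d) (transition c e z) * deriv (transition c e) z) (at z)"
    by (rule DERIV_chain2[OF holomorphic_derivI[OF ed o(2) z(3)] holomorphic_derivI[OF ce o(1) z(1)]])
  then have "(transition c d has_field_derivative
      deriv (transition e d) (transition c e z) * deriv (transition c e) z) (at z)"
    by (rule has_field_derivative_transform_within_open[OF _ o(3) z(2)])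
       (use ic in \<open>auto elim!: imgE simp: transition_eq\<close>)
  then show "\<exists>f'. (transition c d has_field_derivative f') (at z)" by blast
qed

lemma open_overlap: "c \<in> charts A \<Longrightarrow> d \<in> charts A \<Longrightarrow> open S \<Longrightarrow> open (img c (fst d \<inter> S))"
  by (intro open_img open_Int charts_is_chart is_chart_homeo(1))

lemma transition_DERIV:
  assumes c: "c \<in> charts A" and d: "d \<in> charts A" and z: "z \<in> img c (fst d)"
  shows "(transition c d has_field_derivative deriv (transition c d) z) (at z)"
  by (rule holomorphic_derivI[OF transition_holomorphic[OF c d] _ z])
     (intro open_img charts_is_chart[OF c] is_chart_homeo(1)[OF charts_is_chart[OF d]])

lemma transition_deriv_nonzero:
  assumes c: "c \<in> charts A" and d: "d \<in> charts A" and z: "z \<in> img c (fst d)"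
  shows "deriv (transition c d) z \<noteq> 0"
proof
  assume 0: "deriv (transition c d) z = 0"
  have ic: "is_chart c" "is_chart d" using c d charts_is_chart by blast+
  have tz: "transition c d z \<in> img d (fst c)" using transition_img[OF ic(1), of z d UNIV] z by simp
  have "((\<lambda>x. transition d c (transition c d x)) has_field_derivative
      deriv (transition d c) (transition c d z) * deriv (transition c d) z) (at z)"
    by (rule DERIV_chain2[OF transition_DERIV[OF d c tz] transition_DERIV[OF c d z]])
  then have "((\<lambda>x. x) has_field_derivative deriv (transition d c) (transition c d z) * deriv (transition c d) z) (at z)"
    by (rule has_field_derivative_transform_within_open[OF _ open_img[OF ic(1) is_chart_homeo(1)[OF ic(2)]] z])
       (use ic transition_inverse in blast)
  from DERIV_unique[OF this DERIV_ident] 0 show False by simp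
qed

end

section \<open>Existence and uniqueness\<close>

text \<open>|\<Xi>| scales by |t|^3 and sqrt H by |t|, so the quotient scales by |t|^2, as a metric
  coefficient must.\<close>

lemma sk_factor_transform:
  assumes "H x = H' y * (norm t)\<^sup>2" "\<Xi> x = \<Xi>' y * t ^ 3" "t \<noteq> 0" "H' y > 0"
  shows "sk_factor H \<Xi> x = sk_factor H' \<Xi>' y * (norm t)\<^sup>2"
proof -
  have "sqrt (H x) = sqrt (H' y) * norm t" using assms by (simp add: real_sqrt_mult)
  then show ?thesis using assms
    by (simp add: sk_factor_def norm_mult norm_power field_simps power2_eq_square power3_eq_cube)
qed

text \<open>Differentiating the law for \<open>g\<close> logarithmically, the factor |t'|^2
  contributes t'' / t', which is the inhomogeneous term of a connection; its antiholomorphic half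
  contributes nothing. The coefficient \<open>Q\<close> transforms as a tensor.\<close>

lemma sk_connection_transform:
  assumes 1: "sk_data U H \<Xi>" and 2: "sk_data U' H' \<Xi>'" and V: "open V" "V \<subseteq> U" "z \<in> V"
    and t: "t holomorphic_on V" "t ` V \<subseteq> U'" "\<And>x. x \<in> V \<Longrightarrow> deriv t x \<noteq> 0"
    and H: "\<And>x. x \<in> V \<Longrightarrow> H x = H' (t x) * (norm (deriv t x))\<^sup>2"
    and \<Xi>: "\<And>x. x \<in> V \<Longrightarrow> \<Xi> x = \<Xi>' (t x) * deriv t x ^ 3"
  shows "deriv t z * sk_connection H \<Xi> z u v =
     deriv (deriv t) z * u * v + sk_connection H' \<Xi>' (t z) (deriv t z * u) (deriv t z * v)"
proof -
  interpret c: sk_data U H \<Xi> by (rule 1)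
  interpret d: sk_data U' H' \<Xi>' by (rule 2)
  have tz: "t z \<in> U'" "z \<in> U" using V t by auto
  let ?t = "deriv t z"
  have t0: "?t \<noteq> 0" using t(3) V by blast
  have gp: "d.g (t z) > 0" "complex_of_real (d.g (t z)) \<noteq> 0" using d.g_pos[OF tz(1)] by auto
  have g: "c.g x = d.g (t x) * (norm (deriv t x))\<^sup>2" if "x \<in> V" for x
    using sk_factor_transform[of H x H' "t x" "deriv t x" \<Xi> \<Xi>', OF H[OF that] \<Xi>[OF that] t(3)[OF that]]
      d.H_pos t(2) that by blast
  have g': "complex_of_real (c.g x) = of_real (d.g (t x)) * (deriv t x * cnj (deriv t x))" if "x \<in> V" for x
    unfolding g[OF that] by (simp only: of_real_mult complex_norm_square)
  have D: "(t has_field_derivative ?t) (at z)" "(deriv t has_field_derivative deriv (deriv t) z) (at z)"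
    using V t(1) by (auto intro: holomorphic_derivI holomorphic_deriv)
  have "wirt (\<lambda>x. of_real (c.g x)) z
     (d.P (t z) * d.g (t z) * ?t * (?t * cnj ?t) + of_real (d.g (t z)) * (deriv (deriv t) z * cnj ?t))
     (cnj (d.P (t z)) * d.g (t z) * cnj ?t * (?t * cnj ?t) + of_real (d.g (t z)) * (?t * cnj (deriv (deriv t) z)))"
    using wirt_cong_open[OF wirt_mult[OF wirt_compose_field[OF d.wirt_g[OF tz(1)] D(1)]
          wirt_mult[OF wirt_field[OF D(2)] wirt_cnj[OF wirt_field[OF D(2)]]]] V(1,3), of "\<lambda>x. of_real (c.g x)"] g'
    by simp
  from wirt_unique[OF c.wirt_g[OF tz(2)] this]
  have "c.P z * (of_real (d.g (t z)) * (?t * cnj ?t)) =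
      d.P (t z) * d.g (t z) * ?t * (?t * cnj ?t) + of_real (d.g (t z)) * (deriv (deriv t) z * cnj ?t)"
    unfolding g'[OF V(3)] by blast
  then have "(of_real (d.g (t z)) * cnj ?t) * (?t * c.P z) = (of_real (d.g (t z)) * cnj ?t) * (?t * ?t * d.P (t z) + deriv (deriv t) z)"
    by (simp add: algebra_simps)
  moreover have "of_real (d.g (t z)) * cnj ?t \<noteq> 0" using gp t0 by simp
  ultimately have P: "?t * c.P z = ?t * ?t * d.P (t z) + deriv (deriv t) z" by (simp only: mult_cancel_left) simp
  have Q: "?t * c.Q z = cnj ?t * cnj ?t * d.Q (t z)"
    unfolding sk_anti_def g'[OF V(3)] \<Xi>[OF V(3)] using gp t0 by (simp add: field_simps power3_eq_cube)
  have "?t * sk_connection H \<Xi> z u v = (?t * c.P z) * (u * v) + (?t * c.Q z) * cnj (u * v)"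
    by (simp add: sk_connection_def algebra_simps)
  also have "\<dots> = deriv (deriv t) z * u * v + sk_connection H' \<Xi>' (t z) (?t * u) (?t * v)"
    unfolding P Q by (simp add: sk_connection_def algebra_simps)
  finally show ?thesis .
qed

locale hyperbolic_cubic = surface A for A :: "'a::t2_space chart set" +
  fixes S :: "'a set" and h :: "'a metric" and \<Xi> :: "'a cubic"
  assumes hyp: "hyperbolic_metric A S h" and cub: "holomorphic_cubic A S \<Xi>"
    and nz: "\<And>c z. c \<in> charts A \<Longrightarrow> z \<in> img c S \<Longrightarrow> \<Xi> c z \<noteq> 0"
begin

definition H :: "'a chart \<Rightarrow> complex \<Rightarrow> real" where "H c z = h c z 1 1"
definition g :: "'a metric" where "g c = conf (sk_factor (H c) (\<Xi> c))"
definition \<Gamma> :: "'a connection" where "\<Gamma> c = sk_connection (H c) (\<Xi> c)"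

lemma open_S: "open S" using hyp by (simp add: hyperbolic_metric_def)

lemma h_hermitian: "c \<in> charts A \<Longrightarrow> is_hermitian_metric (img c S) (h c)"
  using hyp by (simp add: hyperbolic_metric_def)

lemma h_conf: "c \<in> charts A \<Longrightarrow> z \<in> img c S \<Longrightarrow> h c z = conf (H c) z"
  using hermitian_metric_conf(1)[OF h_hermitian] by (simp add: H_def[abs_def])

lemma sk: assumes c: "c \<in> charts A" shows "sk_data (img c S) (H c) (\<Xi> c)"
proof
  show o: "open (img c S)" using c charts_is_chart open_S open_img by blast
  show "smooth_on (img c S) (H c)" using hermitian_metric_smooth[OF h_hermitian[OF c]] by (simp add: H_def[abs_def])
  show "H c z > 0" if "z \<in> img c S" for z using hermitian_metric_conf(2)[OF h_hermitian[OF c] that] by (simp add: H_def)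
  show "\<Xi> c holomorphic_on img c S" using cub c by (simp add: holomorphic_cubic_def)
  show "\<Xi> c z \<noteq> 0" if "z \<in> img c S" for z using nz c that by blast
  show "dzb (log_dz (H c)) z = of_real (H c z) / 2" if "z \<in> img c S" for z
    using hyperbolic_liouville[OF o h_hermitian[OF c] _ that] hyp c by (simp add: hyperbolic_metric_def H_def[abs_def])
qed

lemma H_law:
  assumes c: "c \<in> charts A" and d: "d \<in> charts A" and z: "z \<in> img c (fst d \<inter> S)"
  shows "H c z = H d (transition c d z) * (norm (deriv (transition c d) z))\<^sup>2"
proof -
  have "transition c d z \<in> img d S"
    using transition_img[OF charts_is_chart[OF c] z] img_mono[of "fst c \<inter> S" S d] by blast
  moreover have "h c z 1 1 = pullback_metric (transition c d) (h d) z 1 1"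
    using hyp c d z unfolding hyperbolic_metric_def metric_law_def by blast
  ultimately show ?thesis
    using h_conf[OF d] by (simp add: H_def[of c] pullback_metric_def conf_def dot_square_norm)
qed

lemma \<Xi>_law:
  assumes "c \<in> charts A" "d \<in> charts A" "z \<in> img c (fst d \<inter> S)"
  shows "\<Xi> c z = \<Xi> d (transition c d z) * deriv (transition c d) z ^ 3"
  using cub assms unfolding holomorphic_cubic_def cubic_law_def by blast

lemma special_kaehler_g_\<Gamma>: "special_kaehler A S g \<Gamma>"
  unfolding special_kaehler_def
proof (intro conjI ballI)
  show "open S" by (rule open_S)
  show "is_special_kaehler (img c S) (g c) (\<Gamma> c)" if "c \<in> charts A" for c
    using sk_data.is_special_kaehler_\<Gamma>[OF sk[OF that]] by (simp add: g_def \<Gamma>_def)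
  have tr: "transition c d z \<in> img d S" if "c \<in> charts A" "z \<in> img c (fst d \<inter> S)" for c d z
    using transition_img[OF charts_is_chart[OF that(1)] that(2)] img_mono[of "fst c \<inter> S" S d] by blast
  have nz': "deriv (transition c d) z \<noteq> 0" if "c \<in> charts A" "d \<in> charts A" "z \<in> img c (fst d \<inter> S)" for c d z
    using transition_deriv_nonzero[OF that(1,2)] that(3) img_mono[of "fst d \<inter> S" "fst d" c] by blast
  show "metric_law A S g"
    unfolding metric_law_def
  proof (intro ballI allI)
    fix c d z u v assume c: "c \<in> charts A" and d: "d \<in> charts A" and z: "z \<in> img c (fst d \<inter> S)"
    have "H d (transition c d z) > 0" using sk_data.H_pos[OF sk[OF d]] tr[OF c z] by blast
    from sk_factor_transform[of "H c" z "H d" _ _ "\<Xi> c" "\<Xi> d", OF H_law[OF c d z] \<Xi>_law[OF c d z] nz'[OF c d z] this]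
    show "g c z u v = pullback_metric (transition c d) (g d) z u v"
      by (simp add: g_def conf_def pullback_metric_def complex_mult_inner)
  qed
  show "connection_law A S \<Gamma>"
    unfolding connection_law_def Let_def
  proof (intro ballI allI)
    fix c d z u v assume c: "c \<in> charts A" and d: "d \<in> charts A" and z: "z \<in> img c (fst d \<inter> S)"
    show "deriv (transition c d) z * \<Gamma> c z u v = deriv (deriv (transition c d)) z * u * v +
       \<Gamma> d (transition c d z) (deriv (transition c d) z * u) (deriv (transition c d) z * v)"
      unfolding \<Gamma>_def
    proof (rule sk_connection_transform[OF sk[OF c] sk[OF d] open_overlap[OF c d open_S] _ z])
      show "transition c d holomorphic_on img c (fst d \<inter> S)"
        by (rule holomorphic_on_subset[OF transition_holomorphic[OF c d] img_mono]) blast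
      show "img c (fst d \<inter> S) \<subseteq> img c S" by (rule img_mono) blast
      show "transition c d ` img c (fst d \<inter> S) \<subseteq> img d S" using tr[OF c] by blast
    qed (use H_law[OF c d] \<Xi>_law[OF c d] nz'[OF c d] in blast)+
  qed
qed

lemma exists_conjugate:
  assumes "c \<in> charts A" "z \<in> img c S"
  shows "\<exists>V Z W. open V \<and> z \<in> V \<and> V \<subseteq> img c S \<and> conjugate_coordinates V (g c) (\<Gamma> c) Z W"
  using sk_data.exists_conjugate_coordinates[OF sk[OF assms(1)] assms(2)] unfolding g_def \<Gamma>_def by metis

lemma special_kaehler_with_g_\<Gamma>: "special_kaehler_with A S h \<Xi> g \<Gamma>"
  unfolding special_kaehler_with_def associated_hyperbolic_metric_def associated_cubic_form_def
proof (intro conjI ballI allI impI special_kaehler_g_\<Gamma> exists_conjugate)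
  fix c z V Z W
  assume c: "c \<in> charts A" and z: "z \<in> img c S"
    and "open V \<and> z \<in> V \<and> V \<subseteq> img c S \<and> conjugate_coordinates V (g c) (\<Gamma> c) Z W"
  then have V: "open V" "V \<subseteq> img c S" "z \<in> V"
    and cc: "conjugate_coordinates V (conf (sk_factor (H c) (\<Xi> c))) (sk_connection (H c) (\<Xi> c)) Z W"
    by (auto simp: g_def \<Gamma>_def)
  note a = sk_data.associated[OF sk[OF c] V cc]
  show "h c z = pullback_metric (period_map Z W) upper_half_plane_metric z"
    using a(1) h_conf[OF c z] by simp
  show "\<Xi> c z = period_cubic Z W z" by (rule a(2))
qed

lemma structure_unique:
  assumes sk': "special_kaehler_with A S h \<Xi> g' \<Gamma>'" and c: "c \<in> charts A" and z: "z \<in> img c S"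
  shows "g' c z = g c z" "\<Gamma>' c z = \<Gamma> c z"
proof -
  have s: "is_special_kaehler (img c S) (g' c) (\<Gamma>' c)"
    using sk' c by (simp add: special_kaehler_with_def special_kaehler_def)
  obtain V Z W where V: "open V" "z \<in> V" "V \<subseteq> img c S" and cc: "conjugate_coordinates V (g' c) (\<Gamma>' c) Z W"
    using sk' c z unfolding special_kaehler_with_def associated_hyperbolic_metric_def by blast
  have "conf (H c) w = pullback_metric (period_map Z W) upper_half_plane_metric w" if w: "w \<in> V" for w
  proof -
    have wS: "w \<in> img c S" using w V by blast
    have "h c w = pullback_metric (period_map Z W) upper_half_plane_metric w"
      using sk' c wS V cc w unfolding special_kaehler_with_def associated_hyperbolic_metric_def by blast
    then show ?thesis using h_conf[OF c wS] by simp
  qed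
  moreover have "\<Xi> c w = period_cubic Z W w" if w: "w \<in> V" for w
  proof -
    have wS: "w \<in> img c S" using w V by blast
    show ?thesis using sk' c wS V cc w unfolding special_kaehler_with_def associated_cubic_form_def by blast
  qed
  ultimately show "g' c z = g c z" "\<Gamma>' c z = \<Gamma> c z"
    using sk_data.determined[OF sk[OF c] s z V cc] by (auto simp: g_def \<Gamma>_def)
qed

end

lemma metric_law_subset: "metric_law A S g \<Longrightarrow> T \<subseteq> S \<Longrightarrow> metric_law A T g"
  unfolding metric_law_def by (meson Int_mono img_mono subsetD subset_refl)

lemma cubic_law_subset: "cubic_law A S \<Xi> \<Longrightarrow> T \<subseteq> S \<Longrightarrow> cubic_law A T \<Xi>"
  unfolding cubic_law_def by (meson Int_mono img_mono subsetD subset_refl)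

lemma is_hermitian_metric_subset: "is_hermitian_metric U G \<Longrightarrow> V \<subseteq> U \<Longrightarrow> is_hermitian_metric V G"
  unfolding is_hermitian_metric_def by (meson smooth_on_subset subsetD)

text \<open>The conditions on a Levi-Civita connection quantify over fields smooth on the domain,
  and a field on \<open>V\<close> need not extend to \<open>U\<close>, so they do not restrict
  formally. They are rechecked on \<open>V\<close> from the explicit formula for the
  connection.\<close>

lemma has_gaussian_curvature_subset:
  assumes U: "open U" and V: "open V" "V \<subseteq> U" and h: "is_hermitian_metric U G" and K: "has_gaussian_curvature U G K"
  shows "has_gaussian_curvature V G K"
proof -
  obtain \<Gamma> where lc: "is_levi_civita U G \<Gamma>" and
    curv: "\<And>z u v. z \<in> U \<Longrightarrow> G z (curvature \<Gamma> (\<lambda>_. u) (\<lambda>_. v) (\<lambda>_. v) z) u = K z * (G z u u * G z v v - (G z u v)\<^sup>2)"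
    using K unfolding has_gaussian_curvature_def by blast
  define w where "w z = G z 1 1" for z
  have G: "G z u v = w z * (u \<bullet> v)" "w z > 0" if "z \<in> U" for z u v
    using hermitian_metric_conf[OF h that] unfolding w_def by (metis conf_def)+
  have sw: "smooth_on U w" using hermitian_metric_smooth[OF h] by (simp add: w_def[abs_def])
  have \<Gamma>: "\<Gamma> z x y = log_dz w z * (x * y)" if "z \<in> U" for z x y
    using levi_civita_conf[OF U h lc that] by (simp add: w_def[abs_def])
  have "is_connection V \<Gamma>"
    using lc V smooth_on_subset unfolding is_levi_civita_def is_connection_def by (meson subsetD)
  moreover have "torsion_free_on V \<Gamma>"
    unfolding torsion_free_on_def using \<Gamma> V by (auto simp: cov_def lie_bracket_def mult.commute)
  moreover have "parallel_bilinear_on V \<Gamma> G"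
    unfolding parallel_bilinear_on_def
  proof (intro allI impI ballI, elim conjE)
    fix X Y Z :: vfield and z assume s: "smooth_on V X" "smooth_on V Y" "smooth_on V Z" and z: "z \<in> V"
    then have zU: "z \<in> U" using V by blast
    have sf: "G x u v = Re (of_real (w x) * (u * cnj v))" if "x \<in> U" for x u v
      by (simp add: G[OF that] inner_complex_def algebra_simps)
    have ww: "wirt (\<lambda>x. of_real (w x)) z (log_dz w z * w z) (cnj (log_dz w z) * w z)"
      using wirt_log_dz smooth_on_differentiable[OF sw zU] G(2)[OF zU] by force
    note wY = smooth_on_wirt[OF s(2) z] and wZ = smooth_on_wirt[OF s(3) z]
    have c: "cov \<Gamma> X Y z = dz Y z * X z + dzb Y z * cnj (X z) + log_dz w z * (X z * Y z)"
      if "smooth_on V Y" for Y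
      by (simp add: cov_def dir_deriv_wirt[OF smooth_on_wirt[OF that z]] \<Gamma>[OF zU])
    have "dir_deriv (\<lambda>x. G x (Y x) (Z x)) X z = dir_deriv (\<lambda>x. Re (of_real (w x) * (Y x * cnj (Z x)))) X z"
      unfolding dir_deriv_def by (subst frechet_derivative_cong_open[OF V(1) z]) (use sf V in auto)
    then show "dir_deriv (\<lambda>x. G x (Y x) (Z x)) X z = G z (cov \<Gamma> X Y z) (Z z) + G z (Y z) (cov \<Gamma> X Z z)"
      unfolding dir_deriv_Re_wirt[OF wirt_mult[OF ww wirt_mult[OF wY wirt_cnj[OF wZ]]]] c[OF s(2)] c[OF s(3)] sf[OF zU]
      by (simp add: algebra_simps)
  qed
  ultimately have "is_levi_civita V G \<Gamma>" by (simp add: is_levi_civita_def)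
  then show ?thesis unfolding has_gaussian_curvature_def using curv V by blast
qed

lemma (in surface) hyperbolic_metric_subset:
  assumes h: "hyperbolic_metric A S h" and T: "open T" "T \<subseteq> S"
  shows "hyperbolic_metric A T h"
  unfolding hyperbolic_metric_def
proof (intro conjI ballI T)
  show "metric_law A T h" using h T metric_law_subset unfolding hyperbolic_metric_def by blast
  fix c assume c: "c \<in> charts A"
  have hh: "is_hermitian_metric (img c S) (h c)" "has_gaussian_curvature (img c S) (h c) (\<lambda>_. - 1)" "open S"
    using h c by (auto simp: hyperbolic_metric_def)
  show "is_hermitian_metric (img c T) (h c)" using is_hermitian_metric_subset[OF hh(1) img_mono[OF T(2)]] .
  show "has_gaussian_curvature (img c T) (h c) (\<lambda>_. - 1)"
    by (rule has_gaussian_curvature_subset[OF _ _ img_mono[OF T(2)] hh(1,2)])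
       (use c hh(3) T(1) in \<open>auto intro!: open_img charts_is_chart\<close>)
qed

lemma (in surface) hyperbolic_cubic_off_zeros:
  assumes cub: "holomorphic_cubic A S \<Xi>" and hyp: "hyperbolic_metric A S h"
  shows "hyperbolic_cubic A (S - cubic_zeros A S \<Xi>) h \<Xi>"
proof -
  let ?T = "S - cubic_zeros A S \<Xi>"
  have S: "open S" using cub by (simp add: holomorphic_cubic_def)
  have nz: "\<Xi> c z \<noteq> 0" if "c \<in> charts A" "z \<in> img c ?T" for c z
    using that by (auto simp: cubic_zeros_def elim!: imgE)
  have law: "\<Xi> c z = \<Xi> d (transition c d z) * deriv (transition c d) z ^ 3"
    if "c \<in> charts A" "d \<in> charts A" "z \<in> img c (fst d \<inter> S)" for c d z
    using cub that unfolding holomorphic_cubic_def cubic_law_def by blast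
  have T: "open ?T"
  proof (rule topological_space_class.openI)
    fix p assume p: "p \<in> ?T"
    obtain c where c: "c \<in> charts A" "p \<in> fst c" by (rule ex_chart)
    note cc = is_chart_homeo[OF charts_is_chart[OF c(1)]]
    have hol: "\<Xi> c holomorphic_on img c S" using cub c by (simp add: holomorphic_cubic_def)
    have "continuous_on (fst c \<inter> S) (\<lambda>q. \<Xi> c (snd c q))"
      by (rule continuous_on_compose2[OF holomorphic_on_imp_continuous_on[OF hol] continuous_on_subset[OF cc(4)]])
        (auto simp: img_def)
    then have "open ((\<lambda>q. \<Xi> c (snd c q)) -` (- {0}) \<inter> (fst c \<inter> S))"
      using continuous_on_open_vimage[OF open_Int[OF cc(1) S]] open_Compl[OF closed_singleton[of 0]] by blast
    moreover have "p \<in> (\<lambda>q. \<Xi> c (snd c q)) -` (- {0}) \<inter> (fst c \<inter> S)"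
      using p c nz[OF c(1) imgI[of p c ?T]] by auto
    moreover have "(\<lambda>q. \<Xi> c (snd c q)) -` (- {0}) \<inter> (fst c \<inter> S) \<subseteq> ?T"
    proof
      fix q assume q: "q \<in> (\<lambda>q. \<Xi> c (snd c q)) -` (- {0}) \<inter> (fst c \<inter> S)"
      \<comment> \<open>\<open>cubic_zeros\<close> asks for a zero in some chart, so nonvanishing
        has to be carried from \<open>c\<close> to every chart \<open>d\<close> by the
        transformation law.\<close>
      have "\<Xi> d (snd d q) \<noteq> 0" if d: "d \<in> charts A" "q \<in> fst d" for d
        using law[OF c(1) d(1) imgI[of q c "fst d \<inter> S"]] q d by (auto simp: transition_eq charts_is_chart[OF c(1)])
      then show "q \<in> ?T" using q by (auto simp: cubic_zeros_def)
    qed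
    ultimately show "\<exists>O'. open O' \<and> p \<in> O' \<and> O' \<subseteq> ?T" by blast
  qed
  show ?thesis
  proof
    show "hyperbolic_metric A ?T h" by (rule hyperbolic_metric_subset[OF hyp T]) blast
    show "holomorphic_cubic A ?T \<Xi>"
      using cub T cubic_law_subset[of A S \<Xi> ?T] holomorphic_on_subset[OF _ img_mono[of ?T S]]
      by (auto simp: holomorphic_cubic_def)
  qed (rule nz)
qed

section \<open>Asymptotics of the local structure\<close>

lemma norm_at_right_0: "filterlim (norm :: complex \<Rightarrow> real) (at_right 0) (at 0)"
  unfolding filterlim_at
  by (auto intro!: tendsto_norm_zero tendsto_ident_at simp: eventually_at intro: exI[of _ 1])

lemma ln_norm_at_bot: "filterlim (\<lambda>z::complex. ln (norm z)) at_bot (at 0)"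
  by (rule filterlim_compose[OF ln_at_0 norm_at_right_0])

lemma norm_ln_norm_tendsto: "((\<lambda>z::complex. norm z * ln (norm z)) \<longlongrightarrow> 0) (at 0)"
proof -
  have "((\<lambda>x::real. - (ln (inverse x) / inverse x)) \<longlongrightarrow> - 0) (at_right 0)"
    by (intro tendsto_minus filterlim_compose[OF ln_x_over_x_tendsto_0 filterlim_inverse_at_top_right])
  then have "((\<lambda>x::real. - (ln (inverse x) / inverse x)) \<longlongrightarrow> 0) (at_right 0)" by simp
  moreover have "\<forall>\<^sub>F x in at_right 0. - (ln (inverse x) / inverse x) = x * ln (x::real)"
    using eventually_at_right_less[of 0] by eventually_elim (simp add: ln_inverse divide_inverse)
  ultimately have "((\<lambda>x::real. x * ln x) \<longlongrightarrow> 0) (at_right 0)"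
    by (rule Lim_transform_eventually)
  from filterlim_compose[OF this norm_at_right_0] show ?thesis .
qed

section \<open>The model connections and the error estimate in complex notation\<close>

text \<open>The two matrices are multiplication by 1 and by \<i>, so they combine with d\<rho> and
  d\<theta> to multiplication by dz / z.\<close>

lemma conical_connection_eq: "conical_connection \<beta> z \<xi> v = of_real (\<beta> / 2) * (\<xi> / z * v)"
proof -
  have "c *\<^sub>R (Re x *\<^sub>R mat2 1 0 0 1 v + Im x *\<^sub>R mat2 0 (-1) 1 0 v) = of_real c * (x * v)" for c x
    by (simp add: mat2_def complex_eq_iff algebra_simps)
  then show ?thesis unfolding conical_connection_def drho_def dtheta_def by blast
qed

text \<open>The matrices with R and J split into a linear and an antilinear map. This exhibits the
  two coefficients that \<open>P\<close> and \<open>Q\<close> have to match.\<close>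

lemma log_connection_eq:
  "log_connection k b z \<xi> v =
    ((of_int k + 1 / of_real (ln (norm z))) * (\<xi> / z * v)
     - cnj (b / of_real (norm b) * cis (of_int k * Arg z)) * cnj (\<xi> / z * v) / of_real (ln (norm z))) / 2"
proof -
  have gen: "(Im x / 2) *\<^sub>R (l *\<^sub>R mat2 0 (-1) 1 0 v + c *\<^sub>R mat2 (Im e) (-1 + Re e) (1 + Re e) (- Im e) v) +
     (Re x / 2) *\<^sub>R (l *\<^sub>R mat2 1 0 0 1 v + c *\<^sub>R mat2 (1 - Re e) (Im e) (Im e) (1 + Re e) v)
     = ((of_real l + of_real c) * (x * v) - of_real c * (cnj e * cnj (x * v))) / 2" for x e l c
    by (simp add: mat2_def complex_eq_iff) (simp add: field_simps)
  show ?thesis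
    unfolding log_connection_def Let_def drho_def dtheta_def gen
    by (simp only: of_real_of_int_eq of_real_divide of_real_1 times_divide_eq_left mult_1_left)
qed

lemma tendsto_imp_asymptotic_metric:
  assumes "C > 0" "((\<lambda>z. f z / w z) \<longlongrightarrow> C) (at 0)" shows "asymptotic_metric (conf f) w"
  unfolding asymptotic_metric_def conf_def
proof (intro exI[of _ C] conjI allI)
  show "((\<lambda>z. f z * (u \<bullet> v) / w z) \<longlongrightarrow> C * (u \<bullet> v)) (at 0)" for u v
    using tendsto_mult_right[OF assms(2), of "u \<bullet> v"] by simp
qed fact

lemma asymptotic_metric_cong:
  assumes "asymptotic_metric G w" "\<forall>\<^sub>F z in at 0. G z = G' z" shows "asymptotic_metric G' w"
proof -
  obtain C where C: "C > 0" "\<And>u v. ((\<lambda>z. G z u v / w z) \<longlongrightarrow> C * (u \<bullet> v)) (at 0)"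
    using assms(1) unfolding asymptotic_metric_def by blast
  have "((\<lambda>z. G' z u v / w z) \<longlongrightarrow> C * (u \<bullet> v)) (at 0)" for u v
    by (rule Lim_transform_eventually[OF C(2)]) (use assms(2) in eventually_elim, simp)
  then show ?thesis unfolding asymptotic_metric_def using C(1) by blast
qed

lemma asymptotic_connection_cong:
  assumes "asymptotic_connection G G0 w" "\<forall>\<^sub>F z in at 0. G z = G' z" shows "asymptotic_connection G' G0 w"
  unfolding asymptotic_connection_def
proof (intro allI)
  fix \<xi> v
  have "\<forall>\<^sub>F z in at 0. norm (G' z \<xi> v - G0 z \<xi> v) = norm (G z \<xi> v - G0 z \<xi> v)"
    using assms(2) by eventually_elim simp
  from landau_o.small.in_cong[OF this] show "(\<lambda>z. norm (G' z \<xi> v - G0 z \<xi> v)) \<in> o[at 0](w)"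
    using assms(1) by (auto simp: asymptotic_connection_def)
qed

text \<open>The two bounds are the linear and the antilinear part of the difference of the connections.\<close>

lemma asymptotic_connectionI:
  assumes w: "\<forall>\<^sub>F z in at 0. w z > 0"
    and eq: "\<And>\<xi> v. \<forall>\<^sub>F z in at 0. norm (\<Gamma> z \<xi> v - \<Gamma>0 z \<xi> v) \<le> w z * (norm (x z) * norm (\<xi> * v) + norm (y z) * norm (\<xi> * v))"
    and x: "(x \<longlongrightarrow> 0) (at 0)" and y: "(y \<longlongrightarrow> 0) (at 0)"
  shows "asymptotic_connection \<Gamma> \<Gamma>0 w"
  unfolding asymptotic_connection_def
proof (intro allI smalloI_tendsto)
  fix \<xi> v :: complex
  have "((\<lambda>z. norm (x z) * norm (\<xi> * v) + norm (y z) * norm (\<xi> * v)) \<longlongrightarrow> 0 * norm (\<xi> * v) + 0 * norm (\<xi> * v)) (at 0)"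
    by (intro tendsto_intros tendsto_norm_zero x y)
  then have l: "((\<lambda>z. norm (x z) * norm (\<xi> * v) + norm (y z) * norm (\<xi> * v)) \<longlongrightarrow> 0) (at 0)" by simp
  show "((\<lambda>z. norm (\<Gamma> z \<xi> v - \<Gamma>0 z \<xi> v) / w z) \<longlongrightarrow> 0) (at 0)"
  proof (rule Lim_null_comparison[OF _ l])
    show "\<forall>\<^sub>F z in at 0. norm (norm (\<Gamma> z \<xi> v - \<Gamma>0 z \<xi> v) / w z) \<le> norm (x z) * norm (\<xi> * v) + norm (y z) * norm (\<xi> * v)"
      using w eq[of \<xi> v] by eventually_elim (simp add: field_simps)
  qed
  show "\<forall>\<^sub>F z in at 0. w z \<noteq> 0" using w by eventually_elim simp
qed

text \<open>Identifies \<open>log_dz H\<close> with the derivative of ln H, which turns the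
  Liouville equation into a statement about a Laplacian.\<close>

lemma (in sk_data) lap_ln_H: "lap_on U (\<lambda>z. ln (H z)) (log_dz H) (\<lambda>z. 2 * H z)"
  unfolding lap_on_def
proof (intro ballI conjI)
  fix z assume z: "z \<in> U"
  have "smooth_on U (log_dz H)" using H_pos by (intro smooth_log_dz U smooth_H) force
  from smooth_on_wirt[OF this z] show "\<exists>q. wirt (log_dz H) z q (of_real (2 * H z) / 4)"
    unfolding liouville[OF z] by auto
  have "(H has_derivative frechet_derivative H (at z)) (at z)"
    using smooth_on_differentiable[OF smooth_H z] by (simp add: frechet_derivative_works)
  note dH = this
  from wirt_frechet[OF wirt_log_dz[OF smooth_on_differentiable[OF smooth_H z]]] H_pos[OF z]
  have "frechet_derivative (\<lambda>x. complex_of_real (H x)) (at z) = (\<lambda>\<xi>. log_dz H z * H z * \<xi> + cnj (log_dz H z) * H z * cnj \<xi>)" by simp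
  moreover have "frechet_derivative (\<lambda>x. complex_of_real (H x)) (at z) \<xi> = of_real (frechet_derivative H (at z) \<xi>)" for \<xi>
    by (rule frechet_derivative_bounded_linear[OF bounded_linear_of_real smooth_on_differentiable[OF smooth_H z]])
  ultimately have fd: "complex_of_real (frechet_derivative H (at z) \<xi>) = log_dz H z * H z * \<xi> + cnj (log_dz H z) * H z * cnj \<xi>" for \<xi>
    by metis
  have "((\<lambda>x. of_real (ln (H x))) has_derivative (\<lambda>\<xi>. complex_of_real (frechet_derivative H (at z) \<xi> * inverse (H z)))) (at z)"
    by (rule bounded_linear.has_derivative[OF bounded_linear_of_real has_derivative_ln[OF H_pos[OF z] dH]])
  then show "wirt (\<lambda>x. of_real (ln (H x))) z (log_dz H z) (cnj (log_dz H z))"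
    unfolding wirt_def
    by (rule has_derivative_eq_rhs) (use H_pos[OF z] in \<open>simp add: fun_eq_iff fd field_simps\<close>)
qed

section \<open>The structure near a point where the cubic form is a unit times z^n\<close>

text \<open>The bound r < 1 keeps ln |z| negative on the whole punctured disc.\<close>

locale sk_singularity = sk_data U H \<Xi> for U H \<Xi> +
  fixes n :: int and \<phi> :: "complex \<Rightarrow> complex" and r :: real
  assumes r: "r > 0" "r < 1" and rU: "ball 0 r - {0} \<subseteq> U"
    and \<phi>: "\<phi> holomorphic_on ball 0 r" "\<And>z. z \<in> ball 0 r \<Longrightarrow> \<phi> z \<noteq> 0"
    and \<Xi>_eq: "\<And>z. z \<in> ball 0 r - {0} \<Longrightarrow> \<Xi> z = \<phi> z * z powi n"
begin

lemma ev: "\<forall>\<^sub>F z in at 0. z \<in> ball 0 r - {0}"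
  using eventually_at_in_open[of "ball 0 r" 0] r by simp

lemma in_U: "z \<in> ball 0 r - {0} \<Longrightarrow> z \<in> U" using rU by blast

lemma punctured_liouville: "punctured_liouville r H (log_dz H)"
  using r(1) lap_on_subset[OF lap_ln_H rU] H_pos in_U by unfold_locales auto

lemma \<phi>_deriv: "z \<in> ball 0 r \<Longrightarrow> (\<phi> has_field_derivative deriv \<phi> z) (at z)"
  using \<phi>(1) by (auto intro: holomorphic_derivI)

lemma \<phi>_lim: "(\<phi> \<longlongrightarrow> \<phi> 0) (at 0)"
  using DERIV_isCont[OF \<phi>_deriv, of 0] r by (simp add: isCont_def)

lemma log_deriv_lim: "((\<lambda>z. deriv \<phi> z / \<phi> z) \<longlongrightarrow> deriv \<phi> 0 / \<phi> 0) (at 0)"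
proof -
  have "isCont (deriv \<phi>) 0"
    by (rule DERIV_isCont[OF holomorphic_derivI[OF holomorphic_deriv[OF \<phi>(1)]]]) (use r in auto)
  then show ?thesis using \<phi>_lim \<phi>(2)[of 0] r by (auto intro!: tendsto_divide simp: isCont_def)
qed

lemma \<Xi>_log_deriv: assumes z: "z \<in> ball 0 r - {0}" shows "z * (deriv \<Xi> z / \<Xi> z) = of_int n + z * (deriv \<phi> z / \<phi> z)"
proof -
  have z0: "z \<noteq> 0" "z \<in> ball 0 r" using z by auto
  have p: "z powi (n - 1) * z = z powi n" using power_int_minus_mult[of z n] z0 by simp
  have "((\<lambda>z. \<phi> z * z powi n) has_field_derivative (deriv \<phi> z * z powi n + \<phi> z * (of_int n * z powi (n - 1)))) (at z)"
    using z0 by (auto intro!: derivative_eq_intros \<phi>_deriv)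
  then have "(\<Xi> has_field_derivative (deriv \<phi> z * z powi n + \<phi> z * (of_int n * z powi (n - 1)))) (at z)"
    by (rule has_field_derivative_transform_within_open[where S="ball 0 r - {0}"]) (use z in \<open>auto simp: \<Xi>_eq\<close>)
  then have d: "deriv \<Xi> z = deriv \<phi> z * z powi n + \<phi> z * (of_int n * z powi (n - 1))" by (rule DERIV_imp_deriv)
  have "z powi n \<noteq> 0" using z0 by simp
  then show ?thesis
    unfolding d \<Xi>_eq[OF z] p[symmetric] using z0 \<phi>(2)[OF z0(2)] by (simp add: field_simps)
qed

lemma norm_\<Xi>: "z \<in> ball 0 r - {0} \<Longrightarrow> norm (\<Xi> z) = norm (\<phi> z) * norm z powr of_int n"
  using powr_real_of_int'[of "norm z" n] by (simp add: \<Xi>_eq norm_mult norm_power_int)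

lemma zP: assumes z: "z \<in> ball 0 r - {0}"
  shows "z * P z = (of_int n + z * (deriv \<phi> z / \<phi> z) - z * log_dz H z) / 2"
  unfolding P_eq[OF in_U[OF z]] \<Xi>_log_deriv[OF z, symmetric] by (simp add: field_simps)

text \<open>Polar decomposition of the antilinear coefficient: the modulus comes from
  \<open>H\<close>, the phase from \<Xi>. At a cusp the phase produces the parameter b of the
  model.\<close>

lemma Q_eq: assumes z: "z \<in> U" shows "Q z = - (\<i> / 2) * of_real (sqrt (H z)) * cnj (sgn (\<Xi> z))"
  using \<Xi>_nz[OF z] H_pos[OF z]
  by (simp add: sk_anti_def sk_factor_def sgn_div_norm scaleR_conv_of_real field_simps)

lemma zphi_lim: "((\<lambda>z. z * (deriv \<phi> z / \<phi> z)) \<longlongrightarrow> 0) (at 0)"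
  using tendsto_mult[OF tendsto_ident_at log_deriv_lim] by simp

context
  fixes \<alpha> C :: real
  assumes \<alpha>: "\<alpha> > - 1" and C: "C > 0" and lim: "((\<lambda>z. H z / norm z powr (2 * \<alpha>)) \<longlongrightarrow> C) (at 0)"
begin

lemma conical_metric: "asymptotic_metric (conf g) (\<lambda>z. norm z powr (of_int n - \<alpha>))"
proof (rule tendsto_imp_asymptotic_metric)
  show "4 * norm (\<phi> 0) / sqrt C > 0" using C \<phi>(2)[of 0] r by simp
  have "((\<lambda>z. 4 * norm (\<phi> z) / sqrt (H z / norm z powr (2 * \<alpha>))) \<longlongrightarrow> 4 * norm (\<phi> 0) / sqrt C) (at 0)"
    by (intro tendsto_intros \<phi>_lim lim) (use C in auto)
  moreover have "\<forall>\<^sub>F z in at 0. 4 * norm (\<phi> z) / sqrt (H z / norm z powr (2 * \<alpha>)) = g z / norm z powr (of_int n - \<alpha>)"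
    using ev
  proof eventually_elim
    case (elim z)
    have z: "norm z > 0" "H z > 0" using elim H_pos in_U by auto
    have "sqrt (norm z powr (2 * \<alpha>)) = norm z powr \<alpha>" using z by (simp add: powr_half_sqrt[symmetric] powr_powr)
    then show ?case using z by (simp add: sk_factor_def norm_\<Xi>[OF elim] real_sqrt_divide powr_diff)
  qed
  ultimately show "((\<lambda>z. g z / norm z powr (of_int n - \<alpha>)) \<longlongrightarrow> 4 * norm (\<phi> 0) / sqrt C) (at 0)"
    by (rule Lim_transform_eventually)
qed

text \<open>By \<open>zP\<close> the linear coefficient z P tends to (n - \<alpha>) / 2. The
  antilinear one has modulus r sqrt H / 2, of order r^(1 + \<alpha>), and therefore leaves no trace
  in the model.\<close>

lemma conical_connection_asymptotic:
  "asymptotic_connection \<Gamma> (conical_connection (of_int n - \<alpha>)) (\<lambda>z. 1 / norm z)"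
proof (rule asymptotic_connectionI)
  let ?x = "\<lambda>z. z * P z - of_real ((of_int n - \<alpha>) / 2)" and ?y = "\<lambda>z. cnj z * Q z"
  show "\<forall>\<^sub>F z::complex in at 0. 1 / norm z > 0" using ev by eventually_elim simp
  show "\<forall>\<^sub>F z in at 0. norm (\<Gamma> z \<xi> v - conical_connection (of_int n - \<alpha>) z \<xi> v)
      \<le> 1 / norm z * (norm (?x z) * norm (\<xi> * v) + norm (?y z) * norm (\<xi> * v))" for \<xi> v
    using ev
  proof eventually_elim
    case (elim z)
    have z: "z \<noteq> 0" using elim by simp
    have "\<Gamma> z \<xi> v - conical_connection (of_int n - \<alpha>) z \<xi> v = ?x z * (\<xi> * v) / z + ?y z * cnj (\<xi> * v) / cnj z"
      using z by (simp add: sk_connection_def conical_connection_eq field_simps)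
    also have "norm \<dots> \<le> norm (?x z * (\<xi> * v) / z) + norm (?y z * cnj (\<xi> * v) / cnj z)" by (rule norm_triangle_ineq)
    also have "\<dots> = 1 / norm z * (norm (?x z) * norm (\<xi> * v) + norm (?y z) * norm (\<xi> * v))"
      by (simp add: norm_mult norm_divide add_divide_distrib)
    finally show ?case .
  qed
  interpret pl: punctured_liouville r H "log_dz H" by (rule punctured_liouville)
  have "((\<lambda>z. (of_int n + z * (deriv \<phi> z / \<phi> z) - z * log_dz H z) / 2 - of_real ((of_int n - \<alpha>) / 2)) \<longlongrightarrow>
     (of_int n + 0 - of_real \<alpha>) / 2 - of_real ((of_int n - \<alpha>) / 2)) (at 0)"
    by (intro tendsto_intros zphi_lim pl.conical_asymptotics[OF \<alpha> C lim]) auto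
  then have "((\<lambda>z. (of_int n + z * (deriv \<phi> z / \<phi> z) - z * log_dz H z) / 2 - of_real ((of_int n - \<alpha>) / 2)) \<longlongrightarrow> 0) (at 0)"
    by simp
  then show "(?x \<longlongrightarrow> 0) (at 0)"
    by (rule Lim_transform_eventually) (use ev in eventually_elim, simp add: zP)
  have n: "((\<lambda>z::complex. norm z) \<longlongrightarrow> 0) (at 0)" by (rule tendsto_norm_zero[OF tendsto_ident_at])
  have "((\<lambda>z. norm z powr (1 + \<alpha>) * sqrt (H z / norm z powr (2 * \<alpha>)) / 2) \<longlongrightarrow> 0 * sqrt C / 2) (at (0::complex))"
    by (intro tendsto_intros lim tendsto_zero_powrI[OF n tendsto_const]) (use \<alpha> in auto)
  then have l: "((\<lambda>z. norm z powr (1 + \<alpha>) * sqrt (H z / norm z powr (2 * \<alpha>)) / 2) \<longlongrightarrow> 0) (at (0::complex))" by simp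
  show "(?y \<longlongrightarrow> 0) (at 0)"
  proof (rule Lim_null_comparison[OF _ l])
    show "\<forall>\<^sub>F z in at 0. norm (?y z) \<le> norm z powr (1 + \<alpha>) * sqrt (H z / norm z powr (2 * \<alpha>)) / 2"
      using ev
    proof eventually_elim
      case (elim z)
      have z: "norm z > 0" "H z > 0" "\<Xi> z \<noteq> 0" using elim H_pos \<Xi>_nz in_U by auto
      have "sqrt (norm z powr (2 * \<alpha>)) = norm z powr \<alpha>" using z by (simp add: powr_half_sqrt[symmetric] powr_powr)
      then have "norm z powr (1 + \<alpha>) * sqrt (H z / norm z powr (2 * \<alpha>)) / 2 = norm z * sqrt (H z) / 2"
        using z by (simp add: real_sqrt_divide powr_add)
      also have "\<dots> = norm (?y z)"
        using z by (simp add: Q_eq[OF in_U[OF elim]] norm_mult norm_divide norm_sgn)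
      finally show ?case by simp
    qed
  qed
qed

end

context
  fixes C :: real
  assumes C: "C > 0" and lim: "((\<lambda>z. H z * (norm z * ln (norm z))\<^sup>2) \<longlongrightarrow> C) (at 0)"
begin

lemma ln_norm_neg: "z \<in> ball 0 r - {0} \<Longrightarrow> ln (cmod z) < 0"
  using r by simp

lemma cusp_sqrt: assumes z: "z \<in> ball 0 r - {0}"
  shows "sqrt (H z * (norm z * ln (norm z))\<^sup>2) = - (sqrt (H z) * norm z * ln (norm z))"
  using ln_norm_neg[OF z] z H_pos[OF in_U[OF z]] by (simp add: real_sqrt_mult abs_mult)

text \<open>The limit is - sqrt C with \<open>cusp_constant\<close> inserted; the sign is that of ln
  |z|.\<close>

lemma cusp_sqrt_lim: "((\<lambda>z. sqrt (H z) * norm z * ln (norm z)) \<longlongrightarrow> - 1) (at 0)"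
proof -
  interpret pl: punctured_liouville r H "log_dz H" by (rule punctured_liouville)
  have "((\<lambda>z. - sqrt (H z * (norm z * ln (norm z))\<^sup>2)) \<longlongrightarrow> - sqrt 1) (at 0)"
    using lim unfolding pl.cusp_constant[OF C lim] by (intro tendsto_intros)
  then have "((\<lambda>z. - sqrt (H z * (norm z * ln (norm z))\<^sup>2)) \<longlongrightarrow> - 1) (at 0)" by simp
  then show ?thesis
    by (rule Lim_transform_eventually) (use ev in eventually_elim, simp add: cusp_sqrt)
qed

text \<open>sqrt H is asymptotic to 1 / (r |ln r|), so dividing |\<Xi>| by it raises the exponent
  \<open>n\<close> by one and brings in the logarithm.\<close>

lemma cusp_metric: "asymptotic_metric (conf g) (\<lambda>z. - (norm z powi (n + 1)) * ln (norm z))"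
proof (rule tendsto_imp_asymptotic_metric)
  show "4 * norm (\<phi> 0) > 0" using \<phi>(2)[of 0] r by simp
  have "((\<lambda>z. - (4 * norm (\<phi> z) / (sqrt (H z) * norm z * ln (norm z)))) \<longlongrightarrow> - (4 * norm (\<phi> 0) / - 1)) (at 0)"
    by (intro tendsto_intros \<phi>_lim cusp_sqrt_lim) auto
  then have "((\<lambda>z. - (4 * norm (\<phi> z) / (sqrt (H z) * norm z * ln (norm z)))) \<longlongrightarrow> 4 * norm (\<phi> 0)) (at 0)" by simp
  then show "((\<lambda>z. g z / (- (norm z powi (n + 1)) * ln (norm z))) \<longlongrightarrow> 4 * norm (\<phi> 0)) (at 0)"
  proof (rule Lim_transform_eventually)
    show "\<forall>\<^sub>F z in at 0. - (4 * norm (\<phi> z) / (sqrt (H z) * norm z * ln (norm z))) = g z / (- (norm z powi (n + 1)) * ln (norm z))"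
      using ev
    proof eventually_elim
      case (elim z)
      have z: "norm z > 0" "H z > 0" "ln (norm z) < 0" using elim H_pos in_U ln_norm_neg by auto
      have e: "norm z powi (n + 1) = norm z powi n * norm z" using z by (simp add: power_int_add)
      have "norm (\<Xi> z) = norm (\<phi> z) * norm z powi n" by (simp add: \<Xi>_eq[OF elim] norm_mult norm_power_int)
      then show ?case unfolding e using z by (simp add: sk_factor_def field_simps)
    qed
  qed
qed

lemma cis_Arg_powi: "z \<noteq> 0 \<Longrightarrow> cis (of_int k * Arg z) = sgn z powi k"
  by (simp add: cis_power_int[symmetric] cis_Arg)

text \<open>Both coefficients are multiplied by \<rho> = ln r times z or its conjugate. The linear
  one is matched by \<open>cusp_asymptotics\<close>. The antilinear one behaves like (\<i> / 2)
  times the conjugate of the phase of \<phi>(0) z^(n + 1); the model has - 1/2 times the conjugate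
  of the phase of b z^(n + 1), whence b = \<i> \<phi>(0).\<close>

lemma log_connection_asymptotic:
  "asymptotic_connection \<Gamma> (log_connection (n + 1) (\<i> * \<phi> 0)) (\<lambda>z. 1 / (norm z * \<bar>ln (norm z)\<bar>))"
proof (rule asymptotic_connectionI)
  define b where "b = \<i> * \<phi> 0"
  define \<rho> where "\<rho> z = complex_of_real (ln (norm z))" for z :: complex
  define e where "e z = b / of_real (norm b) * cis (of_int (n + 1) * Arg z)" for z
  let ?x = "\<lambda>z. \<rho> z * (z * P z) - (\<rho> z * of_int (n + 1) + 1) / 2" and ?y = "\<lambda>z. \<rho> z * (cnj z * Q z) + cnj (e z) / 2"
  show "\<forall>\<^sub>F z::complex in at 0. 1 / (norm z * \<bar>ln (norm z)\<bar>) > 0"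
    using ev by eventually_elim (use ln_norm_neg in \<open>force intro!: mult_pos_pos\<close>)
  have \<phi>0: "\<phi> 0 \<noteq> 0" using \<phi>(2)[of 0] r by simp
  show "\<forall>\<^sub>F z in at 0. norm (\<Gamma> z \<xi> v - log_connection (n + 1) (\<i> * \<phi> 0) z \<xi> v)
      \<le> 1 / (norm z * \<bar>ln (norm z)\<bar>) * (norm (?x z) * norm (\<xi> * v) + norm (?y z) * norm (\<xi> * v))" for \<xi> v
    using ev
  proof eventually_elim
    case (elim z)
    have z: "z \<noteq> 0" "\<rho> z \<noteq> 0" using elim ln_norm_neg[OF elim] by (auto simp: \<rho>_def)
    have "\<Gamma> z \<xi> v - log_connection (n + 1) (\<i> * \<phi> 0) z \<xi> v =
       P z * (\<xi> * v) + Q z * cnj (\<xi> * v) - ((of_int (n + 1) + 1 / \<rho> z) * (\<xi> / z * v) - cnj (e z) * cnj (\<xi> / z * v) / \<rho> z) / 2"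
      unfolding sk_connection_def log_connection_eq b_def[symmetric] e_def[symmetric] \<rho>_def[symmetric] ..
    moreover have "\<dots> = ?x z * (\<xi> * v) / (\<rho> z * z) + ?y z * cnj (\<xi> * v) / (\<rho> z * cnj z)"
      using z by (simp add: field_simps)
    ultimately have eq: "\<Gamma> z \<xi> v - log_connection (n + 1) (\<i> * \<phi> 0) z \<xi> v =
       ?x z * (\<xi> * v) / (\<rho> z * z) + ?y z * cnj (\<xi> * v) / (\<rho> z * cnj z)" by (rule trans)
    have "norm (\<Gamma> z \<xi> v - log_connection (n + 1) (\<i> * \<phi> 0) z \<xi> v) \<le>
       norm (?x z * (\<xi> * v) / (\<rho> z * z)) + norm (?y z * cnj (\<xi> * v) / (\<rho> z * cnj z))"
      unfolding eq by (rule norm_triangle_ineq)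
    also have "\<dots> = 1 / (norm z * \<bar>ln (norm z)\<bar>) * (norm (?x z) * norm (\<xi> * v) + norm (?y z) * norm (\<xi> * v))"
      by (simp add: norm_mult norm_divide add_divide_distrib \<rho>_def mult_ac)
    finally show ?case .
  qed
  interpret pl: punctured_liouville r H "log_dz H" by (rule punctured_liouville)
  have zl: "((\<lambda>z. \<rho> z * z) \<longlongrightarrow> 0) (at 0)"
    by (rule tendsto_norm_zero_cancel)
       (use tendsto_norm_zero[OF norm_ln_norm_tendsto] in \<open>simp add: \<rho>_def norm_mult abs_mult mult.commute\<close>)
  have "((\<lambda>z. ((\<rho> z * z) * (deriv \<phi> z / \<phi> z) - (of_real (ln (norm z)) * (z * log_dz H z + 1) + 1)) / 2) \<longlongrightarrow>
     (0 * (deriv \<phi> 0 / \<phi> 0) - (- 1 + 1)) / 2) (at 0)"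
    by (intro tendsto_intros zl log_deriv_lim pl.cusp_asymptotics[OF C lim]) auto
  then have "((\<lambda>z. ((\<rho> z * z) * (deriv \<phi> z / \<phi> z) - (of_real (ln (norm z)) * (z * log_dz H z + 1) + 1)) / 2) \<longlongrightarrow> 0) (at 0)"
    by simp
  then show "(?x \<longlongrightarrow> 0) (at 0)"
  proof (rule Lim_transform_eventually)
    show "\<forall>\<^sub>F z in at 0. ((\<rho> z * z) * (deriv \<phi> z / \<phi> z) - (of_real (ln (norm z)) * (z * log_dz H z + 1) + 1)) / 2 = ?x z"
      using ev by eventually_elim (simp add: zP \<rho>_def algebra_simps add_divide_distrib diff_divide_distrib)
  qed
  have sl: "((\<lambda>z. sgn (\<phi> z)) \<longlongrightarrow> sgn (\<phi> 0)) (at 0)" by (rule tendsto_sgn[OF \<phi>_lim \<phi>0])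
  have "((\<lambda>z. - (\<i> / 2) * (of_real (sqrt (H z) * norm z * ln (norm z)) * cnj (sgn (\<phi> z)) + cnj (sgn (\<phi> 0)))) \<longlongrightarrow>
     - (\<i> / 2) * (of_real (- 1) * cnj (sgn (\<phi> 0)) + cnj (sgn (\<phi> 0)))) (at 0)"
    by (intro tendsto_intros sl cusp_sqrt_lim)
  then have "((\<lambda>z. - (\<i> / 2) * (of_real (sqrt (H z) * norm z * ln (norm z)) * cnj (sgn (\<phi> z)) + cnj (sgn (\<phi> 0)))) \<longlongrightarrow> 0) (at 0)"
    by simp
  from tendsto_norm_zero[OF this]
  show "(?y \<longlongrightarrow> 0) (at 0)"
  proof (rule Lim_null_comparison[rotated])
    show "\<forall>\<^sub>F z in at 0. norm (?y z) \<le> norm (- (\<i> / 2) * (of_real (sqrt (H z) * norm z * ln (norm z)) * cnj (sgn (\<phi> z)) + cnj (sgn (\<phi> 0))))"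
      using ev
    proof eventually_elim
      case (elim z)
      have z: "z \<noteq> 0" using elim by simp
      \<comment> \<open>The phases of \<Xi> z and of the model share this factor exactly, for every
        \<open>z\<close>; only the convergence of sgn \<phi>(z) to sgn \<phi>(0) and that of the
        modulus are asymptotic.\<close>
      define E where "E = sgn z powi (n + 1)"
      have E1: "norm E = 1" using z by (simp add: E_def norm_power_int norm_sgn)
      have "sgn (z powi n) = sgn z powi n"
        by (simp only: sgn_eq norm_power_int of_real_power_int power_int_divide_distrib)
      then have "sgn (\<Xi> z) = sgn (\<phi> z) * sgn z powi n"
        unfolding \<Xi>_eq[OF elim] by (simp only: sgn_mult)
      moreover have "E = sgn z powi n * sgn z"
        unfolding E_def using z by (simp add: power_int_add sgn_zero_iff)
      ultimately have "sgn (\<Xi> z) * sgn z = sgn (\<phi> z) * E" by (simp only: mult.assoc)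
      then have sz: "cnj (sgn (\<Xi> z)) * cnj (sgn z) = cnj (sgn (\<phi> z)) * cnj E"
        by (metis complex_cnj_mult)
      have cz: "cnj z = of_real (norm z) * cnj (sgn z)" using z by (simp add: sgn_div_norm scaleR_conv_of_real)
      have "\<rho> z * (cnj z * Q z) = - (\<i> / 2) * of_real (sqrt (H z) * norm z * ln (norm z)) * (cnj (sgn (\<Xi> z)) * cnj (sgn z))"
        unfolding Q_eq[OF in_U[OF elim]] cz \<rho>_def by (simp add: mult_ac)
      moreover have "cnj (e z) / 2 = - (\<i> / 2) * cnj (sgn (\<phi> 0)) * cnj E"
        using z unfolding e_def b_def cis_Arg_powi[OF z] E_def
        by (simp add: sgn_div_norm scaleR_conv_of_real norm_mult field_simps)
      ultimately have "?y z = (- (\<i> / 2) * (of_real (sqrt (H z) * norm z * ln (norm z)) * cnj (sgn (\<phi> z)) + cnj (sgn (\<phi> 0)))) * cnj E"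
        unfolding sz by (simp add: algebra_simps)
      then show ?case using E1 by (simp only: norm_mult complex_mod_cnj mult_1_right order_refl)
    qed
  qed
qed

end

end

section \<open>Meromorphic cubic forms\<close>

locale mero_cubic = surface A for A :: "'a::t2_space chart set" +
  fixes \<Xi> :: "'a cubic"
  assumes mer: "meromorphic_cubic A \<Xi>" and nonzero: "cubic_nonzero A \<Xi>"
begin

lemma law:
  assumes "c \<in> charts A" "d \<in> charts A" "z \<in> img c (fst d)"
  shows "\<Xi> c z = \<Xi> d (transition c d z) * deriv (transition c d) z ^ 3"
  using mer assms unfolding meromorphic_cubic_def cubic_law_def by (metis inf_top_right)

lemma law_point:
  assumes "c \<in> charts A" "d \<in> charts A" "p \<in> fst c" "p \<in> fst d"
  shows "\<Xi> c (snd c p) = 0 \<longleftrightarrow> \<Xi> d (snd d p) = 0"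
  using law[OF assms(1,2) imgI[OF assms(3,4)]] transition_deriv_nonzero[OF assms(1,2) imgI[OF assms(3,4)]]
  by (simp add: transition_eq[OF charts_is_chart[OF assms(1)] assms(3)])

lemma nice:
  assumes "c \<in> charts A" "p \<in> fst c"
  shows "isolated_singularity_at (\<Xi> c) (snd c p)" "not_essential (\<Xi> c) (snd c p)"
    "is_pole (\<Xi> c) (snd c p) \<and> \<Xi> c (snd c p) = 0 \<or> \<Xi> c \<midarrow>snd c p\<rightarrow> \<Xi> c (snd c p)"
proof -
  have z: "snd c p \<in> img c UNIV" using imgI[of p c UNIV] assms by simp
  have n: "\<Xi> c nicely_meromorphic_on img c UNIV" using mer assms by (simp add: meromorphic_cubic_def)
  then show "is_pole (\<Xi> c) (snd c p) \<and> \<Xi> c (snd c p) = 0 \<or> \<Xi> c \<midarrow>snd c p\<rightarrow> \<Xi> c (snd c p)"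
    using z unfolding nicely_meromorphic_on_def by blast
  have "\<Xi> c meromorphic_on {snd c p}"
    using n z meromorphic_on_subset unfolding nicely_meromorphic_on_def by blast
  then show "isolated_singularity_at (\<Xi> c) (snd c p)" "not_essential (\<Xi> c) (snd c p)"
    by (auto simp: meromorphic_at_iff)
qed

lemma img_nhd: "c \<in> charts A \<Longrightarrow> p \<in> fst c \<Longrightarrow> open T \<Longrightarrow> p \<in> T \<Longrightarrow> \<forall>\<^sub>F z in at (snd c p). z \<in> img c T"
  by (rule eventually_at_in_open'[OF open_img[OF charts_is_chart]]) (auto intro: imgI)

text \<open>The set for the identity theorem on the surface: open by definition, closed because near
  every point the form is either zero or has no zeros off that point.\<close>

definition vanishing_points :: "'a set" where
  "vanishing_points = {p. \<exists>T. open T \<and> p \<in> T \<and> (\<forall>q\<in>T. \<forall>c\<in>charts A. q \<in> fst c \<longrightarrow> \<Xi> c (snd c q) = 0)}"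

lemma chart_preimage:
  assumes "c \<in> charts A" "open N" shows "open (fst c \<inter> snd c -` N)"
  using continuous_on_open_vimage[OF is_chart_homeo(1)[OF charts_is_chart[OF assms(1)]]]
    is_chart_homeo(4)[OF charts_is_chart[OF assms(1)]] assms(2) by (metis Int_commute)

text \<open>The value at the centre needs an argument: a pole is excluded by the zeros around it,
  and then the convention for nice meromorphic functions makes the value the limit, which is
  0.\<close>

lemma eventually_zero_imp_vanishing:
  assumes c: "c \<in> charts A" "p \<in> fst c" and ev: "\<forall>\<^sub>F z in at (snd c p). \<Xi> c z = 0"
  shows "p \<in> vanishing_points"
proof -
  have "\<not> is_pole (\<Xi> c) (snd c p)"
  proof
    assume "is_pole (\<Xi> c) (snd c p)"
    from non_zero_neighbour_pole[OF this] ev have "\<forall>\<^sub>F z in at (snd c p). False" by eventually_elim simp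
    then show False by simp
  qed
  then have l: "\<Xi> c \<midarrow>snd c p\<rightarrow> \<Xi> c (snd c p)" using nice(3)[OF c] by blast
  have "\<Xi> c \<midarrow>snd c p\<rightarrow> 0"
    by (rule Lim_transform_eventually[OF tendsto_const]) (use ev in eventually_elim, simp)
  with l have "\<Xi> c (snd c p) = 0" using LIM_unique by blast
  with ev have "\<forall>\<^sub>F z in nhds (snd c p). \<Xi> c z = 0" by (simp add: eventually_nhds_conv_at)
  then obtain N where N: "open N" "snd c p \<in> N" "\<And>z. z \<in> N \<Longrightarrow> \<Xi> c z = 0"
    unfolding eventually_nhds by blast
  have "\<Xi> d (snd d q) = 0" if "q \<in> fst c \<inter> snd c -` N" "d \<in> charts A" "q \<in> fst d" for q d
    using law_point[OF c(1) that(2)] that N(3)[of "snd c q"] by auto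
  then show ?thesis unfolding vanishing_points_def
    using chart_preimage[OF c(1) N(1)] N(2) c(2) by blast
qed

lemma dichotomy:
  assumes c: "c \<in> charts A" "p \<in> fst c"
  shows "(\<forall>\<^sub>F z in at (snd c p). \<Xi> c z = 0) \<or> (\<forall>\<^sub>F z in at (snd c p). \<Xi> c z \<noteq> 0)"
  using non_zero_neighbour[OF nice(1,2)[OF c]] unfolding frequently_def by auto

lemma eventually_nonzero_nhd:
  assumes c: "c \<in> charts A" "p \<in> fst c" and ev: "\<forall>\<^sub>F z in at (snd c p). \<Xi> c z \<noteq> 0"
  shows "\<exists>T. open T \<and> p \<in> T \<and> T \<inter> vanishing_points = {}"
proof -
  have np: "p \<notin> vanishing_points"
  proof
    assume "p \<in> vanishing_points"
    then obtain T where T: "open T" "p \<in> T" "\<And>q. q \<in> T \<Longrightarrow> q \<in> fst c \<Longrightarrow> \<Xi> c (snd c q) = 0"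
      using c(1) unfolding vanishing_points_def by blast
    from img_nhd[OF c T(1,2)] ev have "\<forall>\<^sub>F z in at (snd c p). False"
      by eventually_elim (use T(3) in \<open>auto elim!: imgE\<close>)
    then show False by simp
  qed
  obtain N where N: "open N" "snd c p \<in> N" "\<And>z. z \<in> N \<Longrightarrow> z \<noteq> snd c p \<Longrightarrow> \<Xi> c z \<noteq> 0"
    using ev unfolding eventually_at_topological by blast
  have "q \<notin> vanishing_points" if q: "q \<in> fst c \<inter> snd c -` N" for q
  proof (cases "q = p")
    case False
    then have "snd c q \<noteq> snd c p"
      using q c inj_onD[OF is_chart_homeo(3)[OF charts_is_chart[OF c(1)]]] by blast
    then have "\<Xi> c (snd c q) \<noteq> 0" using N(3) q by auto
    then show ?thesis using q c(1) unfolding vanishing_points_def by blast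
  qed (use np in simp)
  then show ?thesis using chart_preimage[OF c(1) N(1)] N(2) c(2) by blast
qed

lemma no_vanishing_points: "vanishing_points = {}"
proof -
  have 1: "open vanishing_points"
  proof (rule topological_space_class.openI)
    fix p assume "p \<in> vanishing_points"
    then obtain T where "open T" "p \<in> T" "\<forall>q\<in>T. \<forall>c\<in>charts A. q \<in> fst c \<longrightarrow> \<Xi> c (snd c q) = 0"
      unfolding vanishing_points_def by blast
    then show "\<exists>T. open T \<and> p \<in> T \<and> T \<subseteq> vanishing_points" unfolding vanishing_points_def by blast
  qed
  have 2: "open (- vanishing_points)"
  proof (rule topological_space_class.openI)
    fix p assume p: "p \<in> - vanishing_points"
    obtain c where c: "c \<in> charts A" "p \<in> fst c" by (rule ex_chart)
    from dichotomy[OF c] have "\<forall>\<^sub>F z in at (snd c p). \<Xi> c z \<noteq> 0"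
      using eventually_zero_imp_vanishing[OF c] p by blast
    from eventually_nonzero_nhd[OF c this] show "\<exists>T. open T \<and> p \<in> T \<and> T \<subseteq> - vanishing_points" by blast
  qed
  have conn: "connected (UNIV :: 'a set)" using rs by (simp add: riemann_surface_def)
  have "vanishing_points \<inter> UNIV = {} \<or> - vanishing_points \<inter> UNIV = {}"
    by (rule connectedD[OF conn 1 2]) auto
  moreover have "vanishing_points \<noteq> UNIV"
  proof
    assume u: "vanishing_points = UNIV"
    obtain c z where cz: "c \<in> charts A" "z \<in> img c UNIV" "\<Xi> c z \<noteq> 0"
      using nonzero unfolding cubic_nonzero_def by blast
    then obtain p where p: "p \<in> fst c" "z = snd c p" by (auto elim: imgE)
    have "p \<in> vanishing_points" using u by simp
    then show False using cz p unfolding vanishing_points_def by blast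
  qed
  ultimately show ?thesis by auto
qed

lemma ev_nonzero:
  assumes "c \<in> charts A" "p \<in> fst c" shows "\<forall>\<^sub>F z in at (snd c p). \<Xi> c z \<noteq> 0"
  using dichotomy[OF assms]
proof
  assume "\<forall>\<^sub>F z in at (snd c p). \<Xi> c z = 0"
  from eventually_zero_imp_vanishing[OF assms this] show ?thesis by (simp add: no_vanishing_points)
qed

text \<open>By the transformation law \<Xi> in one chart, times t'^(-3), is \<Xi> in the other
  composed with the transition t. The factor has order 0, and t minus its value has a simple zero,
  so composition preserves the order.\<close>

lemma zorder_chart:
  assumes c: "c \<in> charts A" "p \<in> fst c" and d: "d \<in> charts A" "p \<in> fst d"
  shows "zorder (\<Xi> c) (snd c p) = zorder (\<Xi> d) (snd d p)"
proof -
  let ?t = "transition c d" and ?z = "snd c p"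
  have ic: "is_chart c" "is_chart d" using c d charts_is_chart by blast+
  have o: "open (img c (fst d))" using open_img[OF ic(1) is_chart_homeo(1)[OF ic(2)]] .
  have z: "?z \<in> img c (fst d)" by (rule imgI[OF c(2) d(2)])
  have tz: "?t ?z = snd d p" using transition_eq[OF ic(1) c(2)] .
  note hol = transition_holomorphic[OF c(1) d(1)]
  have t0: "deriv ?t ?z \<noteq> 0" by (rule transition_deriv_nonzero[OF c(1) d(1) z])
  have ev: "\<forall>\<^sub>F x in at ?z. x \<in> img c (fst d)" using eventually_at_in_open'[OF o z] .
  define \<mu> where "\<mu> x = inverse (deriv ?t x ^ 3)" for x
  have \<mu>_hol: "\<mu> holomorphic_on img c (fst d)"
    unfolding \<mu>_def using hol o transition_deriv_nonzero[OF c(1) d(1)] by (intro holomorphic_intros) auto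
  have \<mu>: "\<mu> analytic_on {?z}" using \<mu>_hol o z analytic_at by blast
  have comp: "\<forall>\<^sub>F x in at ?z. \<Xi> c x * \<mu> x = (\<Xi> d \<circ> ?t) x"
    using ev by eventually_elim (use law[OF c(1) d(1)] transition_deriv_nonzero[OF c(1) d(1)] in \<open>simp add: \<mu>_def\<close>)
  have "zorder (\<lambda>x. \<Xi> c x * \<mu> x) ?z = zorder (\<Xi> c) ?z + zorder \<mu> ?z"
  proof (rule zorder_times_analytic'[OF nice(1,2)[OF c] \<mu>])
    have "\<forall>\<^sub>F x in at ?z. \<Xi> c x * \<mu> x \<noteq> 0"
      using ev_nonzero[OF c] ev by eventually_elim (use transition_deriv_nonzero[OF c(1) d(1)] in \<open>simp add: \<mu>_def\<close>)
    then show "\<exists>\<^sub>F x in at ?z. \<Xi> c x * \<mu> x \<noteq> 0" by (rule eventually_frequently[rotated]) simp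
  qed
  moreover have "zorder \<mu> ?z = 0"
    by (rule zorder_eq_0I[OF \<mu>]) (use t0 in \<open>simp add: \<mu>_def\<close>)
  ultimately have "zorder (\<Xi> c) ?z = zorder (\<Xi> d \<circ> ?t) ?z"
    using zorder_cong[OF comp refl] by (simp add: o_def)
  also have "\<dots> = zorder (\<Xi> d) (?t ?z) * zorder (\<lambda>x. ?t x - ?t ?z) ?z"
  proof (rule zorder_compose')
    show "isolated_singularity_at (\<Xi> d) (?t ?z)" "not_essential (\<Xi> d) (?t ?z)"
      using nice[OF d] tz by auto
    show "?t analytic_on {?z}" using hol o z analytic_at by blast
    show "\<forall>\<^sub>F w in at (?t ?z). \<Xi> d w \<noteq> 0" using ev_nonzero[OF d] tz by simp
    have "\<forall>\<^sub>F x in at ?z. x \<in> img c (fst d) - {?z}" using eventually_at_in_open[OF o z] .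
    then show "\<forall>\<^sub>F w in at ?z. ?t w \<noteq> ?t ?z"
      by eventually_elim (use transition_inverse[OF ic] z in \<open>metis DiffD1 DiffD2 singletonI\<close>)
  qed
  also have "zorder (\<lambda>x. ?t x - ?t ?z) ?z = 1"
  proof (rule zorder_zero_eqI[of _ "img c (fst d)"])
    have "((\<lambda>x. ?t x - ?t ?z) has_field_derivative deriv ?t ?z) (at ?z)"
      using transition_DERIV[OF c(1) d(1) z] by (auto intro!: derivative_eq_intros)
    then show "(deriv ^^ nat 1) (\<lambda>x. ?t x - ?t ?z) ?z \<noteq> 0" using t0 by (simp add: DERIV_imp_deriv)
  qed (use hol o z in \<open>auto intro!: holomorphic_intros\<close>)
  finally show ?thesis using tz by simp
qed

lemma cubic_ord_eq: assumes c: "c \<in> charts A" "p \<in> fst c" shows "cubic_ord A \<Xi> p = zorder (\<Xi> c) (snd c p)"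
proof -
  define d where "d = (SOME c. c \<in> charts A \<and> p \<in> fst c)"
  have "d \<in> charts A \<and> p \<in> fst d" unfolding d_def by (rule someI[of _ c]) (use c in blast)
  then show ?thesis using zorder_chart[OF c, of d] by (simp add: cubic_ord_def d_def[symmetric])
qed

lemma local_form:
  assumes c: "c \<in> charts A" "p \<in> fst c"
  obtains \<phi> r where "r > 0" "\<phi> holomorphic_on ball (snd c p) r" "\<And>z. z \<in> ball (snd c p) r \<Longrightarrow> \<phi> z \<noteq> 0"
    "\<And>z. z \<in> ball (snd c p) r - {snd c p} \<Longrightarrow> \<Xi> c z = \<phi> z * (z - snd c p) powi (cubic_ord A \<Xi> p)"
proof -
  let ?z = "snd c p" and ?\<phi> = "zor_poly (\<Xi> c) (snd c p)"
  have "\<exists>\<^sub>F x in at ?z. \<Xi> c x \<noteq> 0" using ev_nonzero[OF c] by (rule eventually_frequently[rotated]) simp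
  from zorder_exist[OF nice(1,2)[OF c] this] obtain r where r: "r > 0" "?\<phi> ?z \<noteq> 0" "?\<phi> holomorphic_on cball ?z r"
    "\<And>w. w \<in> cball ?z r - {?z} \<Longrightarrow> \<Xi> c w = ?\<phi> w * (w - ?z) powi (zorder (\<Xi> c) ?z) \<and> ?\<phi> w \<noteq> 0"
    by blast
  show ?thesis
  proof (rule that[OF r(1)])
    show "?\<phi> holomorphic_on ball ?z r" using r(3) by (rule holomorphic_on_subset) auto
    show "?\<phi> z \<noteq> 0" if "z \<in> ball ?z r" for z using r(2) r(4)[of z] that by (cases "z = ?z") auto
    show "\<Xi> c z = ?\<phi> z * (z - ?z) powi (cubic_ord A \<Xi> p)" if "z \<in> ball ?z r - {?z}" for z
      using r(4)[of z] that unfolding cubic_ord_eq[OF c] by auto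
  qed
qed

text \<open>Order 0 alone would allow a removable singularity with a wrong value at
  \<open>p\<close>; the nice convention excludes this, so the form is regular and nonzero at the
  point itself.\<close>

lemma ord_0:
  assumes c: "c \<in> charts A" "p \<in> fst c" and 0: "cubic_ord A \<Xi> p = 0"
  shows "\<Xi> c (snd c p) \<noteq> 0" "\<exists>d. (\<Xi> c has_field_derivative d) (at (snd c p))"
proof -
  obtain \<phi> r where r: "r > 0" "\<phi> holomorphic_on ball (snd c p) r" "\<And>z. z \<in> ball (snd c p) r \<Longrightarrow> \<phi> z \<noteq> 0"
    "\<And>z. z \<in> ball (snd c p) r - {snd c p} \<Longrightarrow> \<Xi> c z = \<phi> z"
    using local_form[OF c] unfolding 0 by (metis mult.right_neutral power_int_0_right)
  have D: "(\<phi> has_field_derivative deriv \<phi> (snd c p)) (at (snd c p))"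
    using r by (intro holomorphic_derivI[OF r(2)]) auto
  have "\<phi> \<midarrow>snd c p\<rightarrow> \<phi> (snd c p)" using DERIV_isCont[OF D] by (simp add: isCont_def)
  moreover have "\<forall>\<^sub>F z in at (snd c p). \<phi> z = \<Xi> c z"
    using eventually_at_in_open[of "ball (snd c p) r" "snd c p"] r(1) by (auto elim!: eventually_mono simp: r(4))
  ultimately have l: "\<Xi> c \<midarrow>snd c p\<rightarrow> \<phi> (snd c p)" by (rule Lim_transform_eventually)
  then have "\<not> is_pole (\<Xi> c) (snd c p)"
    unfolding is_pole_def using not_tendsto_and_filterlim_at_infinity[OF _ l] by auto
  then have "\<Xi> c (snd c p) = \<phi> (snd c p)" using nice(3)[OF c] l LIM_unique by blast
  then have e: "\<Xi> c z = \<phi> z" if "z \<in> ball (snd c p) r" for z using r(4)[of z] that by (cases "z = snd c p") auto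
  show "\<Xi> c (snd c p) \<noteq> 0" using e[of "snd c p"] r by auto
  show "\<exists>d. (\<Xi> c has_field_derivative d) (at (snd c p))"
    by (intro exI[of _ "deriv \<phi> (snd c p)"] has_field_derivative_transform_within_open[OF D, where S="ball (snd c p) r"])
       (use e r(1) in auto)
qed

text \<open>A nonvanishing factor times a power of z - z(p) has neither zeros nor poles off the
  centre: the support of the divisor is discrete.\<close>

lemma ord_0_punctured:
  assumes c: "c \<in> charts A" "p \<in> fst c"
  shows "\<forall>\<^sub>F z in at (snd c p). z \<in> img c (- cubic_supp A \<Xi>)"
proof -
  obtain \<phi> r where r: "r > 0" "\<phi> holomorphic_on ball (snd c p) r" "\<And>z. z \<in> ball (snd c p) r \<Longrightarrow> \<phi> z \<noteq> 0"
    "\<And>z. z \<in> ball (snd c p) r - {snd c p} \<Longrightarrow> \<Xi> c z = \<phi> z * (z - snd c p) powi (cubic_ord A \<Xi> p)"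
    using local_form[OF c] by metis
  have "\<forall>\<^sub>F z in at (snd c p). z \<in> ball (snd c p) r - {snd c p}"
    using eventually_at_in_open[of "ball (snd c p) r" "snd c p"] r(1) by auto
  with img_nhd[OF c open_UNIV UNIV_I] show ?thesis
  proof eventually_elim
    case (elim z)
    then obtain q where q: "q \<in> fst c" "z = snd c q" by (auto elim: imgE)
    have "zorder (\<Xi> c) z = 0"
    proof (rule zorder_eqI[of "ball (snd c p) r - {snd c p}" z "\<lambda>z. \<phi> z * (z - snd c p) powi (cubic_ord A \<Xi> p)"])
      show "(\<lambda>z. \<phi> z * (z - snd c p) powi (cubic_ord A \<Xi> p)) holomorphic_on ball (snd c p) r - {snd c p}"
        using r(2) by (intro holomorphic_intros) (auto intro: holomorphic_on_subset)
    qed (use elim r in \<open>auto simp: power_int_eq_0_iff\<close>)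
    then show ?case using cubic_ord_eq[OF c(1) q(1)] q by (auto simp: cubic_supp_def intro!: imgI)
  qed
qed

lemma open_compl_supp: "open (- cubic_supp A \<Xi>)"
proof (rule topological_space_class.openI)
  fix p assume p: "p \<in> - cubic_supp A \<Xi>"
  obtain c where c: "c \<in> charts A" "p \<in> fst c" by (rule ex_chart)
  obtain N where N: "open N" "snd c p \<in> N" "\<And>z. z \<in> N \<Longrightarrow> z \<noteq> snd c p \<Longrightarrow> z \<in> img c (- cubic_supp A \<Xi>)"
    using ord_0_punctured[OF c] unfolding eventually_at_topological by blast
  note inj = inj_onD[OF is_chart_homeo(3)[OF charts_is_chart[OF c(1)]]]
  have "q \<in> - cubic_supp A \<Xi>" if q: "q \<in> fst c \<inter> snd c -` N" for q
  proof (cases "snd c q = snd c p")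
    case True
    then show ?thesis using inj[of q p] q c p by auto
  next
    case False
    then have "snd c q \<in> img c (- cubic_supp A \<Xi>)" using N(3) q by blast
    then obtain q' where "q' \<in> fst c" "q' \<in> - cubic_supp A \<Xi>" "snd c q = snd c q'" by (rule imgE)
    then show ?thesis using inj[of q q'] q by auto
  qed
  then show "\<exists>T. open T \<and> p \<in> T \<and> T \<subseteq> - cubic_supp A \<Xi>"
    using chart_preimage[OF c(1) N(1)] N(2) c(2) by blast
qed

lemma finite_punctured:
  assumes c: "c \<in> charts A" "p \<in> fst c" and F: "finite F"
  shows "\<forall>\<^sub>F z in at (snd c p). z \<in> img c (- F)"
proof -
  have "open (- (F - {p}))" using F by (intro open_Compl finite_imp_closed) auto
  from img_nhd[OF c this] have 1: "\<forall>\<^sub>F z in at (snd c p). z \<in> img c (- (F - {p}))" by simp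
  have 2: "\<forall>\<^sub>F z in at (snd c p). z \<noteq> snd c p" by (auto simp: eventually_at intro: exI[of _ 1])
  from 1 2 show ?thesis by eventually_elim (auto elim!: imgE intro!: imgI)
qed

end

section \<open>Change of the centered coordinate\<close>

lemma change_coordinate_limits:
  fixes t :: "complex \<Rightarrow> complex"
  assumes t: "(t has_field_derivative \<tau>) (at 0)" "t 0 = 0" "\<tau> \<noteq> 0"
  shows "((\<lambda>z. norm (t z / z)) \<longlongrightarrow> norm \<tau>) (at 0)" "filterlim t (at 0) (at 0)"
    "\<forall>\<^sub>F z in at 0. z \<noteq> 0 \<and> t z \<noteq> 0"
proof -
  have l: "((\<lambda>z. t z / z) \<longlongrightarrow> \<tau>) (at 0)" using t(1,2) by (simp add: has_field_derivative_iff)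
  then show "((\<lambda>z. norm (t z / z)) \<longlongrightarrow> norm \<tau>) (at 0)" by (rule tendsto_norm)
  have "\<forall>\<^sub>F z in at 0. t z / z \<noteq> 0" using tendsto_imp_eventually_ne[OF l t(3)] .
  then show nz: "\<forall>\<^sub>F z in at 0. z \<noteq> 0 \<and> t z \<noteq> 0" by eventually_elim auto
  have "(t \<longlongrightarrow> 0) (at 0)" using DERIV_isCont[OF t(1)] t(2) by (simp add: isCont_def)
  then show "filterlim t (at 0) (at 0)" unfolding filterlim_at using nz by (auto elim!: eventually_mono)
qed

text \<open>The singularity of the hyperbolic metric is given in some centered coordinate, while the
  conclusion is claimed in all of them. As |t(z) / z| tends to |\<tau>|, only the constant
  changes.\<close>

lemma change_coordinate_conical:
  fixes t :: "complex \<Rightarrow> complex"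
  assumes t: "(t has_field_derivative \<tau>) (at 0)" "t 0 = 0" "\<tau> \<noteq> 0" and s: "(s \<longlongrightarrow> \<tau>) (at 0)"
    and lim: "((\<lambda>z. H' z / norm z powr b) \<longlongrightarrow> C) (at 0)"
    and H: "\<forall>\<^sub>F z in at 0. H z = H' (t z) * (norm (s z))\<^sup>2"
  shows "((\<lambda>z. H z / norm z powr b) \<longlongrightarrow> C * norm \<tau> powr b * (norm \<tau>)\<^sup>2) (at 0)"
proof -
  note cl = change_coordinate_limits[OF t]
  have "((\<lambda>z. H' (t z) / norm (t z) powr b * norm (t z / z) powr b * (norm (s z))\<^sup>2) \<longlongrightarrow> C * norm \<tau> powr b * (norm \<tau>)\<^sup>2) (at 0)"
    by (intro tendsto_intros filterlim_compose[OF lim cl(2)] cl(1) s) (use t in auto)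
  then show ?thesis
  proof (rule Lim_transform_eventually)
    show "\<forall>\<^sub>F z in at 0. H' (t z) / norm (t z) powr b * norm (t z / z) powr b * (norm (s z))\<^sup>2 = H z / norm z powr b"
      using cl(3) H by eventually_elim (simp add: norm_divide powr_divide)
  qed
qed

text \<open>The quotient of ln |t(z)| and ln |z| tends to 1, and the factors |\<tau>|^2 cancel, so
  here even the constant is preserved.\<close>

lemma change_coordinate_cusp:
  fixes t :: "complex \<Rightarrow> complex"
  assumes t: "(t has_field_derivative \<tau>) (at 0)" "t 0 = 0" "\<tau> \<noteq> 0" and s: "(s \<longlongrightarrow> \<tau>) (at 0)"
    and lim: "((\<lambda>z. H' z * (norm z * ln (norm z))\<^sup>2) \<longlongrightarrow> C) (at 0)"
    and H: "\<forall>\<^sub>F z in at 0. H z = H' (t z) * (norm (s z))\<^sup>2"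
  shows "((\<lambda>z. H z * (norm z * ln (norm z))\<^sup>2) \<longlongrightarrow> C) (at 0)"
proof -
  note cl = change_coordinate_limits[OF t]
  have lb: "filterlim (\<lambda>z::complex. ln (norm z)) at_infinity (at 0)"
    by (rule filterlim_mono[OF ln_norm_at_bot at_bot_le_at_infinity order_refl])
  have "((\<lambda>z. 1 + ln (norm (t z / z)) / ln (norm z)) \<longlongrightarrow> 1 + 0) (at 0)"
    by (intro tendsto_add tendsto_const tendsto_divide_0[OF tendsto_ln[OF cl(1)] lb]) (use t in auto)
  then have L: "((\<lambda>z. 1 + ln (norm (t z / z)) / ln (norm z)) \<longlongrightarrow> 1) (at 0)" by simp
  have "((\<lambda>z. H' (t z) * (norm (t z) * ln (norm (t z)))\<^sup>2 / ((norm (t z / z))\<^sup>2 * (1 + ln (norm (t z / z)) / ln (norm z))\<^sup>2) * (norm (s z))\<^sup>2)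
     \<longlongrightarrow> C / ((norm \<tau>)\<^sup>2 * 1\<^sup>2) * (norm \<tau>)\<^sup>2) (at 0)"
    by (intro tendsto_intros filterlim_compose[OF lim cl(2)] cl(1) L s) (use t in auto)
  then have l: "((\<lambda>z. H' (t z) * (norm (t z) * ln (norm (t z)))\<^sup>2 / ((norm (t z / z))\<^sup>2 * (1 + ln (norm (t z / z)) / ln (norm z))\<^sup>2) * (norm (s z))\<^sup>2) \<longlongrightarrow> C) (at 0)"
    using t(3) by simp
  have small: "\<forall>\<^sub>F z in at 0. ln (norm z) < 0 \<and> ln (norm (t z)) < 0"
    using filterlim_at_bot_dense[THEN iffD1, OF ln_norm_at_bot, rule_format, of 0]
      filterlim_at_bot_dense[THEN iffD1, OF filterlim_compose[OF ln_norm_at_bot cl(2)], rule_format, of 0]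
    by eventually_elim simp
  show ?thesis
  proof (rule Lim_transform_eventually[OF l])
    show "\<forall>\<^sub>F z in at 0. H' (t z) * (norm (t z) * ln (norm (t z)))\<^sup>2 / ((norm (t z / z))\<^sup>2 * (1 + ln (norm (t z / z)) / ln (norm z))\<^sup>2) * (norm (s z))\<^sup>2
      = H z * (norm z * ln (norm z))\<^sup>2"
      using cl(3) H small
    proof eventually_elim
      case (elim z)
      have "1 + ln (norm (t z / z)) / ln (norm z) = ln (norm (t z)) / ln (norm z)"
        using elim by (simp add: norm_divide ln_div field_simps)
      then show ?case using elim by (simp add: norm_divide power_divide power_mult_distrib field_simps)
    qed
  qed
qed

context surface begin

lemma centered_change:
  assumes c: "centered_at A p c" and d: "centered_at A p d"
  shows "(transition c d has_field_derivative deriv (transition c d) 0) (at 0)" "transition c d 0 = 0"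
    "deriv (transition c d) 0 \<noteq> 0" "(deriv (transition c d) \<longlongrightarrow> deriv (transition c d) 0) (at 0)"
proof -
  have cd: "c \<in> charts A" "d \<in> charts A" "p \<in> fst c" "p \<in> fst d" "snd c p = 0" "snd d p = 0"
    using c d by (auto simp: centered_at_def)
  have ic: "is_chart c" "is_chart d" using cd charts_is_chart by blast+
  have z: "0 \<in> img c (fst d)" using imgI[OF cd(3,4)] cd(5) by simp
  have o: "open (img c (fst d))" using open_img[OF ic(1) is_chart_homeo(1)[OF ic(2)]] .
  show "(transition c d has_field_derivative deriv (transition c d) 0) (at 0)" by (rule transition_DERIV[OF cd(1,2) z])
  show "deriv (transition c d) 0 \<noteq> 0" by (rule transition_deriv_nonzero[OF cd(1,2) z])
  show "transition c d 0 = 0" using transition_eq[OF ic(1) cd(3), of d] cd by simp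
  have "isCont (deriv (transition c d)) 0"
    by (rule DERIV_isCont[OF holomorphic_derivI[OF holomorphic_deriv[OF transition_holomorphic[OF cd(1,2)] o] o z]])
  then show "(deriv (transition c d) \<longlongrightarrow> deriv (transition c d) 0) (at 0)" by (simp add: isCont_def)
qed

end

section \<open>Singularities of the special Kaehler structure\<close>

locale singular_structure = mero_cubic A \<Xi> for A :: "'a::t2_space chart set" and \<Xi> +
  fixes h :: "'a metric" and F :: "'a set" and S :: "'a set"
  assumes F: "finite F" and hF: "hyperbolic_metric A (- F) h" and S: "S = - (cubic_supp A \<Xi> \<union> F)"
begin

lemma S_open: "open S"
  using open_compl_supp F by (auto simp: S intro!: open_Int open_Compl finite_imp_closed)

lemma hyperbolic_cubic: "hyperbolic_cubic A S h \<Xi>"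
proof
  show "hyperbolic_metric A S h" by (rule hyperbolic_metric_subset[OF hF S_open]) (auto simp: S)
  have z0: "\<Xi> c z \<noteq> 0 \<and> (\<exists>d. (\<Xi> c has_field_derivative d) (at z))" if "c \<in> charts A" "z \<in> img c S" for c z
  proof -
    obtain q where q: "q \<in> fst c" "q \<in> S" "z = snd c q" using \<open>z \<in> img c S\<close> by (rule imgE)
    then have "cubic_ord A \<Xi> q = 0" by (simp add: S cubic_supp_def)
    from ord_0[OF that(1) q(1) this] q(3) show ?thesis by simp
  qed
  show "\<Xi> c z \<noteq> 0" if "c \<in> charts A" "z \<in> img c S" for c z using z0[OF that] by blast
  show "holomorphic_cubic A S \<Xi>"
    unfolding holomorphic_cubic_def
  proof (intro conjI ballI S_open)
    show "cubic_law A S \<Xi>" using mer cubic_law_subset unfolding meromorphic_cubic_def by blast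
    show "\<Xi> c holomorphic_on img c S" if "c \<in> charts A" for c
      unfolding holomorphic_on_open[OF open_img[OF charts_is_chart[OF that] S_open]] using z0[OF that] by blast
  qed
qed

sublocale hc: hyperbolic_cubic A S h \<Xi> by (rule hyperbolic_cubic)

lemma punctured: assumes "c \<in> charts A" "p \<in> fst c" shows "\<forall>\<^sub>F z in at (snd c p). z \<in> img c S"
  using ord_0_punctured[OF assms] finite_punctured[OF assms F]
proof eventually_elim
  case (elim z)
  then obtain q q' where "q \<in> fst c" "q \<in> - cubic_supp A \<Xi>" "z = snd c q" "q' \<in> fst c" "q' \<in> - F" "z = snd c q'"
    by (auto elim!: imgE)
  moreover from this have "q = q'" using inj_onD[OF is_chart_homeo(3)[OF charts_is_chart[OF assms(1)]]] by metis
  ultimately show ?case by (auto simp: S intro!: imgI)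
qed

lemma centered_punctured: "centered_at A p c \<Longrightarrow> punctured_nbhd_in c S"
  using punctured[of c p] by (simp add: centered_at_def punctured_nbhd_in_def)

lemma singularity:
  assumes c: "centered_at A p c"
  obtains \<phi> r where "sk_singularity (img c S) (hc.H c) (\<Xi> c) (cubic_ord A \<Xi> p) \<phi> r"
proof -
  have cc: "c \<in> charts A" "p \<in> fst c" "snd c p = 0" using c by (auto simp: centered_at_def)
  obtain \<phi> r where r: "r > 0" "\<phi> holomorphic_on ball 0 r" "\<And>z. z \<in> ball 0 r \<Longrightarrow> \<phi> z \<noteq> 0"
    "\<And>z. z \<in> ball 0 r - {0} \<Longrightarrow> \<Xi> c z = \<phi> z * z powi (cubic_ord A \<Xi> p)"
    using local_form[OF cc(1,2)] unfolding cc(3) diff_zero by metis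
  obtain r' where r': "r' > 0" "\<And>z. z \<noteq> 0 \<Longrightarrow> norm z < r' \<Longrightarrow> z \<in> img c S"
    using punctured[OF cc(1,2)] unfolding cc(3) eventually_at by auto
  interpret sk_data "img c S" "hc.H c" "\<Xi> c" by (rule hc.sk[OF cc(1)])
  define \<rho> where "\<rho> = min (min r r') (1/2)"
  have \<rho>: "\<rho> > 0" "\<rho> < 1" "\<rho> \<le> r" "\<rho> \<le> r'" using r(1) r'(1) by (auto simp: \<rho>_def)
  have "sk_singularity (img c S) (hc.H c) (\<Xi> c) (cubic_ord A \<Xi> p) \<phi> \<rho>"
  proof
    show "ball 0 \<rho> - {0} \<subseteq> img c S"
    proof
      fix z :: complex assume "z \<in> ball 0 \<rho> - {0}"
      then show "z \<in> img c S" by (intro r'(2)) (use \<rho> in auto)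
    qed
    show "\<phi> holomorphic_on ball 0 \<rho>" using r(2) \<rho> by (auto intro: holomorphic_on_subset)
  qed (use r \<rho> in auto)
  then show ?thesis by (rule that)
qed

lemma H_change:
  assumes c: "centered_at A p c" and d: "centered_at A p d"
  shows "\<forall>\<^sub>F z in at 0. hc.H c z = hc.H d (transition c d z) * (norm (deriv (transition c d) z))\<^sup>2"
proof -
  have cd: "c \<in> charts A" "d \<in> charts A" "p \<in> fst c" "p \<in> fst d" "snd c p = 0"
    using c d by (auto simp: centered_at_def)
  have "\<forall>\<^sub>F z in at 0. z \<in> img c S" using punctured[OF cd(1,3)] cd(5) by simp
  moreover have "\<forall>\<^sub>F z in at 0. z \<in> img c (fst d)"
    using img_nhd[OF cd(1,3) is_chart_homeo(1)[OF charts_is_chart[OF cd(2)]] cd(4)] cd(5) by simp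
  ultimately show ?thesis
  proof eventually_elim
    case (elim z)
    then obtain q q' where "q \<in> fst c" "q \<in> S" "z = snd c q" "q' \<in> fst c" "q' \<in> fst d" "z = snd c q'"
      by (auto elim!: imgE)
    moreover from this have "q = q'" using inj_onD[OF is_chart_homeo(3)[OF charts_is_chart[OF cd(1)]]] by metis
    ultimately have "z \<in> img c (fst d \<inter> S)" by (auto intro!: imgI)
    then show ?case by (rule hc.H_law[OF cd(1,2)])
  qed
qed

lemma H_conical:
  assumes "metric_conical A (- F) h p \<alpha>" and c: "centered_at A p c"
  shows "\<alpha> > - 1" "\<exists>C>0. ((\<lambda>z. hc.H c z / norm z powr (2 * \<alpha>)) \<longlongrightarrow> C) (at 0)"
proof -
  obtain d C where d: "centered_at A p d" and C: "C > 0"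
    and l: "\<And>u v. ((\<lambda>z. h d z u v / norm z powr (2 * \<alpha>)) \<longlongrightarrow> C * (u \<bullet> v)) (at 0)"
    using assms(1) unfolding metric_conical_def asymptotic_metric_def by blast
  show "\<alpha> > - 1" using assms(1) by (simp add: metric_conical_def)
  have "((\<lambda>z. hc.H d z / norm z powr (2 * \<alpha>)) \<longlongrightarrow> C) (at 0)" using l[of 1 1] by (simp add: hc.H_def[abs_def])
  from change_coordinate_conical[OF centered_change[OF c d] this H_change[OF c d]]
  show "\<exists>C>0. ((\<lambda>z. hc.H c z / norm z powr (2 * \<alpha>)) \<longlongrightarrow> C) (at 0)"
    using C centered_change(3)[OF c d]
    by (intro exI[of _ "C * norm (deriv (transition c d) 0) powr (2 * \<alpha>) * (norm (deriv (transition c d) 0))\<^sup>2"]) auto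
qed

lemma H_cusp:
  assumes "metric_cusp A (- F) h p" and c: "centered_at A p c"
  shows "\<exists>C>0. ((\<lambda>z. hc.H c z * (norm z * ln (norm z))\<^sup>2) \<longlongrightarrow> C) (at 0)"
proof -
  obtain d C where d: "centered_at A p d" and C: "C > 0"
    and l: "\<And>u v. ((\<lambda>z. h d z u v / (1 / (norm z * ln (norm z))\<^sup>2)) \<longlongrightarrow> C * (u \<bullet> v)) (at 0)"
    using assms(1) unfolding metric_cusp_def asymptotic_metric_def by blast
  have "((\<lambda>z. hc.H d z * (norm z * ln (norm z))\<^sup>2) \<longlongrightarrow> C) (at 0)" using l[of 1 1] by (simp add: hc.H_def[abs_def])
  from change_coordinate_cusp[OF centered_change[OF c d] this H_change[OF c d]] C show ?thesis by blast
qed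

text \<open>A regular point of the metric counts as a cone of order 0, which makes the points of the
  cubic divisor outside the metric divisor a case of the conical statement.\<close>

lemma H_smooth:
  assumes "p \<notin> F" and c: "centered_at A p c"
  shows "\<exists>C>0. ((\<lambda>z. hc.H c z / norm z powr (2 * 0)) \<longlongrightarrow> C) (at 0)"
proof (intro exI[of _ "hc.H c 0"] conjI)
  have cc: "c \<in> charts A" "p \<in> fst c" "snd c p = 0" using c by (auto simp: centered_at_def)
  have h: "is_hermitian_metric (img c (- F)) (h c)" using hF cc(1) by (simp add: hyperbolic_metric_def)
  have z: "0 \<in> img c (- F)" using imgI[of p c "- F"] assms(1) cc by simp
  show "hc.H c 0 > 0" using hermitian_metric_conf(2)[OF h z] by (simp add: hc.H_def)
  have "smooth_on (img c (- F)) (hc.H c)" using hermitian_metric_smooth[OF h] by (simp add: hc.H_def[abs_def])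
  from differentiable_imp_continuous_within[OF smooth_on_differentiable[OF this z]]
  have "(hc.H c \<longlongrightarrow> hc.H c 0) (at 0)" by (simp add: isCont_def)
  then show "((\<lambda>z. hc.H c z / norm z powr (2 * 0)) \<longlongrightarrow> hc.H c 0) (at 0)"
    by (rule Lim_transform_eventually) (auto simp: eventually_at intro: exI[of _ 1])
qed

context
  fixes g :: "'a metric" and \<Gamma> :: "'a connection"
  assumes sk: "special_kaehler_with A S h \<Xi> g \<Gamma>"
begin

text \<open>By uniqueness an arbitrary structure with the given data agrees on \<open>S\<close> with
  the explicit one, for which the asymptotics were computed.\<close>

lemma eventually_structure:
  assumes c: "centered_at A p c"
  shows "\<forall>\<^sub>F z in at 0. conf (sk_factor (hc.H c) (\<Xi> c)) z = g c z"
    "\<forall>\<^sub>F z in at 0. sk_connection (hc.H c) (\<Xi> c) z = \<Gamma> c z"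
proof -
  have cc: "c \<in> charts A" "p \<in> fst c" "snd c p = 0" using c by (auto simp: centered_at_def)
  have ev: "\<forall>\<^sub>F z in at 0. z \<in> img c S" using punctured[OF cc(1,2)] cc(3) by simp
  show "\<forall>\<^sub>F z in at 0. conf (sk_factor (hc.H c) (\<Xi> c)) z = g c z"
    using ev by eventually_elim (simp add: hc.structure_unique(1)[OF sk cc(1)] hc.g_def)
  show "\<forall>\<^sub>F z in at 0. sk_connection (hc.H c) (\<Xi> c) z = \<Gamma> c z"
    using ev by eventually_elim (simp add: hc.structure_unique(2)[OF sk cc(1)] hc.\<Gamma>_def)
qed

lemma conical:
  assumes \<alpha>: "\<alpha> > - 1"
    and lim: "\<And>c. centered_at A p c \<Longrightarrow> \<exists>C>0. ((\<lambda>z. hc.H c z / norm z powr (2 * \<alpha>)) \<longlongrightarrow> C) (at 0)"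
  shows "sk_conical A S g \<Gamma> p (1/2 * (of_int (cubic_ord A \<Xi> p) - \<alpha>))"
  unfolding sk_conical_def
proof (intro exI[of _ "of_int (cubic_ord A \<Xi> p) - \<alpha>"] conjI allI impI refl)
  fix c assume c: "centered_at A p c"
  show "punctured_nbhd_in c S" by (rule centered_punctured[OF c])
  obtain C where C: "C > 0" "((\<lambda>z. hc.H c z / norm z powr (2 * \<alpha>)) \<longlongrightarrow> C) (at 0)" using lim[OF c] by blast
  obtain \<phi> r where "sk_singularity (img c S) (hc.H c) (\<Xi> c) (cubic_ord A \<Xi> p) \<phi> r" by (rule singularity[OF c])
  then interpret s: sk_singularity "img c S" "hc.H c" "\<Xi> c" "cubic_ord A \<Xi> p" \<phi> r .
  show "asymptotic_metric (g c) (\<lambda>z. norm z powr (of_int (cubic_ord A \<Xi> p) - \<alpha>))"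
    by (rule asymptotic_metric_cong[OF s.conical_metric[OF \<alpha> C] eventually_structure(1)[OF c]])
  show "asymptotic_connection (\<Gamma> c) (conical_connection (of_int (cubic_ord A \<Xi> p) - \<alpha>)) (\<lambda>z. 1 / norm z)"
    by (rule asymptotic_connection_cong[OF s.conical_connection_asymptotic[OF \<alpha> C] eventually_structure(2)[OF c]])
qed

lemma logarithmic:
  assumes lim: "\<And>c. centered_at A p c \<Longrightarrow> \<exists>C>0. ((\<lambda>z. hc.H c z * (norm z * ln (norm z))\<^sup>2) \<longlongrightarrow> C) (at 0)"
  shows "sk_logarithmic A S g \<Gamma> p (1/2 * (of_int (cubic_ord A \<Xi> p) + 1))"
  unfolding sk_logarithmic_def
proof (intro exI[of _ "cubic_ord A \<Xi> p + 1"] conjI allI impI)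
  fix c assume c: "centered_at A p c"
  show "punctured_nbhd_in c S" by (rule centered_punctured[OF c])
  obtain C where C: "C > 0" "((\<lambda>z. hc.H c z * (norm z * ln (norm z))\<^sup>2) \<longlongrightarrow> C) (at 0)" using lim[OF c] by blast
  obtain \<phi> r where "sk_singularity (img c S) (hc.H c) (\<Xi> c) (cubic_ord A \<Xi> p) \<phi> r" by (rule singularity[OF c])
  then interpret s: sk_singularity "img c S" "hc.H c" "\<Xi> c" "cubic_ord A \<Xi> p" \<phi> r .
  show "asymptotic_metric (g c) (\<lambda>z. - (norm z powi (cubic_ord A \<Xi> p + 1)) * ln (norm z))"
    by (rule asymptotic_metric_cong[OF s.cusp_metric[OF C] eventually_structure(1)[OF c]])
  have "\<i> * \<phi> 0 \<noteq> 0" using s.\<phi>(2)[of 0] s.r by simp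
  moreover have "asymptotic_connection (\<Gamma> c) (log_connection (cubic_ord A \<Xi> p + 1) (\<i> * \<phi> 0)) (\<lambda>z. 1 / (norm z * \<bar>ln (norm z)\<bar>))"
    by (rule asymptotic_connection_cong[OF s.log_connection_asymptotic[OF C] eventually_structure(2)[OF c]])
  ultimately show "\<exists>b. b \<noteq> 0 \<and> asymptotic_connection (\<Gamma> c) (log_connection (cubic_ord A \<Xi> p + 1) b)
                 (\<lambda>z. 1 / (norm z * \<bar>ln (norm z)\<bar>))" by blast
qed simp

end

end

theorem theorem31:
  fixes A :: "'a::t2_space chart set"
  assumes "riemann_surface A"
  shows
    "(\<forall>S \<Xi> h. open S \<and> holomorphic_cubic A S \<Xi> \<and> hyperbolic_metric A S h \<longrightarrow>
        (\<exists>g \<Gamma>. special_kaehler_with A (S - cubic_zeros A S \<Xi>) h \<Xi> g \<Gamma> \<and>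
           (\<forall>g' \<Gamma>'. special_kaehler_with A (S - cubic_zeros A S \<Xi>) h \<Xi> g' \<Gamma>' \<longrightarrow>
              same_structure A (S - cubic_zeros A S \<Xi>) g \<Gamma> g' \<Gamma>'))) \<and>
     (\<forall>\<Xi> h D. meromorphic_cubic A \<Xi> \<and> cubic_nonzero A \<Xi> \<and> represents_divisor A h D \<longrightarrow>
        (let S = - (cubic_supp A \<Xi> \<union> div_supp D) in
           (\<exists>g \<Gamma>. special_kaehler_with A S h \<Xi> g \<Gamma>) \<and>
           (\<forall>g \<Gamma>. special_kaehler_with A S h \<Xi> g \<Gamma> \<longrightarrow>
              (\<forall>p\<in>div_supp D. metric_cusp A (- div_supp D) h p \<longrightarrow>
                 sk_logarithmic A S g \<Gamma> p (1/2 * (of_int (cubic_ord A \<Xi> p) + 1))) \<and>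
              (\<forall>p\<in>div_supp D. \<forall>\<alpha>. metric_conical A (- div_supp D) h p \<alpha> \<longrightarrow>
                 sk_conical A S g \<Gamma> p (1/2 * (of_int (cubic_ord A \<Xi> p) - \<alpha>))) \<and>
              (\<forall>p\<in>cubic_supp A \<Xi> - div_supp D.
                 sk_conical A S g \<Gamma> p (1/2 * of_int (cubic_ord A \<Xi> p))))))"
proof -
  interpret surface A by (rule surface.intro[OF assms])
  show ?thesis unfolding Let_def
  proof (intro conjI allI impI ballI)
    fix S \<Xi> h assume "open S \<and> holomorphic_cubic A S \<Xi> \<and> hyperbolic_metric A S h"
    then interpret hc: hyperbolic_cubic A "S - cubic_zeros A S \<Xi>" h \<Xi>
      by (intro hyperbolic_cubic_off_zeros) auto
    show "\<exists>g \<Gamma>. special_kaehler_with A (S - cubic_zeros A S \<Xi>) h \<Xi> g \<Gamma> \<and>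
       (\<forall>g' \<Gamma>'. special_kaehler_with A (S - cubic_zeros A S \<Xi>) h \<Xi> g' \<Gamma>' \<longrightarrow>
          same_structure A (S - cubic_zeros A S \<Xi>) g \<Gamma> g' \<Gamma>')"
      using hc.special_kaehler_with_g_\<Gamma> hc.structure_unique unfolding same_structure_def by metis
  next
    fix \<Xi> h D assume m: "meromorphic_cubic A \<Xi> \<and> cubic_nonzero A \<Xi> \<and> represents_divisor A h D"
    let ?S = "- (cubic_supp A \<Xi> \<union> div_supp D)"
    interpret ss: singular_structure A \<Xi> h "div_supp D" ?S
      by unfold_locales (use m in \<open>auto simp: represents_divisor_def\<close>)
    show "\<exists>g \<Gamma>. special_kaehler_with A ?S h \<Xi> g \<Gamma>" using ss.hc.special_kaehler_with_g_\<Gamma> by blast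
    fix g \<Gamma> p assume sk: "special_kaehler_with A ?S h \<Xi> g \<Gamma>"
    show "sk_logarithmic A ?S g \<Gamma> p (1/2 * (of_int (cubic_ord A \<Xi> p) + 1))"
      if "metric_cusp A (- div_supp D) h p"
      by (rule ss.logarithmic[OF sk ss.H_cusp[OF that]])
    show "sk_conical A ?S g \<Gamma> p (1/2 * (of_int (cubic_ord A \<Xi> p) - \<alpha>))"
      if con: "metric_conical A (- div_supp D) h p \<alpha>" for \<alpha>
    proof (rule ss.conical[OF sk _ ss.H_conical(2)[OF con]])
      show "\<alpha> > - 1" using con by (simp add: metric_conical_def)
    qed
    show "sk_conical A ?S g \<Gamma> p (1/2 * of_int (cubic_ord A \<Xi> p))" if "p \<in> cubic_supp A \<Xi> - div_supp D"
      using ss.conical[OF sk, of 0 p] ss.H_smooth[of p] that by simp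
  qed
qed

end
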